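(* Let $(c,\kappa)\in\tilde{\mathcal{D}}$ and let $u\in\mathcal{X}(\mathbb{R})$ be a singular solution to $\mathrm{TW}(c,\kappa)$ (i.e. a weak solution which is not in $C^2(\mathbb{R})$), so that $u$ is nontrivial and the set $\Gamma(u)=\{x\in\mathbb{R}:|u(x)|^2=1/(2\kappa)\}$ is nonempty and bounded. Let $\mathfrak{a}=\inf\Gamma(u)$ and $\mathfrak{b}=\sup\Gamma(u)$, and assume (without loss of generality, by translation) that $\mathfrak{b}=0$. Then $\eta=1-|u|^2$ satisfies, for all $x\ge0$, $$\eta(x)=f_{c,\kappa}^{-1}(x)\ \text{if }(c,\kappa)\in\mathcal{D}_1,\quad \eta(x)=h_{c,\kappa}^{-1}(x)\ \text{if }(c,\kappa)\in\mathcal{D}_3,\quad \eta(x)=g_{\kappa}^{-1}(x)\ \text{if }(c,\kappa)\in\mathcal{B}_-,\quad \eta(x)=\tilde g_{\kappa}^{-1}(x)\ \text{if }(c,\kappa)\in\mathcal{B}_+,$$ and for all $x\le\mathfrak{a}$, $\eta(x)=\eta(\mathfrak{a}-x)$. Additionally, for all $x\in(-\infty,\mathfrak{a})\cup(0,\infty)$, one has $1-\frac1{2\kappa}<\eta(x)<0$ if $(c,\kappa)\in\mathcal{D}_1\cup\mathcal{B}_-$, whereas $0<\eta(x)<1-\frac1{2\kappa}$ if $(c,\kappa)\in\mathcal{D}_3\cup\mathcal{B}_+$, and $u$ is given there by $$u(x)=\sqrt{1-\eta(x)}\,e^{i\theta(x)},\qquad \theta'(x)=\frac{c\,\eta(x)}{2-2\eta(x)}.$$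 Also $u\in C^\infty((-\infty,\mathfrak{a})\cup(0,\infty))\cap C(\mathbb{R})$. Moreover, $\eta'(\mathfrak{a}^-)=-\infty$ and $\eta'(0^+)=+\infty$ if $(c,\kappa)\in\mathcal{D}_1\cup\mathcal{B}_-$, while $\eta'(\mathfrak{a}^-)=+\infty$ and $\eta'(0^+)=-\infty$ if $(c,\kappa)\in\mathcal{D}_3\cup\mathcal{B}_+$. Finally, for all $j\in\mathbb{N}$ there exist $C_1,C_2,C_3>0$ such that, for all $x\ge1$: $|D^ju'(x)|+|D^j\eta(x)|\le C_1e^{-C_2x}$ if $(c,\kappa)\in\mathcal{D}_1\cup\mathcal{D}_3$, and $|D^ju'(x)|+|D^j\eta(x)|\le C_3x^{-(2+j)}$ if $(c,\kappa)\in\mathcal{B}_+\cup\mathcal{B}_-$.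
   Context: For $z_1,z_2\in\mathbb{C}$, $\langle z_1,z_2\rangle=\operatorname{Re}(z_1\overline{z_2})$. Energy space: $\mathcal{X}(\mathbb{R})=\{v\in H^1_{\mathrm{loc}}(\mathbb{R};\mathbb{C}): 1-|v|^2\in L^2(\mathbb{R}),\ v'\in L^2(\mathbb{R})\}$; its elements are continuous and $|v(x)|\to1$ as $|x|\to\infty$. $\mathrm{TW}(c,\kappa)$ is the equation $icu'+u''+u(1-|u|^2)+\kappa u(1-|u|^2)''=0$. A function $u\in\mathcal{X}(\mathbb{R})$ is a weak solution if for all $\phi\in C_0^\infty(\mathbb{R};\mathbb{C})$, $$\int_{\mathbb{R}}\langle icu'+u(1-|u|^2),\phi\rangle-\langle u',\phi'\rangle+2\kappa\langle u,u'\rangle\langle u,\phi\rangle'=0.$$ A solution is trivial if it is a constant of modulus one. Parameter sets: $\mathcal{D}_1=\{0\le c<\sqrt2,\ 0<\kappa<1/2\}$, $\mathcal{D}_3=\{c>\sqrt2,\ \kappa>1/2\}$, $\mathcal{B}_-=\{c=\sqrt2,\ 0<\kappa<1/2\}$, $\mathcal{B}_+=\{c=\sqrt2,\ \kappa>1/2\}$, $\tilde{\mathcal{D}}=\mathcal{D}_1\cup\mathcal{D}_3\cup\mathcal{B}_-\cup\mathcal{B}_+$. Functions: $\mathfrak{T}_\kappa=[1-\frac1{2\kappa},0)$ if $0<\kappa<1/2$; $\mathfrak{J}_\kappa=(0,1-\frac1{2\kappa}]$ if $\kappa>1/2$. For $(c,\kappa)\in\mathcal{D}_1$, $f_{c,\kappa}:\mathfrak{T}_\kappa\to\mathbb{R}$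 is $$f_{c,\kappa}(y)=2\sqrt\kappa\arctan\Big(\sqrt\kappa\sqrt{\tfrac{2-c^2-2y}{1-2\kappa+2\kappa y}}\Big)+2\sqrt{\tfrac{1-2\kappa}{2-c^2}}\operatorname{artanh}\Big(\sqrt{\tfrac{(2-c^2)(1-2\kappa+2\kappa y)}{(1-2\kappa)(2-c^2-2y)}}\Big)-\pi\sqrt\kappa.$$ For $(c,\kappa)\in\mathcal{D}_3$, $h_{c,\kappa}:\mathfrak{J}_\kappa\to\mathbb{R}$ is given by the same formula. For $(\sqrt2,\kappa)\in\mathcal{B}_-$, $g_\kappa:\mathfrak{T}_\kappa\to\mathbb{R}$ is $$g_\kappa(y)=2\sqrt\kappa\arctan\Big(\sqrt{\tfrac{-2\kappa y}{1-2\kappa+2\kappa y}}\Big)+\sqrt2\sqrt{-\tfrac{1-2\kappa+2\kappa y}{y}}-\pi\sqrt\kappa,$$ and for $(\sqrt2,\kappa)\in\mathcal{B}_+$, $\tilde g_\kappa:\mathfrak{J}_\kappa\to\mathbb{R}$ is given by the same formula as $g_\kappa$. At $y=1-\frac1{2\kappa}$ the formulas are understood by continuity ($\arctan(+\infty)=\pi/2$), giving the value $0$. These functions are continuous, injective, and tend to $+\infty$ as $y\to0$, so they are bijections onto $[0,\infty)$ and their inverses are defined on $[0,\infty)$. *)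

theory Defs
  imports "HOL-Analysis.Analysis"
begin

text \<open>The pairing of the paper on complex numbers is the library's real inner product.\<close>

lemma inner_complex_eq_Re: "z \<bullet> w = Re (z * cnj w)" for z w :: complex
  by (simp add: inner_complex_def)

definition Dn :: "nat \<Rightarrow> (real \<Rightarrow> 'a::real_normed_vector) \<Rightarrow> real \<Rightarrow> 'a" where
  "Dn j f = ((\<lambda>g x. vector_derivative g (at x)) ^^ j) f"

text \<open>Meant for open \<open>S\<close> only, since the derivatives are two-sided.\<close>

definition Ck_on :: "nat \<Rightarrow> (real \<Rightarrow> 'a::real_normed_vector) \<Rightarrow> real set \<Rightarrow> bool" where
  "Ck_on k f S \<longleftrightarrow> (\<forall>j\<le>k. continuous_on S (Dn j f)) \<and>
     (\<forall>j<k. \<forall>x\<in>S. Dn j f differentiable (at x))"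

definition smooth_on :: "(real \<Rightarrow> 'a::real_normed_vector) \<Rightarrow> real set \<Rightarrow> bool" where
  "smooth_on f S \<longleftrightarrow> (\<forall>k. Ck_on k f S)"

definition test_fun :: "(real \<Rightarrow> 'a::real_normed_vector) \<Rightarrow> bool" where
  "test_fun \<phi> \<longleftrightarrow> smooth_on \<phi> UNIV \<and> compact (closure {x. \<phi> x \<noteq> 0})"

text \<open>Function spaces consist of Borel functions; no quotient by equality almost everywhere is taken.\<close>

definition L1_loc :: "(real \<Rightarrow> 'a::euclidean_space) set" where
  "L1_loc = {f \<in> borel_measurable lborel. \<forall>K. compact K \<longrightarrow> set_integrable lborel K f}"

definition L2_loc :: "(real \<Rightarrow> 'a::euclidean_space) set" where
  "L2_loc = {f \<in> borel_measurable lborel.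
     \<forall>K. compact K \<longrightarrow> set_integrable lborel K (\<lambda>x. (norm (f x))\<^sup>2)}"

definition L2 :: "(real \<Rightarrow> 'a::euclidean_space) set" where
  "L2 = {f \<in> borel_measurable lborel. integrable lborel (\<lambda>x. (norm (f x))\<^sup>2)}"

definition has_weak_deriv ::
  "(real \<Rightarrow> 'a::euclidean_space) \<Rightarrow> (real \<Rightarrow> 'a) \<Rightarrow> bool" where
  "has_weak_deriv u v \<longleftrightarrow> u \<in> L1_loc \<and> v \<in> L1_loc \<and>
     (\<forall>\<psi> :: real \<Rightarrow> real. test_fun \<psi> \<longrightarrow>
        (LINT x|lborel. vector_derivative \<psi> (at x) *\<^sub>R u x) = - (LINT x|lborel. \<psi> x *\<^sub>R v x))"

text \<open>Weak derivatives are unique up to null sets; this selects a representative.\<close>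

definition weak_deriv :: "(real \<Rightarrow> 'a::euclidean_space) \<Rightarrow> real \<Rightarrow> 'a" where
  "weak_deriv u = (SOME v. has_weak_deriv u v)"

definition H1_loc :: "(real \<Rightarrow> 'a::euclidean_space) set" where
  "H1_loc = {u \<in> L2_loc. \<exists>v \<in> L2_loc. has_weak_deriv u v}"

text \<open>Elements of the energy space are identified with their continuous representatives.\<close>

definition energy_space :: "(real \<Rightarrow> complex) set" where
  "energy_space = {v \<in> H1_loc. continuous_on UNIV v \<and>
     (\<lambda>x. 1 - (norm (v x))\<^sup>2) \<in> L2 \<and> weak_deriv v \<in> L2}"

definition weak_solution :: "real \<Rightarrow> real \<Rightarrow> (real \<Rightarrow> complex) \<Rightarrow> bool" where
  "weak_solution c \<kappa> u \<longleftrightarrow> u \<in> energy_space \<and>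
     (\<forall>\<phi> :: real \<Rightarrow> complex. test_fun \<phi> \<longrightarrow>
       (LINT x|lborel.
          (\<i> * complex_of_real c * weak_deriv u x
             + u x * complex_of_real (1 - (norm (u x))\<^sup>2)) \<bullet> \<phi> x
          - weak_deriv u x \<bullet> vector_derivative \<phi> (at x)
          + 2 * \<kappa> * (u x \<bullet> weak_deriv u x) * weak_deriv (\<lambda>t. u t \<bullet> \<phi> t) x) = 0)"

definition singular_solution :: "real \<Rightarrow> real \<Rightarrow> (real \<Rightarrow> complex) \<Rightarrow> bool" where
  "singular_solution c \<kappa> u \<longleftrightarrow> weak_solution c \<kappa> u \<and> \<not> Ck_on 2 u UNIV"

definition trivial_solution :: "(real \<Rightarrow> complex) \<Rightarrow> bool" where
  "trivial_solution u \<longleftrightarrow> (\<exists>z. norm z = 1 \<and> u = (\<lambda>x. z))"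

definition Gamma_set :: "real \<Rightarrow> (real \<Rightarrow> complex) \<Rightarrow> real set" where
  "Gamma_set \<kappa> u = {x. (norm (u x))\<^sup>2 = 1 / (2 * \<kappa>)}"

definition D1 :: "(real \<times> real) set" where
  "D1 = {(c, \<kappa>). 0 \<le> c \<and> c < sqrt 2 \<and> 0 < \<kappa> \<and> \<kappa> < 1 / 2}"

definition D3 :: "(real \<times> real) set" where
  "D3 = {(c, \<kappa>). c > sqrt 2 \<and> \<kappa> > 1 / 2}"

definition B_minus :: "(real \<times> real) set" where
  "B_minus = {(c, \<kappa>). c = sqrt 2 \<and> 0 < \<kappa> \<and> \<kappa> < 1 / 2}"

definition B_plus :: "(real \<times> real) set" where
  "B_plus = {(c, \<kappa>). c = sqrt 2 \<and> \<kappa> > 1 / 2}"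

definition D_tilde :: "(real \<times> real) set" where
  "D_tilde = D1 \<union> D3 \<union> B_minus \<union> B_plus"

definition T_dom :: "real \<Rightarrow> real set" where
  "T_dom \<kappa> = {1 - 1 / (2 * \<kappa>)..<0}"

definition J_dom :: "real \<Rightarrow> real set" where
  "J_dom \<kappa> = {0<..1 - 1 / (2 * \<kappa>)}"

text \<open>At \<open>y = 1 - 1 / (2 * \<kappa>)\<close> the argument of the arctangent below is \<open>+\<infinity>\<close> in the
  paper, but division by zero gives \<open>0\<close> in HOL; hence the explicit limit value there.
  The functions f and h of the paper share one formula, as do g and its tilde variant; they
  differ in their domain, \<open>T_dom \<kappa>\<close> or \<open>J_dom \<kappa>\<close>.\<close>

definition fh :: "real \<Rightarrow> real \<Rightarrow> real \<Rightarrow> real" where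
  "fh c \<kappa> y = (if y = 1 - 1 / (2 * \<kappa>) then 0 else
     2 * sqrt \<kappa> * arctan (sqrt \<kappa> * sqrt ((2 - c\<^sup>2 - 2 * y) / (1 - 2 * \<kappa> + 2 * \<kappa> * y)))
     + 2 * sqrt ((1 - 2 * \<kappa>) / (2 - c\<^sup>2))
         * artanh (sqrt (((2 - c\<^sup>2) * (1 - 2 * \<kappa> + 2 * \<kappa> * y))
                          / ((1 - 2 * \<kappa>) * (2 - c\<^sup>2 - 2 * y))))
     - pi * sqrt \<kappa>)"

definition gg :: "real \<Rightarrow> real \<Rightarrow> real" where
  "gg \<kappa> y = (if y = 1 - 1 / (2 * \<kappa>) then 0 else
     2 * sqrt \<kappa> * arctan (sqrt ((- 2 * \<kappa> * y) / (1 - 2 * \<kappa> + 2 * \<kappa> * y)))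
     + sqrt 2 * sqrt (- ((1 - 2 * \<kappa> + 2 * \<kappa> * y) / y))
     - pi * sqrt \<kappa>)"

definition f_inv :: "real \<Rightarrow> real \<Rightarrow> real \<Rightarrow> real" where
  "f_inv c \<kappa> = inv_into (T_dom \<kappa>) (fh c \<kappa>)"

definition h_inv :: "real \<Rightarrow> real \<Rightarrow> real \<Rightarrow> real" where
  "h_inv c \<kappa> = inv_into (J_dom \<kappa>) (fh c \<kappa>)"

definition g_inv :: "real \<Rightarrow> real \<Rightarrow> real" where
  "g_inv \<kappa> = inv_into (T_dom \<kappa>) (gg \<kappa>)"

definition g_tilde_inv :: "real \<Rightarrow> real \<Rightarrow> real" where
  "g_tilde_inv \<kappa> = inv_into (J_dom \<kappa>) (gg \<kappa>)"

end

(*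
  Put w = u' - 2 \<kappa> <u,u'> u. The weak equation says that w' is locally integrable, so w has a
  continuous representative; where s = 1 - 2 \<kappa> |u|^2 is nonzero, u' can be recovered from w, and
  u is C^2 there. Hence \<Gamma>(u) is nonempty for a singular solution. Since u' and \<eta> are square
  integrable, |u| tends to 1 at infinity, so \<Gamma>(u) is bounded and both first integrals (momentum
  and Hamiltonian) vanish on the two unbounded components of its complement. With
  P = 2 - c^2, A = 1 - 2 \<kappa> they combine to (\<eta>')^2 (A + 2 \<kappa> \<eta>) = \<eta>^2 (P - 2 \<eta>), where
  A + 2 \<kappa> \<eta> = s vanishes exactly at the end of the half-line. A Gronwall argument shows that \<eta>
  never vanishes, so \<eta>' = - \<eta> r with r = sqrt ((P - 2 \<eta>) / (A + 2 \<kappa> \<eta>)), and the function f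
  (respectively g) of the statement, written in terms of r, has derivative 1 along \<eta>. The quantities
  r, \<eta>, 1 / (1 - \<eta>) and u solve an ODE system with polynomial right hand sides divisible by \<eta>;
  this gives smoothness and reduces the decay of all derivatives to that of \<eta> (P nonzero) or of r
  (P = 0, where \<eta> is a multiple of r^2).
*)
theory Submission
  imports Defs
begin

section \<open>Algebras of functions closed under differentiation\<close>

text \<open>The real-linear map sending \<open>u'\<close> to \<open>w\<close> fixes the direction
  \<open>\<i> * u\<close> and multiplies the direction \<open>u\<close> by \<open>s\<close>, so it
  is invertible exactly off \<open>\<Gamma>(u)\<close>; all loss of regularity sits there. The
  energy gives only integral bounds, so far out \<open>u'\<close> is small at suitable points but
  not known to be small everywhere. For quantities that are constant on a component such points
  suffice; a bounded component has none, which confines the explicit description to the two outer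
  half-lines. The profile equation is quadratic in \<open>\<eta>'\<close> and degenerates at the
  singular end, so it fixes neither the sign of \<open>\<eta>'\<close> nor an initial slope. The
  sign comes from the limit 0 of \<open>\<eta>\<close>. The variable \<open>r\<close> is preferred
  to \<open>\<eta>\<close> because it tends to infinity at the singular end, where the arctangent
  has the limit behind the prescribed endpoint value. Injectivity of the functions to be inverted is
  a by-product: if \<open>G (\<eta> x) = x\<close> along a half-line and \<open>\<eta>\<close> takes
  all values in the domain of \<open>G\<close>, then \<open>G\<close> is injective there. Symmetry
  follows too, since both half-lines produce the same inverse function.\<close>

inductive_set fun_alg :: "(real \<Rightarrow> 'a::real_normed_algebra_1) set \<Rightarrow> (real \<Rightarrow> 'a) set" for G where
  gen: "g \<in> G \<Longrightarrow> g \<in> fun_alg G"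
| const: "(\<lambda>x. a) \<in> fun_alg G"
| add: "f \<in> fun_alg G \<Longrightarrow> g \<in> fun_alg G \<Longrightarrow> (\<lambda>x. f x + g x) \<in> fun_alg G"
| mult: "f \<in> fun_alg G \<Longrightarrow> g \<in> fun_alg G \<Longrightarrow> (\<lambda>x. f x * g x) \<in> fun_alg G"

text \<open>The Leibniz rule keeps a factor common to the derivatives of all generators. With
  \<open>\<rho> = \<zeta>\<close> this records that every derivative is divisible by the profile,
  which is the source of the decay estimates.\<close>

lemma fun_alg_deriv_factor:
  fixes G :: "(real \<Rightarrow> 'a::real_normed_field) set"
  assumes "\<And>g. g \<in> G \<Longrightarrow> \<exists>h\<in>fun_alg G. \<forall>x\<in>S. (g has_vector_derivative \<rho> x * h x) (at x)"
    and "f \<in> fun_alg G"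
  shows "\<exists>h\<in>fun_alg G. \<forall>x\<in>S. (f has_vector_derivative \<rho> x * h x) (at x)"
  using assms(2)
proof induction
  case (gen g)
  then show ?case using assms(1) by blast
next
  case (const a)
  show ?case
    by (rule bexI[of _ "\<lambda>x. 0"]) (auto intro: fun_alg.const)
next
  case (add f g)
  then obtain f' g' where "f' \<in> fun_alg G" "g' \<in> fun_alg G"
    "\<forall>x\<in>S. (f has_vector_derivative \<rho> x * f' x) (at x)" "\<forall>x\<in>S. (g has_vector_derivative \<rho> x * g' x) (at x)"
    by blast
  then show ?case
    by (intro bexI[of _ "\<lambda>x. f' x + g' x"])
      (auto intro: fun_alg.add has_vector_derivative_add simp: distrib_left)
next
  case (mult f g)
  then obtain f' g' where fg: "f' \<in> fun_alg G" "g' \<in> fun_alg G"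
    "\<forall>x\<in>S. (f has_vector_derivative \<rho> x * f' x) (at x)" "\<forall>x\<in>S. (g has_vector_derivative \<rho> x * g' x) (at x)"
    by blast
  have "((\<lambda>x. f x * g x) has_vector_derivative \<rho> x * (f x * g' x + f' x * g x)) (at x)" if "x \<in> S" for x
    using has_vector_derivative_mult[of f "\<rho> x * f' x" x UNIV g "\<rho> x * g' x"] fg that
    by (simp add: algebra_simps)
  with fg mult show ?case
    by (intro bexI[of _ "\<lambda>x. f x * g' x + f' x * g x"]) (auto intro: fun_alg.add fun_alg.mult)
qed

lemma fun_alg_deriv:
  fixes G :: "(real \<Rightarrow> 'a::real_normed_field) set"
  assumes "\<And>g. g \<in> G \<Longrightarrow> \<exists>g'\<in>fun_alg G. \<forall>x\<in>S. (g has_vector_derivative g' x) (at x)"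
    and "f \<in> fun_alg G"
  shows "\<exists>f'\<in>fun_alg G. \<forall>x\<in>S. (f has_vector_derivative f' x) (at x)"
  using fun_alg_deriv_factor[where \<rho> = "\<lambda>_. 1", simplified, OF assms] .

lemma fun_alg_bounded:
  assumes "\<And>g. g \<in> G \<Longrightarrow> \<exists>B. \<forall>x\<in>S. norm (g x) \<le> B" and "f \<in> fun_alg G"
  shows "\<exists>B. \<forall>x\<in>S. norm (f x) \<le> B"
  using assms(2)
proof induction
  case (gen g)
  then show ?case using assms(1) by blast
next
  case (add f g)
  then obtain B B' where "\<forall>x\<in>S. norm (f x) \<le> B" "\<forall>x\<in>S. norm (g x) \<le> B'"
    by blast
  then show ?case
    by (intro exI[of _ "B + B'"]) (auto intro: norm_triangle_mono)
next
  case (mult f g)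
  then obtain B B' where "\<forall>x\<in>S. norm (f x) \<le> B" "\<forall>x\<in>S. norm (g x) \<le> B'"
    by blast
  then show ?case
    by (intro exI[of _ "B * B'"]) (auto intro!: order.trans[OF norm_mult_ineq] mult_mono
      order.trans[OF norm_ge_zero])
qed auto

lemma fun_alg_const_mult: "f \<in> fun_alg G \<Longrightarrow> (\<lambda>x. a * f x) \<in> fun_alg G"
  by (rule fun_alg.mult[OF fun_alg.const])

lemma fun_alg_diff: "f \<in> fun_alg G \<Longrightarrow> g \<in> fun_alg G \<Longrightarrow> (\<lambda>x. f x - g x) \<in> fun_alg G"
  using fun_alg.add[OF _ fun_alg_const_mult, of f G g "-1"] by simp

lemma fun_alg_power: "f \<in> fun_alg G \<Longrightarrow> (\<lambda>x. f x ^ n) \<in> fun_alg G"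
  by (induction n) (auto intro: fun_alg.intros)

section \<open>Iterated derivatives and smooth functions\<close>

lemma Dn_0 [simp]: "Dn 0 f = f"
  by (simp add: Dn_def)

lemma Dn_Suc: "Dn (Suc j) f = (\<lambda>x. vector_derivative (Dn j f) (at x))"
  by (simp add: Dn_def)

lemma Dn_1: "Dn 1 f = (\<lambda>x. vector_derivative f (at x))"
  using Dn_Suc[of 0 f] by simp

text \<open>The grade counts differentiations: a constant family \<open>M\<close> gives smoothness,
  a graded one gives decay that improves with each derivative. Agreement of \<open>f\<close> and
  \<open>g\<close> on the open \<open>S\<close> is enough because derivatives are local. The
  existence of \<open>d\<close> is carried along because \<open>vector_derivative\<close> has a
  value even where no derivative exists.\<close>

lemma Dn_graded_class:
  assumes "open S"
    and M: "\<And>k g. g \<in> M k \<Longrightarrow> \<exists>g'\<in>M (Suc k). \<forall>x\<in>S. (g has_vector_derivative g' x) (at x)"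
    and g: "g \<in> M k" "\<And>x. x \<in> S \<Longrightarrow> f x = g x"
  shows "\<exists>h\<in>M (k + j). \<forall>x\<in>S. Dn j f x = h x \<and> (\<exists>d. (Dn j f has_vector_derivative d) (at x))"
proof (induction j)
  case 0
  obtain g' where "\<forall>x\<in>S. (g has_vector_derivative g' x) (at x)"
    using M[OF g(1)] by blast
  moreover have "(f has_vector_derivative g' x) (at x)"
    if "x \<in> S" "(g has_vector_derivative g' x) (at x)" for x
    using has_vector_derivative_transform_within_open[OF that(2) \<open>open S\<close> that(1)] g(2) by metis
  ultimately show ?case
    using g by auto
next
  case (Suc j)
  then obtain h where h: "h \<in> M (k + j)" "\<And>x. x \<in> S \<Longrightarrow> Dn j f x = h x"
    by blast
  obtain h' where h': "h' \<in> M (Suc (k + j))" "\<And>x. x \<in> S \<Longrightarrow> (h has_vector_derivative h' x) (at x)"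
    using M[OF h(1)] by blast
  have eq: "Dn (Suc j) f x = h' x" if "x \<in> S" for x
  proof -
    have "(Dn j f has_vector_derivative h' x) (at x)"
      using has_vector_derivative_transform_within_open[OF h'(2)[OF that] \<open>open S\<close> that] h(2) by metis
    then show ?thesis
      by (simp add: Dn_Suc vector_derivative_at)
  qed
  obtain h'' where h'': "\<And>x. x \<in> S \<Longrightarrow> (h' has_vector_derivative h'' x) (at x)"
    using M[OF h'(1)] by blast
  have "(Dn (Suc j) f has_vector_derivative h'' x) (at x)" if "x \<in> S" for x
    using has_vector_derivative_transform_within_open[OF h''[OF that] \<open>open S\<close> that] eq by metis
  then show ?case
    using h'(1) eq by auto
qed

lemma smooth_onI:
  assumes "\<And>j x. x \<in> S \<Longrightarrow> \<exists>d. (Dn j f has_vector_derivative d) (at x)"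
  shows "smooth_on f S"
proof -
  have "Dn j f differentiable at x" if "x \<in> S" for j x
    using assms[OF that] differentiableI_vector by blast
  then show ?thesis
    unfolding smooth_on_def Ck_on_def
    by (auto intro!: continuous_at_imp_continuous_on differentiable_imp_continuous_within)
qed

lemma smooth_on_class:
  assumes "open S" "f \<in> M"
    and "\<And>g. g \<in> M \<Longrightarrow> \<exists>g'\<in>M. \<forall>x\<in>S. (g has_vector_derivative g' x) (at x)"
  shows "smooth_on f S"
proof (rule smooth_onI)
  fix j x assume "x \<in> S"
  then show "\<exists>d. (Dn j f has_vector_derivative d) (at x)"
    using Dn_graded_class[of S "\<lambda>_. M" f 0 f j] assms by blast
qed

lemma smooth_on_Dn:
  assumes "smooth_on f S" "x \<in> S"
  shows "(Dn j f has_vector_derivative Dn (Suc j) f x) (at x)"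
  using assms unfolding smooth_on_def Ck_on_def Dn_Suc
  by (metis lessI vector_derivative_works)

lemma smooth_on_deriv:
  assumes "smooth_on f S" "x \<in> S"
  shows "(f has_vector_derivative Dn 1 f x) (at x)"
  using smooth_on_Dn[OF assms, of 0] by simp

lemma smooth_on_continuous_Dn: "smooth_on f S \<Longrightarrow> continuous_on S (Dn j f)"
  unfolding smooth_on_def Ck_on_def by blast

lemma smooth_on_fun_alg:
  fixes G :: "(real \<Rightarrow> 'a::real_normed_field) set"
  assumes "open S" "\<And>g. g \<in> G \<Longrightarrow> \<exists>g'\<in>fun_alg G. \<forall>x\<in>S. (g has_vector_derivative g' x) (at x)"
    and "f \<in> fun_alg G"
  shows "smooth_on f S"
  using smooth_on_class[OF assms(1,3)] fun_alg_deriv[OF assms(2)] by blast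

lemma smooth_on_linear:
  assumes "bounded_linear L" "smooth_on f S" "open S"
  shows "smooth_on (\<lambda>x. L (f x)) S"
proof (rule smooth_on_class[OF \<open>open S\<close>, where M = "range (\<lambda>j x. L (Dn j f x))"])
  have "(\<lambda>x. L (f x)) = (\<lambda>x. L (Dn 0 f x))" by simp
  then show "(\<lambda>x. L (f x)) \<in> range (\<lambda>j x. L (Dn j f x))" by blast
next
  fix g assume "g \<in> range (\<lambda>j x. L (Dn j f x))"
  then obtain j where "g = (\<lambda>x. L (Dn j f x))" by blast
  then show "\<exists>g'\<in>range (\<lambda>j x. L (Dn j f x)). \<forall>x\<in>S. (g has_vector_derivative g' x) (at x)"
    using bounded_linear.has_vector_derivative[OF assms(1) smooth_on_Dn[OF assms(2)], of _ j]
    by (intro bexI[of _ "\<lambda>x. L (Dn (Suc j) f x)"]) auto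
qed

text \<open>Makes the algebra generated by all derivatives of \<open>f\<close> and \<open>g\<close>
  closed under differentiation, so that products and differences are smooth without a Leibniz
  formula of higher order.\<close>

lemma smooth_on_common_class:
  fixes f g :: "real \<Rightarrow> 'a::real_normed_field"
  assumes "smooth_on f S" "smooth_on g S" "h \<in> range (\<lambda>j. Dn j f) \<union> range (\<lambda>j. Dn j g)"
  shows "\<exists>h'\<in>fun_alg (range (\<lambda>j. Dn j f) \<union> range (\<lambda>j. Dn j g)). \<forall>x\<in>S. (h has_vector_derivative h' x) (at x)"
proof -
  from assms(3) obtain j where "h = Dn j f \<or> h = Dn j g" by blast
  then show ?thesis
  proof
    assume "h = Dn j f"
    then show ?thesis
      using smooth_on_Dn[OF assms(1)] by (intro bexI[of _ "Dn (Suc j) f"]) (auto intro: fun_alg.gen)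
  next
    assume "h = Dn j g"
    then show ?thesis
      using smooth_on_Dn[OF assms(2)] by (intro bexI[of _ "Dn (Suc j) g"]) (auto intro: fun_alg.gen)
  qed
qed

lemma smooth_on_in_common_class:
  "f \<in> fun_alg (range (\<lambda>j. Dn j f) \<union> X)" "g \<in> fun_alg (X \<union> range (\<lambda>j. Dn j g))"
  by (rule fun_alg.gen, metis Dn_0 UnI1 UnI2 rangeI)+

lemma smooth_on_mult:
  fixes f g :: "real \<Rightarrow> 'a::real_normed_field"
  assumes "smooth_on f S" "smooth_on g S" "open S"
  shows "smooth_on (\<lambda>x. f x * g x) S"
  by (rule smooth_on_fun_alg[OF assms(3) smooth_on_common_class[OF assms(1,2)]])
    (auto intro: fun_alg.mult smooth_on_in_common_class)

lemma smooth_on_diff: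
  fixes f g :: "real \<Rightarrow> 'a::real_normed_field"
  assumes "smooth_on f S" "smooth_on g S" "open S"
  shows "smooth_on (\<lambda>x. f x - g x) S"
  by (rule smooth_on_fun_alg[OF assms(3) smooth_on_common_class[OF assms(1,2)]])
    (auto intro: fun_alg_diff smooth_on_in_common_class)

lemma smooth_on_antideriv:
  assumes "smooth_on f S" "open S" "\<And>x. x \<in> S \<Longrightarrow> (F has_vector_derivative f x) (at x)"
  shows "smooth_on F S"
proof (rule smooth_on_class[OF \<open>open S\<close>, where M = "insert F (range (\<lambda>j. Dn j f))"])
  fix g assume "g \<in> insert F (range (\<lambda>j. Dn j f))"
  then consider "g = F" | j where "g = Dn j f" by blast
  then show "\<exists>g'\<in>insert F (range (\<lambda>j. Dn j f)). \<forall>x\<in>S. (g has_vector_derivative g' x) (at x)"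
  proof cases
    case 1
    have "f \<in> range (\<lambda>j. Dn j f)" by (metis Dn_0 rangeI)
    with 1 assms(3) show ?thesis by blast
  next
    case 2
    then show ?thesis using smooth_on_Dn[OF assms(1)] by blast
  qed
qed simp

section \<open>Test functions and smooth bumps\<close>

lemma test_fun_iff:
  "test_fun \<phi> \<longleftrightarrow> smooth_on \<phi> UNIV \<and> (\<exists>R>0. \<forall>x. \<phi> x \<noteq> 0 \<longrightarrow> \<bar>x\<bar> \<le> R)"
proof -
  have "compact (closure {x. \<phi> x \<noteq> 0}) \<longleftrightarrow> bounded {x. \<phi> x \<noteq> 0}"
    by (metis bounded_closure bounded_subset closure_subset compact_eq_bounded_closed closed_closure)
  then show ?thesis
    by (auto simp: test_fun_def bounded_pos)
qed

text \<open>The powers of \<open>1 / x\<close> make the family closed under differentiation.\<close>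

definition flat_exp :: "nat \<Rightarrow> real \<Rightarrow> real" where
  "flat_exp k x = (if x > 0 then inverse x ^ k * exp (- inverse x) else 0)"

lemma flat_exp_tendsto_0: "(flat_exp k \<longlongrightarrow> 0) (at 0)"
proof -
  have "((\<lambda>x. inverse x ^ k / exp (inverse x)) \<longlongrightarrow> (0::real)) (at_right 0)"
    by (rule filterlim_compose[OF tendsto_power_div_exp_0 filterlim_inverse_at_top_right])
  then have "(flat_exp k \<longlongrightarrow> 0) (at_right 0)"
    by (rule Lim_transform_eventually)
      (auto simp: flat_exp_def exp_minus field_simps eventually_at_filter)
  moreover have "(flat_exp k \<longlongrightarrow> 0) (at_left 0)"
    by (rule Lim_transform_eventually[OF tendsto_const])
      (auto simp: flat_exp_def eventually_at_filter)
  ultimately show ?thesis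
    by (simp add: filterlim_at_split)
qed

lemma flat_exp_deriv:
  "(flat_exp k has_real_derivative flat_exp (k + 2) x - real k * flat_exp (k + 1) x) (at x)"
proof -
  consider "x > 0" | "x = 0" | "x < 0" by linarith
  then show ?thesis
  proof cases
    case 1
    have "((\<lambda>x. inverse x ^ k * exp (- inverse x)) has_real_derivative
        flat_exp (k + 2) x - real k * flat_exp (k + 1) x) (at x)"
      \<comment> \<open>Differentiating the \<open>k\<close>-th power produces the exponent
        \<open>k - 1\<close>, which is truncated for \<open>k = 0\<close>; hence the case
        distinction.\<close>
      using 1 power_Suc[of "inverse x" "k - 1"]
      by (cases "k = 0") (auto intro!: derivative_eq_intros simp: flat_exp_def algebra_simps power2_eq_square)
    then show ?thesis
      by (rule DERIV_cong_ev[THEN iffD1, rotated 3])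
        (use 1 eventually_nhds_in_open[of "{0<..}" x] in \<open>auto simp: flat_exp_def elim!: eventually_mono\<close>)
  next
    case 2
    \<comment> \<open>The difference quotient at 0 is \<open>flat_exp (k + 1)\<close> itself, so the
      derivative there reduces to the limit already known.\<close>
    have "((\<lambda>h. (flat_exp k (0 + h) - flat_exp k 0) / h) \<longlongrightarrow> 0) (at 0)"
      by (rule Lim_transform_eventually[OF flat_exp_tendsto_0[of "k + 1"]])
        (auto simp: flat_exp_def eventually_at_filter field_simps)
    then show ?thesis
      using 2 unfolding DERIV_def by (simp add: flat_exp_def)
  next
    case 3
    have "((\<lambda>x. 0) has_real_derivative 0) (at x)" by simp
    then show ?thesis
      by (rule DERIV_cong_ev[THEN iffD1, rotated 3])
        (use 3 eventually_nhds_in_open[of "{..<0}" x] in \<open>auto simp: flat_exp_def elim!: eventually_mono\<close>)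
  qed
qed

text \<open>\<open>n\<close> is a steepness: inside the interval each factor is
  \<open>exp (- 1 / (n * t))\<close>, with \<open>t\<close> the distance to one of the ends, and
  tends to 1 as \<open>n\<close> grows. Indicators of open intervals are thus limits of explicit
  test functions bounded by 1.\<close>

definition bump :: "real \<Rightarrow> real \<Rightarrow> real \<Rightarrow> real \<Rightarrow> real" where
  "bump a b n x = flat_exp 0 (n * x - n * a) * flat_exp 0 (n * b - n * x)"

lemma smooth_bump: "smooth_on (bump a b n) UNIV"
proof -
  define G where "G = {f. \<exists>k \<alpha> \<beta>. f = (\<lambda>x. flat_exp k (\<alpha> * x + \<beta>))}"
  have "\<exists>g'\<in>fun_alg G. \<forall>x\<in>UNIV. (g has_vector_derivative g' x) (at x)" if "g \<in> G" for g
  proof -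
    from that obtain k \<alpha> \<beta> where g: "g = (\<lambda>x. flat_exp k (\<alpha> * x + \<beta>))"
      unfolding G_def by blast
    define g' where "g' = (\<lambda>x. \<alpha> * (flat_exp (k + 2) (\<alpha> * x + \<beta>) - real k * flat_exp (k + 1) (\<alpha> * x + \<beta>)))"
    have "g' \<in> fun_alg G"
      unfolding g'_def by (intro fun_alg_const_mult fun_alg_diff fun_alg.gen) (auto simp: G_def)
    moreover have "(g has_real_derivative g' x) (at x)" for x
    proof -
      have "((\<lambda>x. \<alpha> * x + \<beta>) has_real_derivative \<alpha>) (at x)"
        by (auto intro!: derivative_eq_intros)
      from DERIV_chain2[OF flat_exp_deriv this, of k] show ?thesis
        by (simp add: g g'_def mult.commute)
    qed
    ultimately show ?thesis
      by (auto simp: has_real_derivative_iff_has_vector_derivative)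
  qed
  moreover have "bump a b n \<in> fun_alg G"
  proof -
    have "(\<lambda>x. flat_exp 0 (n * x + (- n * a))) \<in> G" "(\<lambda>x. flat_exp 0 ((- n) * x + n * b)) \<in> G"
      unfolding G_def by blast+
    then have "(\<lambda>x. flat_exp 0 (n * x + (- n * a)) * flat_exp 0 ((- n) * x + n * b)) \<in> fun_alg G"
      by (intro fun_alg.mult fun_alg.gen)
    also have "(\<lambda>x. flat_exp 0 (n * x + (- n * a)) * flat_exp 0 ((- n) * x + n * b)) = bump a b n"
      by (auto simp: bump_def fun_eq_iff)
    finally show ?thesis .
  qed
  ultimately show ?thesis
    by (intro smooth_on_fun_alg) auto
qed

lemma flat_exp_0_bounds: "0 \<le> flat_exp 0 x" "flat_exp 0 x \<le> 1"
  by (auto simp: flat_exp_def)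

lemma bump_bounds: "0 \<le> bump a b n x" "bump a b n x \<le> 1"
  by (auto simp: bump_def flat_exp_0_bounds intro!: mult_le_one)

lemma bump_eq_0_iff: "n > 0 \<Longrightarrow> bump a b n x = 0 \<longleftrightarrow> \<not> (a < x \<and> x < b)"
  by (auto simp: bump_def flat_exp_def)

lemma test_fun_bump: "n > 0 \<Longrightarrow> test_fun (bump a b n)"
  unfolding test_fun_iff
  by (auto simp: smooth_bump bump_eq_0_iff intro!: exI[of _ "\<bar>a\<bar> + \<bar>b\<bar> + 1"])

lemma bump_limit:
  "(\<lambda>n. bump a b (real (Suc n)) x) \<longlonglongrightarrow> indicator {a<..<b} x"
proof -
  have *: "(\<lambda>n. flat_exp 0 (real (Suc n) * y)) \<longlonglongrightarrow> (if y > 0 then 1 else 0)" for y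
  proof (cases "y > 0")
    case True
    have "(\<lambda>n. exp (- (inverse (real (Suc n)) * inverse y))) \<longlonglongrightarrow> exp (- (0 * inverse y))"
      by (intro tendsto_intros LIMSEQ_inverse_real_of_nat)
    then show ?thesis using True by (simp add: flat_exp_def)
  next
    case False
    then have "\<not> real (Suc n) * y > 0" for n
      by (simp add: zero_less_mult_iff)
    then show ?thesis using False by (simp add: flat_exp_def)
  qed
  have "bump a b n x = flat_exp 0 (n * (x - a)) * flat_exp 0 (n * (b - x))" for n
    by (simp add: bump_def algebra_simps)
  moreover have "(\<lambda>n. flat_exp 0 (real (Suc n) * (x - a)) * flat_exp 0 (real (Suc n) * (b - x)))
      \<longlonglongrightarrow> (if x - a > 0 then 1 else 0) * (if b - x > 0 then 1 else 0)"
    by (intro tendsto_mult *)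
  moreover have "(if x - a > 0 then 1 else 0) * (if b - x > 0 then 1 else 0) = (indicator {a<..<b} x :: real)"
    by (auto simp: indicator_def)
  ultimately show ?thesis
    by simp
qed

section \<open>Weak derivatives on the line\<close>

lemma test_fun_Dn:
  assumes "test_fun \<phi>"
  shows "test_fun (Dn 1 \<phi>)"
proof -
  obtain R where R: "smooth_on \<phi> UNIV" "R > 0" "\<And>x. \<phi> x \<noteq> 0 \<Longrightarrow> \<bar>x\<bar> \<le> R"
    using assms unfolding test_fun_iff by blast
  have "smooth_on (Dn 1 \<phi>) UNIV"
    by (rule smooth_on_class[where M = "range (\<lambda>j. Dn j \<phi>)"]) (use smooth_on_Dn[OF R(1)] in auto)
  moreover have "Dn 1 \<phi> x = 0" if "\<not> \<bar>x\<bar> \<le> R" for x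
  proof -
    have "((\<lambda>_. 0) has_vector_derivative 0) (at x)" by simp
    then have "(\<phi> has_vector_derivative 0) (at x)"
    proof (rule has_vector_derivative_transform_within_open)
      show "open (- {-R..R})" by (intro open_Compl closed_atLeastAtMost)
      show "x \<in> - {-R..R}" using that by auto
      show "0 = \<phi> y" if "y \<in> - {-R..R}" for y
        using that R(3)[of y] by (cases "\<phi> y = 0") auto
    qed
    then show ?thesis
      unfolding Dn_1 by (rule vector_derivative_at)
  qed
  ultimately show ?thesis
    unfolding test_fun_iff using R(2) by blast
qed

lemma test_fun_deriv: "test_fun \<phi> \<Longrightarrow> (\<phi> has_vector_derivative Dn 1 \<phi> x) (at x)"
  using smooth_on_deriv[of \<phi> UNIV] by (simp add: test_fun_iff)

lemma test_fun_continuous: "test_fun \<phi> \<Longrightarrow> continuous_on UNIV \<phi>"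
  using smooth_on_continuous_Dn[of \<phi> UNIV 0] by (simp add: test_fun_iff)

lemma test_fun_support:
  assumes "test_fun \<phi>"
  obtains R where "R > 0" "\<And>x. \<bar>x\<bar> \<ge> R \<Longrightarrow> \<phi> x = 0"
proof -
  obtain R where "R > 0" "\<And>x. \<phi> x \<noteq> 0 \<Longrightarrow> \<bar>x\<bar> \<le> R"
    using assms unfolding test_fun_iff by blast
  then show ?thesis
    using that[of "R + 1"] by fastforce
qed

lemma test_fun_bounded:
  assumes "test_fun \<phi>"
  obtains B where "\<And>x. norm (\<phi> x) \<le> B"
proof -
  obtain R where R: "\<And>x. \<bar>x\<bar> \<ge> R \<Longrightarrow> \<phi> x = 0" "R > 0"
    using test_fun_support[OF assms] by metis
  have "compact (\<phi> ` {-R..R})"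
    using test_fun_continuous[OF assms] by (intro compact_continuous_image) (auto intro: continuous_on_subset)
  then obtain B where B: "\<And>x. x \<in> {-R..R} \<Longrightarrow> norm (\<phi> x) \<le> B"
    by (meson compact_imp_bounded bounded_iff imageI)
  have "norm (\<phi> x) \<le> B" for x
  proof (cases "x \<in> {-R..R}")
    case False
    then have "\<phi> x = 0" by (intro R) auto
    then show ?thesis using order.trans[OF norm_ge_zero B[of 0]] R(2) by simp
  qed (rule B)
  then show ?thesis using that by blast
qed

lemma test_fun_measurable: "test_fun \<phi> \<Longrightarrow> \<phi> \<in> borel_measurable borel"
  by (intro borel_measurable_continuous_onI test_fun_continuous)

lemma L1_loc_measurable: "f \<in> L1_loc \<Longrightarrow> f \<in> borel_measurable borel"
  by (auto simp: L1_loc_def)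

lemma L1_loc_set_integrable: "f \<in> L1_loc \<Longrightarrow> set_integrable lborel {a..b} f"
  by (auto simp: L1_loc_def)

lemma L1_loc_continuous:
  fixes f :: "real \<Rightarrow> 'a::euclidean_space"
  assumes "continuous_on UNIV f"
  shows "f \<in> L1_loc"
  unfolding L1_loc_def set_integrable_def
  using assms by (auto intro!: borel_integrable_compact borel_measurable_continuous_onI intro: continuous_on_subset)

lemma L1_loc_diff:
  fixes f g :: "real \<Rightarrow> 'a::euclidean_space"
  shows "f \<in> L1_loc \<Longrightarrow> g \<in> L1_loc \<Longrightarrow> (\<lambda>x. f x - g x) \<in> L1_loc"
  unfolding L1_loc_def by (auto intro!: set_integral_diff)

lemma L1_loc_dominated:
  fixes f :: "real \<Rightarrow> 'a::euclidean_space" and h :: "real \<Rightarrow> 'b::euclidean_space"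
  assumes "f \<in> L1_loc" and [measurable]: "h \<in> borel_measurable borel"
    and "\<And>x. norm (h x) \<le> B * norm (f x)" and "\<And>x. \<bar>x\<bar> \<ge> R \<Longrightarrow> h x = 0"
  shows "integrable lborel h"
proof (rule Bochner_Integration.integrable_bound)
  show "integrable lborel (\<lambda>x. B *\<^sub>R (indicator {-R..R} x *\<^sub>R f x))"
    using L1_loc_set_integrable[OF assms(1), of "-R" R] unfolding set_integrable_def
    by (rule integrable_scaleR_right)
  show "AE x in lborel. norm (h x) \<le> norm (B *\<^sub>R (indicator {-R..R} x *\<^sub>R f x))"
  proof (rule AE_I2)
    fix x
    show "norm (h x) \<le> norm (B *\<^sub>R (indicator {-R..R} x *\<^sub>R f x))"
    proof (cases "x \<in> {-R..R}")
      case True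
      have "norm (h x) \<le> \<bar>B * norm (f x)\<bar>" using assms(3)[of x] by linarith
      then show ?thesis using True by (simp add: abs_mult)
    next
      case False
      then have "\<bar>x\<bar> \<ge> R" by auto
      then show ?thesis using assms(4) by simp
    qed
  qed
qed simp

lemma integrable_test_L1_loc:
  fixes \<psi> :: "real \<Rightarrow> real" and f :: "real \<Rightarrow> 'a::euclidean_space"
  assumes "test_fun \<psi>" "f \<in> L1_loc"
  shows "integrable lborel (\<lambda>x. \<psi> x *\<^sub>R f x)"
proof -
  obtain R where R: "\<And>x. \<bar>x\<bar> \<ge> R \<Longrightarrow> \<psi> x = 0"
    using test_fun_support[OF assms(1)] by metis
  obtain B where B: "\<And>x. norm (\<psi> x) \<le> B"
    using test_fun_bounded[OF assms(1)] by metis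
  have [measurable]: "\<psi> \<in> borel_measurable borel" "f \<in> borel_measurable borel"
    using assms by (auto intro: test_fun_measurable L1_loc_measurable)
  show ?thesis
    by (rule L1_loc_dominated[OF assms(2), of _ B R]) (auto simp: R intro!: mult_right_mono B[unfolded real_norm_def])
qed

lemma test_fun_mult:
  fixes f g :: "real \<Rightarrow> real"
  assumes "test_fun f" "test_fun g"
  shows "test_fun (\<lambda>x. f x * g x)"
  using assms smooth_on_mult[of f UNIV g] unfolding test_fun_iff by auto

lemma test_fun_linear_image:
  assumes "test_fun f" "bounded_linear L"
  shows "test_fun (\<lambda>x. L (f x))"
  using assms smooth_on_linear[OF assms(2), of f UNIV] linear_0[OF bounded_linear.linear[OF assms(2)]]
  unfolding test_fun_iff by (metis open_UNIV)

lemma test_fun_diff: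
  fixes f g :: "real \<Rightarrow> real"
  assumes "test_fun f" "test_fun g"
  shows "test_fun (\<lambda>x. f x - g x)"
proof -
  obtain R1 where 1: "\<And>x. \<bar>x\<bar> \<ge> R1 \<Longrightarrow> f x = 0" "R1 > 0"
    using test_fun_support[OF assms(1)] by metis
  obtain R2 where 2: "\<And>x. \<bar>x\<bar> \<ge> R2 \<Longrightarrow> g x = 0" "R2 > 0"
    using test_fun_support[OF assms(2)] by metis
  have "\<bar>x\<bar> \<le> max R1 R2" if "f x - g x \<noteq> 0" for x
    using that 1(1)[of x] 2(1)[of x] by (cases "\<bar>x\<bar> \<ge> R1"; cases "\<bar>x\<bar> \<ge> R2") auto
  then show ?thesis
    using assms smooth_on_diff[of f UNIV g] 1(2) unfolding test_fun_iff
    by (metis max.strict_coboundedI1 open_UNIV)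
qed

section \<open>Functions annihilated by test functions\<close>

lemma integral_exhaustion:
  fixes h :: "real \<Rightarrow> 'a::euclidean_space"
  assumes h: "integrable lborel h"
  shows "(\<lambda>n. LINT x|lborel. indicator {- real n<..<real n} x *\<^sub>R h x) \<longlonglongrightarrow> integral\<^sup>L lborel h"
proof (rule integral_dominated_convergence[where w = "\<lambda>x. norm (h x)"])
  show "AE x in lborel. (\<lambda>n. indicator {- real n<..<real n} x *\<^sub>R h x) \<longlonglongrightarrow> h x"
  proof (rule AE_I2, rule tendsto_eventually)
    fix x :: real
    obtain N where "\<bar>x\<bar> < real N" using reals_Archimedean2 by blast
    then show "\<forall>\<^sub>F n in sequentially. indicator {- real n<..<real n} x *\<^sub>R h x = h x"
      by (intro eventually_sequentiallyI[of N]) (auto simp: indicator_def)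
  qed
qed (use borel_measurable_integrable[OF h] in \<open>auto simp: h indicator_def\<close>)

text \<open>A Dynkin argument: open intervals are closed under intersection and generate the Borel
  sets, so vanishing integrals pass to all Borel sets. The complement step needs the integral over
  the whole line, which is the limit over \<open>{- n<..<n}\<close>.\<close>

lemma AE_zero_if_greaterThanLessThan_integrals:
  fixes h :: "real \<Rightarrow> 'a::euclidean_space"
  assumes h: "integrable lborel h"
    and int: "\<And>a b. (LINT x:{a<..<b}|lborel. h x) = 0"
  shows "AE x in lborel. h x = 0"
proof -
  have [measurable]: "h \<in> borel_measurable borel"
    using borel_measurable_integrable[OF h] by simp
  have iA: "integrable lborel (\<lambda>x. indicator A x *\<^sub>R h x)" if "A \<in> sets borel" for A
    using that by (intro integrable_mult_indicator h) auto
  have tot: "integral\<^sup>L lborel h = 0"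
  proof -
    note integral_exhaustion[OF h]
    then show ?thesis
      using int unfolding set_lebesgue_integral_def by (simp add: LIMSEQ_const_iff)
  qed
  have borel: "sets borel = sigma_sets UNIV (range (\<lambda>(a, b). {a<..<b::real}))"
    using arg_cong[OF borel_eq_box[where 'a = real], of sets] by (simp only: box_real) simp
  have "Int_stable (range (\<lambda>(a, b). {a<..<b::real}))"
  proof (rule Int_stableI)
    fix X Y :: "real set"
    assume "X \<in> range (\<lambda>(a, b). {a<..<b})" "Y \<in> range (\<lambda>(a, b). {a<..<b})"
    then obtain a b c d where "X = {a<..<b}" "Y = {c<..<d}" by auto
    then have "X \<inter> Y = (\<lambda>(a, b). {a<..<b}) (max a c, min b d)" by auto
    then show "X \<inter> Y \<in> range (\<lambda>(a, b). {a<..<b})" by (metis rangeI)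
  qed
  moreover have "range (\<lambda>(a, b). {a<..<b::real}) \<subseteq> Pow UNIV" by simp
  ultimately have "(LINT x:A|lborel. h x) = 0" if "A \<in> sigma_sets UNIV (range (\<lambda>(a, b). {a<..<b}))" for A
    using that
  proof (induction rule: sigma_sets_induct_disjoint)
    case (basic A)
    then show ?case using int by auto
  next
    case (compl A)
    then have A: "A \<in> sets borel" by (simp add: borel)
    have "(LINT x:UNIV - A|lborel. h x) = (LINT x|lborel. h x - indicator A x *\<^sub>R h x)"
      unfolding set_lebesgue_integral_def by (intro Bochner_Integration.integral_cong) (auto simp: indicator_def)
    also have "\<dots> = 0"
      using compl tot iA[OF A] h by (simp add: set_lebesgue_integral_def)
    finally show ?case .
  next
    case (union A)
    then have A: "A i \<in> sets borel" for i by (auto simp: borel)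
    have "(LINT x:(\<Union>i. A i)|lborel. h x) = (\<Sum>i. LINT x:A i|lborel. h x)"
      using union(1) A iA[of "\<Union>i. A i"]
      by (intro lebesgue_integral_countable_add) (auto simp: disjoint_family_on_def set_integrable_def)
    then show ?case using union by simp
  qed (auto simp: set_lebesgue_integral_def)
  then show ?thesis
    by (intro sigma_finite_measure.density_zero[OF sigma_finite_lborel h]) (simp add: borel)
qed

text \<open>Bumps converge to indicators of intervals, so dominated convergence turns the hypothesis
  into vanishing interval integrals of \<open>f\<close> times a fixed bump, and that bump is
  positive on \<open>{- N<..<N}\<close>.\<close>

lemma fundamental_lemma:
  fixes f :: "real \<Rightarrow> 'a::euclidean_space"
  assumes f: "f \<in> L1_loc" and int: "\<And>\<psi>. test_fun \<psi> \<Longrightarrow> (LINT x|lborel. \<psi> x *\<^sub>R f x) = 0"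
  shows "AE x in lborel. f x = 0"
proof -
  have "AE x in lborel. \<bar>x\<bar> < real N \<longrightarrow> f x = 0" for N :: nat
  proof -
    \<comment> \<open>The weight makes \<open>f\<close> globally integrable and turns test functions into test functions.\<close>
    define h where "h = (\<lambda>x. bump (- real N) (real N) 1 x *\<^sub>R f x)"
    have h: "integrable lborel h"
      unfolding h_def by (intro integrable_test_L1_loc test_fun_bump f) simp
    have [measurable]: "h \<in> borel_measurable borel"
      using borel_measurable_integrable[OF h] by simp
    have [measurable]: "bump a b (real (Suc n)) \<in> borel_measurable borel" for a b n
      by (intro test_fun_measurable test_fun_bump) simp
    have "(LINT x:{a<..<b}|lborel. h x) = 0" for a b
    proof -
      have "(\<lambda>n. LINT x|lborel. bump a b (real (Suc n)) x *\<^sub>R h x) \<longlonglongrightarrow> (LINT x|lborel. indicator {a<..<b} x *\<^sub>R h x)"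
      proof (rule integral_dominated_convergence[where w = "\<lambda>x. norm (h x)"])
        show "AE x in lborel. (\<lambda>n. bump a b (real (Suc n)) x *\<^sub>R h x) \<longlonglongrightarrow> indicator {a<..<b} x *\<^sub>R h x"
          by (intro AE_I2 tendsto_scaleR bump_limit tendsto_const)
        show "AE x in lborel. norm (bump a b (real (Suc n)) x *\<^sub>R h x) \<le> norm (h x)" for n
        proof (rule AE_I2)
          fix x
          show "norm (bump a b (real (Suc n)) x *\<^sub>R h x) \<le> norm (h x)"
            using bump_bounds[of a b "real (Suc n)" x]
            by (simp add: mult_left_le_one_le del: of_nat_Suc)
        qed
      qed (use h in \<open>simp_all del: of_nat_Suc\<close>)
      moreover have "(LINT x|lborel. bump a b (real (Suc n)) x *\<^sub>R h x) = 0" for n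
        using int[of "\<lambda>x. bump a b (real (Suc n)) x * bump (- real N) (real N) 1 x"]
        by (simp add: h_def test_fun_mult test_fun_bump del: of_nat_Suc)
      ultimately show ?thesis
        unfolding set_lebesgue_integral_def by (simp add: LIMSEQ_const_iff del: of_nat_Suc)
    qed
    then have "AE x in lborel. h x = 0"
      by (rule AE_zero_if_greaterThanLessThan_integrals[OF h])
    then show ?thesis
      by eventually_elim (auto simp: h_def abs_less_iff bump_eq_0_iff)
  qed
  then have "AE x in lborel. \<forall>N::nat. \<bar>x\<bar> < real N \<longrightarrow> f x = 0"
    by (subst AE_all_countable) simp
  then show ?thesis
    by eventually_elim (use reals_Archimedean2 in blast)
qed

lemma integral_of_derivative:
  fixes F f :: "real \<Rightarrow> 'a::euclidean_space"
  assumes "\<And>x. (F has_vector_derivative f x) (at x)" "continuous_on UNIV f" "a \<le> b"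
  shows "(LINT x:{a..b}|lborel. f x) = F b - F a"
  unfolding set_lebesgue_integral_def using assms
  by (intro integral_FTC_atLeastAtMost) (auto intro: continuous_on_subset has_vector_derivative_at_within)

lemma integral_test_fun:
  fixes \<psi> :: "real \<Rightarrow> real"
  assumes "test_fun \<psi>" "\<And>x. \<bar>x\<bar> \<ge> R \<Longrightarrow> \<psi> x = 0"
  shows "(LINT x|lborel. \<psi> x) = (LINT x:{-R..R}|lborel. \<psi> x)"
  unfolding set_lebesgue_integral_def
  using assms(2) by (intro Bochner_Integration.integral_cong) (force simp: indicator_def)+

text \<open>The antiderivative that vanishes to the left of the support is constant to the right of
  it, and mean zero makes that constant 0.\<close>

lemma test_fun_antideriv:
  fixes \<rho> :: "real \<Rightarrow> real"
  assumes \<rho>: "test_fun \<rho>" and "(LINT x|lborel. \<rho> x) = 0"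
  shows "\<exists>\<psi>. test_fun \<psi> \<and> Dn 1 \<psi> = \<rho>"
proof -
  have cont: "continuous_on UNIV \<rho>" by (rule test_fun_continuous[OF \<rho>])
  then have "\<exists>F. \<forall>x. - \<infinity> < ereal x \<longrightarrow> ereal x < \<infinity> \<longrightarrow> (F has_vector_derivative \<rho> x) (at x)"
    by (intro einterval_antiderivative) (auto simp: continuous_on_eq_continuous_at)
  then obtain F where F: "\<And>x. (F has_vector_derivative \<rho> x) (at x)" by auto
  obtain R where R: "R > 0" "\<And>x. \<bar>x\<bar> \<ge> R \<Longrightarrow> \<rho> x = 0"
    using test_fun_support[OF \<rho>] by metis
  define \<psi> where "\<psi> = (\<lambda>x. F x - F (- R))"
  have d: "(\<psi> has_vector_derivative \<rho> x) (at x)" for x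
    unfolding \<psi>_def by (auto intro!: derivative_eq_intros F)
  have zero: "(LINT x:{a..b}|lborel. \<rho> x) = 0" if "\<And>x. x \<in> {a..b} \<Longrightarrow> \<rho> x = 0" for a b
    unfolding set_lebesgue_integral_def using that
    by (intro integral_eq_zero_AE AE_I2) (auto simp: indicator_def)
  have "F (- R) = F R"
    using integral_of_derivative[OF F cont, of "-R" R] integral_test_fun[OF \<rho> R(2)] assms(2) R(1) by simp
  have "\<psi> x = 0" if "\<not> \<bar>x\<bar> \<le> R" for x
  proof (cases "x < - R")
    case True
    then have "(LINT x:{x..-R}|lborel. \<rho> x) = 0"
      by (intro zero R(2)) auto
    then show ?thesis
      using integral_of_derivative[OF F cont, of x "-R"] True by (simp add: \<psi>_def)
  next
    case False
    with that have "x > R" by auto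
    then have "(LINT x:{R..x}|lborel. \<rho> x) = 0"
      by (intro zero R(2)) auto
    then show ?thesis
      using integral_of_derivative[OF F cont, of R x] \<open>x > R\<close> \<open>F (- R) = F R\<close> by (simp add: \<psi>_def)
  qed
  moreover have "smooth_on \<psi> UNIV"
    by (rule smooth_on_antideriv[OF _ _ d]) (use \<rho> in \<open>simp_all add: test_fun_iff\<close>)
  ultimately have "test_fun \<psi>"
    unfolding test_fun_iff using R(1) by blast
  moreover have "Dn 1 \<psi> = \<rho>"
    unfolding Dn_1 using vector_derivative_at[OF d] by (simp add: fun_eq_iff)
  ultimately show ?thesis by blast
qed

text \<open>The hypothesis reaches only test functions of mean zero, since these are the derivatives
  of test functions. Subtracting a multiple of one fixed bump from \<open>\<psi>\<close> makes its
  mean zero; accordingly \<open>C\<close> is the mean of \<open>f\<close> weighted by that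
  bump.\<close>

lemma du_Bois_Reymond:
  fixes f :: "real \<Rightarrow> 'a::euclidean_space"
  assumes f: "f \<in> L1_loc" and int: "\<And>\<psi>. test_fun \<psi> \<Longrightarrow> (LINT x|lborel. Dn 1 \<psi> x *\<^sub>R f x) = 0"
  shows "\<exists>C. AE x in lborel. f x = C"
proof -
  define b where "b = bump 0 1 1"
  have b: "test_fun b" unfolding b_def by (rule test_fun_bump) simp
  have one: "(\<lambda>x. 1::real) \<in> L1_loc"
    by (intro L1_loc_continuous continuous_on_const)
  have i1: "integrable lborel \<psi>" if "test_fun \<psi>" for \<psi> :: "real \<Rightarrow> real"
    using integrable_test_L1_loc[OF that one] by simp
  define m where "m = (LINT x|lborel. b x)"
  have "m \<noteq> 0"
  proof
    assume "m = 0"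
    moreover have "AE x in lborel. 0 \<le> b x"
      by (simp add: b_def bump_bounds)
    ultimately have "AE x in lborel. b x = 0"
      using integral_nonneg_eq_0_iff_AE[OF i1[OF b]] by (simp add: m_def)
    then have "AE x in lborel. x \<notin> {0<..<1::real}"
      by eventually_elim (simp add: b_def bump_eq_0_iff)
    then have "{0<..<1::real} \<in> null_sets lborel"
      by (subst AE_iff_null_sets) auto
    then show False
      by (simp add: null_sets_def)
  qed
  define C where "C = (1 / m) *\<^sub>R (LINT x|lborel. b x *\<^sub>R f x)"
  have "AE x in lborel. f x - C = 0"
  proof (rule fundamental_lemma)
    have C: "(\<lambda>x. C) \<in> L1_loc"
      by (intro L1_loc_continuous continuous_on_const)
    show L: "(\<lambda>x. f x - C) \<in> L1_loc"
      by (rule L1_loc_diff[OF f C])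
    fix \<psi> :: "real \<Rightarrow> real" assume \<psi>: "test_fun \<psi>"
    define t where "t = (LINT x|lborel. \<psi> x) / m"
    have tb: "test_fun (\<lambda>x. t * b x)"
      by (rule test_fun_linear_image[OF b bounded_linear_mult_right])
    have "(LINT x|lborel. \<psi> x - t * b x) = 0"
      using i1[OF \<psi>] i1[OF b] \<open>m \<noteq> 0\<close> by (simp add: t_def m_def)
    then obtain \<Psi> where \<Psi>: "test_fun \<Psi>" "Dn 1 \<Psi> = (\<lambda>x. \<psi> x - t * b x)"
      using test_fun_antideriv[OF test_fun_diff[OF \<psi> tb]] by blast
    have "0 = (LINT x|lborel. (\<psi> x - t * b x) *\<^sub>R f x)"
      using int[OF \<Psi>(1)] unfolding \<Psi>(2) by simp
    also have "\<dots> = (LINT x|lborel. \<psi> x *\<^sub>R f x - t *\<^sub>R (b x *\<^sub>R f x))"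
      by (simp add: scaleR_diff_left)
    also have "\<dots> = (LINT x|lborel. \<psi> x *\<^sub>R f x) - t *\<^sub>R (LINT x|lborel. b x *\<^sub>R f x)"
      using integrable_test_L1_loc[OF \<psi> f] integrable_test_L1_loc[OF b f]
      by (subst Bochner_Integration.integral_diff) (auto simp del: scaleR_scaleR)
    finally have "(LINT x|lborel. \<psi> x *\<^sub>R f x) = t *\<^sub>R (LINT x|lborel. b x *\<^sub>R f x)" by simp
    moreover have "(LINT x|lborel. \<psi> x *\<^sub>R (f x - C)) = (LINT x|lborel. \<psi> x *\<^sub>R f x) - (LINT x|lborel. \<psi> x *\<^sub>R C)"
      using integrable_test_L1_loc[OF \<psi> f] integrable_test_L1_loc[OF \<psi> C]
      by (simp add: scaleR_diff_right)
    moreover have "(LINT x|lborel. \<psi> x *\<^sub>R C) = (LINT x|lborel. \<psi> x) *\<^sub>R C"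
      using i1[OF \<psi>] by simp
    ultimately show "(LINT x|lborel. \<psi> x *\<^sub>R (f x - C)) = 0"
      using \<open>m \<noteq> 0\<close> by (simp add: C_def t_def)
  qed
  then show ?thesis by auto
qed

lemma L1_loc_add:
  fixes f g :: "real \<Rightarrow> 'a::euclidean_space"
  shows "f \<in> L1_loc \<Longrightarrow> g \<in> L1_loc \<Longrightarrow> (\<lambda>x. f x + g x) \<in> L1_loc"
  unfolding L1_loc_def by (auto intro!: set_integral_add)

lemma L1_loc_bound:
  fixes f :: "real \<Rightarrow> 'a::euclidean_space" and h :: "real \<Rightarrow> 'b::euclidean_space"
  assumes f: "f \<in> L1_loc" and h [measurable]: "h \<in> borel_measurable borel"
    and K: "continuous_on UNIV K" "\<And>x. norm (h x) \<le> K x * norm (f x)"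
  shows "h \<in> L1_loc"
proof -
  have "set_integrable lborel C h" if "compact C" for C
  proof -
    have "compact (K ` C)"
      using K(1) that by (intro compact_continuous_image) (auto intro: continuous_on_subset)
    then obtain B where B: "\<And>x. x \<in> C \<Longrightarrow> norm (K x) \<le> B"
      by (meson compact_imp_bounded bounded_iff imageI)
    have C [measurable]: "C \<in> sets borel" using that by (rule borel_compact)
    show ?thesis
    proof (rule set_integrable_bound)
      show "set_integrable lborel C (\<lambda>x. B *\<^sub>R f x)"
        using f that by (intro set_integrable_scaleR_right) (auto simp: L1_loc_def)
      show "set_borel_measurable lborel C h"
        unfolding set_borel_measurable_def by simp
      show "AE x in lborel. x \<in> C \<longrightarrow> norm (h x) \<le> norm (B *\<^sub>R f x)"
      proof (intro AE_I2 impI)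
        fix x assume "x \<in> C"
        have "norm (h x) \<le> K x * norm (f x)" by (rule K(2))
        also have "\<dots> \<le> B * norm (f x)"
          using B[OF \<open>x \<in> C\<close>] by (intro mult_right_mono) auto
        finally show "norm (h x) \<le> norm (B *\<^sub>R f x)"
          using B[OF \<open>x \<in> C\<close>] order.trans[OF norm_ge_zero B[OF \<open>x \<in> C\<close>]] by simp
      qed
    qed
  qed
  then show ?thesis by (simp add: L1_loc_def)
qed

lemma L1_loc_inner_continuous:
  fixes f \<phi> :: "real \<Rightarrow> 'a::euclidean_space"
  assumes "f \<in> L1_loc" "continuous_on UNIV \<phi>"
  shows "(\<lambda>x. f x \<bullet> \<phi> x) \<in> L1_loc"
proof (rule L1_loc_bound[OF assms(1), of _ "\<lambda>x. norm (\<phi> x)"])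
  show "(\<lambda>x. f x \<bullet> \<phi> x) \<in> borel_measurable borel"
    using L1_loc_measurable[OF assms(1)] borel_measurable_continuous_onI[OF assms(2)] by simp
  show "continuous_on UNIV (\<lambda>x. norm (\<phi> x))"
    by (intro continuous_on_norm assms(2))
  show "norm (f x \<bullet> \<phi> x) \<le> norm (\<phi> x) * norm (f x)" for x
    using Cauchy_Schwarz_ineq2[of "f x" "\<phi> x"] by (simp add: mult.commute)
qed

section \<open>Primitives of locally integrable functions\<close>

definition primitive :: "(real \<Rightarrow> 'a::euclidean_space) \<Rightarrow> (real \<Rightarrow> 'a) \<Rightarrow> bool" where
  "primitive F f \<longleftrightarrow> continuous_on UNIV F \<and> (\<forall>a b. a \<le> b \<longrightarrow> F b - F a = (LINT t:{a..b}|lborel. f t))"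

lemma primitive_exists:
  fixes g :: "real \<Rightarrow> 'a::euclidean_space"
  assumes g: "g \<in> L1_loc"
  obtains G where "primitive G g"
proof -
  define G where "G = (\<lambda>x::real. LBINT t=(0::real)..x. g t)"
  have diff: "G b - G a = (LINT t:{a..b}|lborel. g t)" if "a \<le> b" for a b
  proof -
    have "interval_lebesgue_integrable lborel (ereal p) (ereal q) g" for p q
      unfolding interval_lebesgue_integrable_def
      by (auto intro!: set_integrable_subset[OF L1_loc_set_integrable[OF g, of "min p q" "max p q"]])
    then have "G a + (LBINT t=a..b. g t) = G b"
      unfolding G_def by (intro interval_integral_sum) (simp add: min_def max_def)
    then show ?thesis
      using interval_integral_Icc[OF that, of g] by (simp add: algebra_simps)
  qed
  have "isCont G x" for x
  proof -
    define R where "R = \<bar>x\<bar> + 1"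
    have "G y = G (- R) + integral {-R..y} g" if "y \<in> {-R..R}" for y
      using diff[of "-R" y] that set_borel_integral_eq_integral(2)[OF L1_loc_set_integrable[OF g], of "-R" y]
      by (simp add: algebra_simps)
    moreover have "continuous_on {-R..R} (\<lambda>y. G (- R) + integral {-R..y} g)"
      by (intro continuous_intros indefinite_integral_continuous_1
          set_borel_integral_eq_integral(1) L1_loc_set_integrable[OF g])
    ultimately have "continuous_on {-R..R} G"
      by (metis (no_types, lifting) continuous_on_cong)
    then show ?thesis
      by (rule continuous_on_interior) (auto simp: R_def)
  qed
  then have "continuous_on UNIV G"
    by (simp add: continuous_on_eq_continuous_at)
  then show ?thesis
    using that diff unfolding primitive_def by blast
qed

lemma has_weak_deriv_iff:
  "has_weak_deriv u v \<longleftrightarrow> u \<in> L1_loc \<and> v \<in> L1_loc \<and>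
     (\<forall>\<psi> :: real \<Rightarrow> real. test_fun \<psi> \<longrightarrow>
        (LINT x|lborel. Dn 1 \<psi> x *\<^sub>R u x) = - (LINT x|lborel. \<psi> x *\<^sub>R v x))"
  unfolding has_weak_deriv_def Dn_1 ..

text \<open>\<open>G\<close> is not assumed differentiable at any point, so integration by parts is
  replaced by Fubini for the derivative of \<open>\<psi>\<close> at \<open>x\<close> times
  \<open>g t\<close> on the region \<open>t \<le> x\<close>.\<close>

lemma primitive_has_weak_deriv:
  fixes g :: "real \<Rightarrow> 'a::euclidean_space"
  assumes g: "g \<in> L1_loc" and G: "primitive G g"
  shows "has_weak_deriv G g"
  unfolding has_weak_deriv_iff
proof (intro conjI allI impI)
  have contG: "continuous_on UNIV G" using G by (simp add: primitive_def)
  then show GL: "G \<in> L1_loc" by (rule L1_loc_continuous)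
  show "g \<in> L1_loc" by fact
  fix \<psi> :: "real \<Rightarrow> real" assume \<psi>: "test_fun \<psi>"
  obtain R where R: "R > 0" "\<And>x. \<bar>x\<bar> \<ge> R \<Longrightarrow> \<psi> x = 0"
    using test_fun_support[OF \<psi>] by metis
  obtain R' where R': "\<And>x. \<bar>x\<bar> \<ge> R' \<Longrightarrow> Dn 1 \<psi> x = 0"
    using test_fun_support[OF test_fun_Dn[OF \<psi>]] by metis
  \<comment> \<open>Bounds the supports of \<open>\<psi>\<close> and of its derivative, so that
    cutting \<open>g\<close> down to an integrable function with \<open>I\<close> changes neither
    iterated integral.\<close>
  define r where "r = max R R'"
  have r: "\<And>x. \<bar>x\<bar> \<ge> r \<Longrightarrow> \<psi> x = 0" "\<And>x. \<bar>x\<bar> \<ge> r \<Longrightarrow> Dn 1 \<psi> x = 0" "r > 0"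
    using R R' by (auto simp: r_def)
  define I where "I = (indicator {-r..r} :: real \<Rightarrow> real)"
  have [measurable]: "g \<in> borel_measurable borel" "\<psi> \<in> borel_measurable borel" "Dn 1 \<psi> \<in> borel_measurable borel"
    "I \<in> borel_measurable borel"
    using g \<psi> test_fun_Dn[OF \<psi>]
    by (auto intro: L1_loc_measurable test_fun_measurable simp: I_def)
  have ig: "integrable lborel (\<lambda>t. I t *\<^sub>R g t)"
    using L1_loc_set_integrable[OF g] unfolding I_def set_integrable_def .
  have i\<psi>: "integrable lborel (\<lambda>x. Dn 1 \<psi> x)"
    using integrable_test_L1_loc[OF test_fun_Dn[OF \<psi>] L1_loc_continuous[OF continuous_on_const[of UNIV "1::real"]]] by simp
  define h where "h = (\<lambda>x t. (Dn 1 \<psi> x * (if t \<le> x then 1 else 0)) *\<^sub>R (I t *\<^sub>R g t))"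
  have int: "integrable (lborel \<Otimes>\<^sub>M lborel) (\<lambda>(x, t). h x t)"
  proof (rule lborel_pair.Fubini_integrable)
    have hm: "(\<lambda>(x, t). h x t) \<in> borel_measurable (borel \<Otimes>\<^sub>M borel)"
      unfolding h_def by measurable
    then show "(\<lambda>(x, t). h x t) \<in> borel_measurable (lborel \<Otimes>\<^sub>M lborel)"
      by simp
    have hx: "integrable lborel (\<lambda>t. h x t)" for x
    proof (rule Bochner_Integration.integrable_bound)
      show "(\<lambda>t. h x t) \<in> borel_measurable lborel"
        using measurable_compose[OF measurable_Pair1'[of x borel borel] hm] by simp
      show "integrable lborel (\<lambda>t. Dn 1 \<psi> x *\<^sub>R (I t *\<^sub>R g t))"
        using ig by (rule integrable_scaleR_right)
    qed (auto simp: h_def)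
    then show "AE x in lborel. integrable lborel (\<lambda>t. (\<lambda>(x, t). h x t) (x, t))" by simp
    show "integrable lborel (\<lambda>x. \<integral>t. norm ((\<lambda>(x, t). h x t) (x, t)) \<partial>lborel)"
    proof (rule Bochner_Integration.integrable_bound)
      show "integrable lborel (\<lambda>x. Dn 1 \<psi> x * (\<integral>t. norm (I t *\<^sub>R g t) \<partial>lborel))"
        using i\<psi> by simp
      show "(\<lambda>x. \<integral>t. norm ((\<lambda>(x, t). h x t) (x, t)) \<partial>lborel) \<in> borel_measurable lborel"
      proof (rule lborel.borel_measurable_lebesgue_integral)
        show "(\<lambda>(x, t). norm ((\<lambda>(x, t). h x t) (x, t))) \<in> borel_measurable (lborel \<Otimes>\<^sub>M lborel)"
          using hm by (simp add: case_prod_unfold)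
      qed
      have "(\<integral>t. norm (h x t) \<partial>lborel) \<le> \<bar>Dn 1 \<psi> x\<bar> * (\<integral>t. norm (I t *\<^sub>R g t) \<partial>lborel)" for x
      proof -
        have "(\<integral>t. norm (h x t) \<partial>lborel) \<le> (\<integral>t. \<bar>Dn 1 \<psi> x\<bar> * norm (I t *\<^sub>R g t) \<partial>lborel)"
        proof (rule integral_mono)
          show "integrable lborel (\<lambda>t. norm (h x t))"
            by (rule integrable_norm[OF hx])
          show "integrable lborel (\<lambda>t. \<bar>Dn 1 \<psi> x\<bar> * norm (I t *\<^sub>R g t))"
            by (rule integrable_mult_right) (rule integrable_norm[OF ig])
        qed (auto simp: h_def abs_mult)
        then show ?thesis
          by (simp only: integral_mult_right_zero)
      qed
      then show "AE x in lborel. norm (\<integral>t. norm ((\<lambda>(x, t). h x t) (x, t)) \<partial>lborel)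
          \<le> norm (Dn 1 \<psi> x * (\<integral>t. norm (I t *\<^sub>R g t) \<partial>lborel))"
        by (simp add: abs_mult)
    qed
  qed
  \<comment> \<open>Because of this the additive constant \<open>G (- r)\<close> drops out of the
    inner integral below.\<close>
  have zero: "(LINT x|lborel. Dn 1 \<psi> x) = 0"
    using integral_test_fun[OF test_fun_Dn[OF \<psi>] r(2)] r
      integral_of_derivative[OF test_fun_deriv[OF \<psi>] test_fun_continuous[OF test_fun_Dn[OF \<psi>]], of "-r" r]
    by simp
  have 1: "(\<integral>t. h x t \<partial>lborel) = Dn 1 \<psi> x *\<^sub>R G x - Dn 1 \<psi> x *\<^sub>R G (- r)" for x
  proof (cases "\<bar>x\<bar> \<ge> r")
    case True
    then show ?thesis by (simp add: h_def r(2)[OF True, simplified])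
  next
    case False
    have "(\<integral>t. h x t \<partial>lborel) = Dn 1 \<psi> x *\<^sub>R (\<integral>t. indicator {-r..x} t *\<^sub>R g t \<partial>lborel)"
      unfolding h_def integral_scaleR_right[symmetric] using False
      by (intro Bochner_Integration.integral_cong) (auto simp: I_def indicator_def)
    also have "(\<integral>t. indicator {-r..x} t *\<^sub>R g t \<partial>lborel) = G x - G (- r)"
      using G False unfolding primitive_def set_lebesgue_integral_def by auto
    finally show ?thesis by (simp add: scaleR_diff_right)
  qed
  have 2: "(\<integral>x. h x t \<partial>lborel) = - (\<psi> t *\<^sub>R g t)" for t
  proof (cases "t \<in> {-r..r}")
    case False
    then have "\<bar>t\<bar> \<ge> r" by auto
    with False show ?thesis by (simp add: h_def I_def r(1))
  next
    case True
    have "(\<integral>x. h x t \<partial>lborel) = (\<integral>x. Dn 1 \<psi> x * (if t \<le> x then 1 else 0) \<partial>lborel) *\<^sub>R g t"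
    proof -
      have "integrable lborel (\<lambda>x. Dn 1 \<psi> x * (if t \<le> x then 1 else 0))"
      proof (rule Bochner_Integration.integrable_bound[OF i\<psi>])
        have "(\<lambda>x. if t \<le> x then 1 else 0 :: real) = indicator {t..}"
          by (auto simp: indicator_def)
        then have [measurable]: "(\<lambda>x. if t \<le> x then 1 else 0 :: real) \<in> borel_measurable borel"
          by simp
        show "(\<lambda>x. Dn 1 \<psi> x * (if t \<le> x then 1 else 0)) \<in> borel_measurable lborel"
          by (simp del: One_nat_def)
      qed auto
      then show ?thesis
        using True by (simp add: h_def I_def)
    qed
    also have "(\<integral>x. Dn 1 \<psi> x * (if t \<le> x then 1 else 0) \<partial>lborel) = (LINT x:{t..r}|lborel. Dn 1 \<psi> x)"
      unfolding set_lebesgue_integral_def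
    proof (intro Bochner_Integration.integral_cong refl)
      fix x
      show "Dn 1 \<psi> x * (if t \<le> x then 1 else 0) = indicator {t..r} x *\<^sub>R Dn 1 \<psi> x"
        using r(2)[of x] r(3) by (cases "x \<le> r") (auto simp: indicator_def)
    qed
    also have "\<dots> = - \<psi> t"
      using True r integral_of_derivative[OF test_fun_deriv[OF \<psi>] test_fun_continuous[OF test_fun_Dn[OF \<psi>]], of t r]
      by simp
    finally show ?thesis by simp
  qed
  have "(LINT x|lborel. Dn 1 \<psi> x *\<^sub>R G x) = (LINT x|lborel. Dn 1 \<psi> x *\<^sub>R G x - Dn 1 \<psi> x *\<^sub>R G (- r))"
    using integrable_test_L1_loc[OF test_fun_Dn[OF \<psi>] GL] i\<psi> zero by simp
  also have "\<dots> = (LINT x|lborel. LINT t|lborel. h x t)"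
    by (simp add: 1)
  also have "\<dots> = (LINT t|lborel. LINT x|lborel. h x t)"
    using lborel_pair.Fubini_integral[OF int] by simp
  also have "\<dots> = - (LINT x|lborel. \<psi> x *\<^sub>R g x)"
    by (simp add: 2)
  finally show "(LINT x|lborel. Dn 1 \<psi> x *\<^sub>R G x) = - (LINT x|lborel. \<psi> x *\<^sub>R g x)" .
qed

text \<open>The difference between \<open>f\<close> and any primitive of \<open>g\<close> has weak
  derivative 0, hence is constant almost everywhere; the constant is absorbed into the
  primitive.\<close>

lemma has_weak_deriv_AE_primitive:
  fixes f g :: "real \<Rightarrow> 'a::euclidean_space"
  assumes fg: "has_weak_deriv f g"
  obtains F where "primitive F g" "AE x in lborel. f x = F x"
proof -
  have f: "f \<in> L1_loc" and g: "g \<in> L1_loc"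
    using fg by (auto simp: has_weak_deriv_def)
  obtain G where G: "primitive G g" using primitive_exists[OF g] .
  have Gg: "has_weak_deriv G g" by (rule primitive_has_weak_deriv[OF g G])
  then have GL: "G \<in> L1_loc" by (simp add: has_weak_deriv_def)
  have "\<exists>C. AE x in lborel. f x - G x = C"
  proof (rule du_Bois_Reymond[OF L1_loc_diff[OF f GL]])
    fix \<psi> :: "real \<Rightarrow> real" assume \<psi>: "test_fun \<psi>"
    show "(LINT x|lborel. Dn 1 \<psi> x *\<^sub>R (f x - G x)) = 0"
      using fg Gg \<psi> integrable_test_L1_loc[OF test_fun_Dn[OF \<psi>] f] integrable_test_L1_loc[OF test_fun_Dn[OF \<psi>] GL]
      unfolding has_weak_deriv_iff scaleR_diff_right by simp
  qed
  then obtain C where C: "AE x in lborel. f x - G x = C" by blast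
  have "primitive (\<lambda>x. G x + C) g"
    using G unfolding primitive_def by (auto intro: continuous_intros)
  moreover have "AE x in lborel. f x = G x + C"
    using C by eventually_elim (auto simp: algebra_simps)
  ultimately show ?thesis using that by blast
qed

lemma has_weak_deriv_unique:
  fixes f g :: "real \<Rightarrow> 'a::euclidean_space"
  assumes "has_weak_deriv f g" "has_weak_deriv f h"
  shows "AE x in lborel. g x = h x"
proof -
  have g: "g \<in> L1_loc" and h: "h \<in> L1_loc"
    using assms by (auto simp: has_weak_deriv_def)
  have "AE x in lborel. g x - h x = 0"
  proof (rule fundamental_lemma[OF L1_loc_diff[OF g h]])
    fix \<psi> :: "real \<Rightarrow> real" assume \<psi>: "test_fun \<psi>"
    have "(LINT x|lborel. \<psi> x *\<^sub>R g x) = (LINT x|lborel. \<psi> x *\<^sub>R h x)"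
      using assms \<psi> unfolding has_weak_deriv_iff by (metis neg_equal_iff_equal)
    then show "(LINT x|lborel. \<psi> x *\<^sub>R (g x - h x)) = 0"
      using integrable_test_L1_loc[OF \<psi> g] integrable_test_L1_loc[OF \<psi> h]
      by (simp add: scaleR_diff_right)
  qed
  then show ?thesis by simp
qed

lemma has_weak_deriv_weak_deriv: "has_weak_deriv u v \<Longrightarrow> has_weak_deriv u (weak_deriv u)"
  unfolding weak_deriv_def by (rule someI[of "has_weak_deriv u"])

text \<open>Leibniz rule by duality: for each basis vector \<open>b\<close> the product
  \<open>\<psi> x * (\<phi> x \<bullet> b)\<close> is again a real test function. Testing
  \<open>u\<close> with it and summing over \<open>b\<close> recovers the inner products.\<close>

lemma has_weak_deriv_inner_test_fun:
  fixes u v \<phi> :: "real \<Rightarrow> 'a::euclidean_space"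
  assumes uv: "has_weak_deriv u v" and \<phi>: "test_fun \<phi>"
  shows "has_weak_deriv (\<lambda>x. u x \<bullet> \<phi> x) (\<lambda>x. v x \<bullet> \<phi> x + u x \<bullet> Dn 1 \<phi> x)"
  unfolding has_weak_deriv_iff
proof (intro conjI allI impI)
  have u: "u \<in> L1_loc" and v: "v \<in> L1_loc"
    using uv by (auto simp: has_weak_deriv_def)
  note c\<phi> = test_fun_continuous[OF \<phi>] and cD\<phi> = test_fun_continuous[OF test_fun_Dn[OF \<phi>]]
  note u\<phi> = L1_loc_inner_continuous[OF u c\<phi>] and v\<phi> = L1_loc_inner_continuous[OF v c\<phi>]
    and uD\<phi> = L1_loc_inner_continuous[OF u cD\<phi>]
  show "(\<lambda>x. u x \<bullet> \<phi> x) \<in> L1_loc" by (rule u\<phi>)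
  show "(\<lambda>x. v x \<bullet> \<phi> x + u x \<bullet> Dn 1 \<phi> x) \<in> L1_loc" by (rule L1_loc_add[OF v\<phi> uD\<phi>])
  fix \<psi> :: "real \<Rightarrow> real" assume \<psi>: "test_fun \<psi>"
  define \<psi>b where "\<psi>b = (\<lambda>b x. \<psi> x * (\<phi> x \<bullet> b))"
  have \<psi>b: "test_fun (\<psi>b b)" for b
    unfolding \<psi>b_def by (intro test_fun_mult \<psi> test_fun_linear_image[OF \<phi> bounded_linear_inner_left])
  have D\<psi>b: "Dn 1 (\<psi>b b) x = Dn 1 \<psi> x * (\<phi> x \<bullet> b) + \<psi> x * (Dn 1 \<phi> x \<bullet> b)" for b x
  proof -
    have "((\<lambda>x. \<phi> x \<bullet> b) has_vector_derivative Dn 1 \<phi> x \<bullet> b) (at x)"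
      by (rule bounded_linear.has_vector_derivative[OF bounded_linear_inner_left test_fun_deriv[OF \<phi>]])
    from has_vector_derivative_mult[OF test_fun_deriv[OF \<psi>] this]
    show ?thesis
      unfolding Dn_1 \<psi>b_def by (simp add: vector_derivative_at Dn_1[symmetric])
  qed
  have eq: "(LINT x|lborel. Dn 1 (\<psi>b b) x *\<^sub>R (u x \<bullet> b)) = - (LINT x|lborel. \<psi>b b x *\<^sub>R (v x \<bullet> b))" for b
  proof -
    have "(LINT x|lborel. Dn 1 (\<psi>b b) x *\<^sub>R u x) \<bullet> b = - ((LINT x|lborel. \<psi>b b x *\<^sub>R v x) \<bullet> b)"
      using uv \<psi>b unfolding has_weak_deriv_iff by simp
    then show ?thesis
      using integrable_test_L1_loc[OF test_fun_Dn[OF \<psi>b] u] integrable_test_L1_loc[OF \<psi>b v]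
      by (simp flip: integral_inner_left)
  qed
  have cst: "continuous_on UNIV (\<lambda>x::real. b)" for b :: 'a by (rule continuous_on_const)
  have "(LINT x|lborel. (\<Sum>b\<in>Basis. Dn 1 (\<psi>b b) x *\<^sub>R (u x \<bullet> b))) = - (LINT x|lborel. (\<Sum>b\<in>Basis. \<psi>b b x *\<^sub>R (v x \<bullet> b)))"
    using integrable_test_L1_loc[OF test_fun_Dn[OF \<psi>b] L1_loc_inner_continuous[OF u cst]]
      integrable_test_L1_loc[OF \<psi>b L1_loc_inner_continuous[OF v cst]]
    by (simp add: eq[simplified] sum_negf)
  moreover have "(\<Sum>b\<in>Basis. Dn 1 (\<psi>b b) x *\<^sub>R (u x \<bullet> b)) = Dn 1 \<psi> x * (u x \<bullet> \<phi> x) + \<psi> x * (u x \<bullet> Dn 1 \<phi> x)" for x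
    unfolding D\<psi>b euclidean_inner[of "u x" "\<phi> x"] euclidean_inner[of "u x" "Dn 1 \<phi> x"]
    by (simp add: algebra_simps sum.distrib sum_distrib_left)
  moreover have "(\<Sum>b\<in>Basis. \<psi>b b x *\<^sub>R (v x \<bullet> b)) = \<psi> x * (v x \<bullet> \<phi> x)" for x
    unfolding \<psi>b_def euclidean_inner[of "v x" "\<phi> x"]
    by (simp add: algebra_simps sum.distrib sum_distrib_left)
  ultimately have "(LINT x|lborel. Dn 1 \<psi> x * (u x \<bullet> \<phi> x) + \<psi> x * (u x \<bullet> Dn 1 \<phi> x)) = - (LINT x|lborel. \<psi> x * (v x \<bullet> \<phi> x))"
    by simp
  then show "(LINT x|lborel. Dn 1 \<psi> x *\<^sub>R (u x \<bullet> \<phi> x)) = - (LINT x|lborel. \<psi> x *\<^sub>R (v x \<bullet> \<phi> x + u x \<bullet> Dn 1 \<phi> x))"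
    using integrable_test_L1_loc[OF test_fun_Dn[OF \<psi>] u\<phi>] integrable_test_L1_loc[OF \<psi> uD\<phi>]
      integrable_test_L1_loc[OF \<psi> v\<phi>]
    by (simp add: distrib_left)
qed

section \<open>Regularity and first integrals of weak solutions\<close>

lemma continuous_AE_eq:
  fixes f g :: "real \<Rightarrow> 'a::euclidean_space"
  assumes "continuous_on UNIV f" "continuous_on UNIV g" "AE x in lborel. f x = g x"
  shows "f = g"
proof (rule ccontr)
  assume "f \<noteq> g"
  then have ne: "{x. f x \<noteq> g x} \<noteq> {}" by auto
  have op: "open {x. f x \<noteq> g x}"
    by (intro open_Collect_neq assms)
  have "AE x in lborel. x \<notin> {x. f x \<noteq> g x}"
    using assms(3) by simp
  then have "{x. f x \<noteq> g x} \<in> null_sets lborel"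
    using op by (subst AE_iff_null_sets) auto
  then have "negligible {x. f x \<noteq> g x}"
    by (simp add: negligible_iff_null_sets null_sets_completionI)
  then show False
    using open_not_negligible[OF op ne] by simp
qed

text \<open>The passage from almost everywhere information to classical derivatives: where
  \<open>f\<close> agrees almost everywhere with a continuous \<open>h\<close>, its primitive is an
  indefinite integral of \<open>h\<close>.\<close>

lemma primitive_has_vector_derivative:
  fixes G f h :: "real \<Rightarrow> 'a::euclidean_space"
  assumes G: "primitive G f" and f: "f \<in> L1_loc" and S: "open S" "continuous_on S h"
    and ae: "AE x in lborel. x \<in> S \<longrightarrow> f x = h x" and "x \<in> S"
  shows "(G has_vector_derivative h x) (at x)"
proof -
  obtain d where d: "d > 0" "cball x d \<subseteq> S"
    using S(1) \<open>x \<in> S\<close> open_contains_cball by blast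
  define a b where "a = x - d" and "b = x + d"
  have ab: "a < x" "x < b" "{a..b} \<subseteq> S"
    using d by (auto simp: a_def b_def cball_eq_atLeastAtMost)
  have cont: "continuous_on {a..b} h"
    using S(2) ab(3) by (rule continuous_on_subset)
  have eq: "G a + integral {a..y} h = G y" if y: "y \<in> {a..b}" for y
  proof -
    have sub: "{a..y} \<subseteq> S"
      using y by (intro order.trans[OF _ ab(3)]) auto
    have si: "set_integrable lborel {a..y} h"
      using y by (intro borel_integrable_atLeastAtMost' continuous_on_subset[OF cont]) auto
    have "(LINT t:{a..y}|lborel. f t) = (LINT t:{a..y}|lborel. h t)"
      unfolding set_lebesgue_integral_def
    proof (rule integral_cong_AE)
      show "(\<lambda>t. indicator {a..y} t *\<^sub>R f t) \<in> borel_measurable lborel"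
        using L1_loc_measurable[OF f] by simp
      show "(\<lambda>t. indicator {a..y} t *\<^sub>R h t) \<in> borel_measurable lborel"
        using si unfolding set_integrable_def by (rule borel_measurable_integrable)
      show "AE t in lborel. indicator {a..y} t *\<^sub>R f t = indicator {a..y} t *\<^sub>R h t"
        using ae by eventually_elim (use sub in \<open>auto simp: indicator_def\<close>)
    qed
    also have "\<dots> = integral {a..y} h"
      by (rule set_borel_integral_eq_integral(2)[OF si])
    finally show ?thesis
      using G y unfolding primitive_def by (auto simp: algebra_simps)
  qed
  have "((\<lambda>y. integral {a..y} h) has_vector_derivative h x) (at x within {a..b})"
    using ab cont by (intro integral_has_vector_derivative) auto
  then have "((\<lambda>y. G a + integral {a..y} h) has_vector_derivative h x) (at x within {a..b})"
    by (auto intro!: derivative_eq_intros)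
  then have "(G has_vector_derivative h x) (at x within {a..b})"
    by (rule has_vector_derivative_transform[rotated 2]) (use ab eq in auto)
  moreover have "at x within {a..b} = at x"
    using ab by (intro at_within_interior) auto
  ultimately show ?thesis by simp
qed

text \<open>The minimum of a continuous function does not exceed its mean, and on an interval of
  length 1 the mean is the integral.\<close>

lemma exists_le_of_integral_le:
  fixes h e :: "real \<Rightarrow> real"
  assumes h: "continuous_on {p..p + 1} h" and e: "set_integrable lborel {p..p + 1} e"
    and ae: "AE x in lborel. x \<in> {p..p + 1} \<longrightarrow> h x \<le> e x"
    and le: "(LINT x:{p..p + 1}|lborel. e x) \<le> \<epsilon>"
  shows "\<exists>x\<in>{p..p + 1}. h x \<le> \<epsilon>"
proof -
  obtain x where x: "x \<in> {p..p + 1}" "\<And>y. y \<in> {p..p + 1} \<Longrightarrow> h x \<le> h y"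
    using continuous_attains_inf[OF compact_Icc _ h] by force
  have "h x = (LINT y:{p..p + 1}|lborel. h x)"
    by (simp add: set_integral_const)
  also have "\<dots> \<le> (LINT x:{p..p + 1}|lborel. e x)"
    unfolding set_lebesgue_integral_def
  proof (rule integral_mono_AE)
    show "AE y in lborel. indicator {p..p + 1} y *\<^sub>R h x \<le> indicator {p..p + 1} y *\<^sub>R e y"
      using ae by eventually_elim (use x(2) in \<open>auto simp: indicator_def intro: order.trans\<close>)
  qed (use e in \<open>auto simp: set_integrable_def\<close>)
  finally show ?thesis using x(1) le by force
qed

lemma integrable_tail:
  fixes e :: "real \<Rightarrow> real"
  assumes e: "integrable lborel e" "\<And>x. e x \<ge> 0" and "\<epsilon> > 0"
  obtains X where "X > 0" "\<And>p. X \<le> p \<or> p + 1 \<le> - X \<Longrightarrow> (LINT x:{p..p + 1}|lborel. e x) \<le> \<epsilon>"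
proof -
  have ie: "integrable lborel (\<lambda>x. indicator A x *\<^sub>R e x)" if "A \<in> sets borel" for A
    using that by (intro integrable_mult_indicator e(1)) auto
  from order_tendstoD(1)[OF integral_exhaustion[OF e(1)], of "integral\<^sup>L lborel e - \<epsilon>"] \<open>\<epsilon> > 0\<close>
  obtain n where n: "integral\<^sup>L lborel e - \<epsilon> < (LINT x|lborel. indicator {- real n<..<real n} x *\<^sub>R e x)"
    unfolding eventually_sequentially by auto
  show ?thesis
  proof (rule that[of "real n + 1"])
    fix p assume p: "real n + 1 \<le> p \<or> p + 1 \<le> - (real n + 1)"
    have "(LINT x:{p..p + 1}|lborel. e x) + (LINT x|lborel. indicator {- real n<..<real n} x *\<^sub>R e x)
        = (LINT x|lborel. indicator {p..p + 1} x *\<^sub>R e x + indicator {- real n<..<real n} x *\<^sub>R e x)"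
      unfolding set_lebesgue_integral_def using ie by (intro Bochner_Integration.integral_add[symmetric]) auto
    also have "\<dots> \<le> integral\<^sup>L lborel e"
      using p e by (intro integral_mono Bochner_Integration.integrable_add ie) (auto simp: indicator_def)
    finally show "(LINT x:{p..p + 1}|lborel. e x) \<le> \<epsilon>" using n by linarith
  qed simp
qed

section \<open>The weak equation and its classical form off the singular set\<close>

locale weak_tw =
  fixes c \<kappa> :: real and u :: "real \<Rightarrow> complex"
  assumes weak_sol: "weak_solution c \<kappa> u"
begin

definition v where "v = weak_deriv u"
definition \<eta> where "\<eta> = (\<lambda>x. 1 - (norm (u x))\<^sup>2)"
definition s where "s = (\<lambda>x. 1 - 2 * \<kappa> * (norm (u x))\<^sup>2)"
definition reg where "reg = {x. s x \<noteq> 0}"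
text \<open>Up to sign, \<open>w\<close> collects what the weak equation pairs with the derivative
  of the test function, and \<open>rhs\<close> what it pairs with the test function itself.
  \<open>rhs\<close> takes the derivative of \<open>u\<close> as an argument so that it can be
  evaluated both at \<open>v\<close> and at its continuous version \<open>V\<close>.\<close>

definition w where "w = (\<lambda>x. v x - (2 * \<kappa> * (u x \<bullet> v x)) *\<^sub>R u x)"
definition rhs where
  "rhs z x = - (\<i> * complex_of_real c * z + u x * complex_of_real (\<eta> x) + (2 * \<kappa> * (u x \<bullet> z)) *\<^sub>R z)"

lemma energy: "u \<in> energy_space"
  using weak_sol by (simp add: weak_solution_def)

lemma cont_u: "continuous_on UNIV u"
  using energy by (simp add: energy_space_def)

lemma cont_\<eta>: "continuous_on UNIV \<eta>"
  unfolding \<eta>_def by (intro continuous_intros cont_u)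

lemma cont_s: "continuous_on UNIV s"
  unfolding s_def by (intro continuous_intros cont_u)

lemma open_reg: "open reg"
  unfolding reg_def by (intro open_Collect_neq cont_s continuous_on_const)

lemma uv: "has_weak_deriv u v"
  using energy has_weak_deriv_weak_deriv unfolding v_def energy_space_def H1_loc_def by blast

lemma vL1: "v \<in> L1_loc"
  using uv by (simp add: has_weak_deriv_def)

lemma L2: "integrable lborel (\<lambda>x. (norm (v x))\<^sup>2)" "integrable lborel (\<lambda>x. (\<eta> x)\<^sup>2)"
  using energy by (auto simp: energy_space_def L2_def v_def \<eta>_def)

lemma meas [measurable]: "u \<in> borel_measurable borel" "v \<in> borel_measurable borel"
    "\<eta> \<in> borel_measurable borel"
  using cont_u cont_\<eta> vL1 by (auto intro: L1_loc_measurable borel_measurable_continuous_onI)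

lemma v_sq_L1: "(\<lambda>x. (norm (v x))\<^sup>2) \<in> L1_loc"
proof -
  have "set_integrable lborel K (\<lambda>x. (norm (v x))\<^sup>2)" if "compact K" for K
    unfolding set_integrable_def
    by (rule integrable_mult_indicator[OF _ L2(1)]) (use borel_compact[OF that] in simp)
  then show ?thesis by (simp add: L1_loc_def)
qed

lemma w_L1: "w \<in> L1_loc"
proof (rule L1_loc_bound[OF vL1])
  show "w \<in> borel_measurable borel" unfolding w_def by measurable
  show "continuous_on UNIV (\<lambda>x. 1 + 2 * \<bar>\<kappa>\<bar> * norm (u x) * norm (u x))"
    by (intro continuous_intros cont_u)
  fix x
  have "norm (w x) \<le> norm (v x) + \<bar>2 * \<kappa> * (u x \<bullet> v x)\<bar> * norm (u x)"
    unfolding w_def by (rule order.trans[OF norm_triangle_ineq4]) simp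
  also have "\<bar>2 * \<kappa> * (u x \<bullet> v x)\<bar> \<le> 2 * \<bar>\<kappa>\<bar> * (norm (u x) * norm (v x))"
    unfolding abs_mult using Cauchy_Schwarz_ineq2[of "u x" "v x"] by (intro mult_mono) auto
  finally show "norm (w x) \<le> (1 + 2 * \<bar>\<kappa>\<bar> * norm (u x) * norm (u x)) * norm (v x)"
    by (simp add: algebra_simps mult_right_mono)
qed

lemma rhs_L1: "(\<lambda>x. rhs (v x) x) \<in> L1_loc"
proof -
  have 1: "(\<lambda>x. \<i> * complex_of_real c * v x) \<in> L1_loc"
    by (rule L1_loc_bound[OF vL1, of _ "\<lambda>_. \<bar>c\<bar>"]) (auto simp: norm_mult)
  have 2: "(\<lambda>x. u x * complex_of_real (\<eta> x)) \<in> L1_loc"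
    by (intro L1_loc_continuous continuous_intros cont_u cont_\<eta>)
  \<comment> \<open>Quadratic in \<open>v\<close>, hence controlled by the finite energy and not by
    the local integrability of \<open>v\<close>.\<close>
  have 3: "(\<lambda>x. (2 * \<kappa> * (u x \<bullet> v x)) *\<^sub>R v x) \<in> L1_loc"
  proof (rule L1_loc_bound[OF v_sq_L1, of _ "\<lambda>x. 2 * \<bar>\<kappa>\<bar> * norm (u x)"])
    show "continuous_on UNIV (\<lambda>x. 2 * \<bar>\<kappa>\<bar> * norm (u x))"
      by (intro continuous_intros cont_u)
    fix x
    have "norm ((2 * \<kappa> * (u x \<bullet> v x)) *\<^sub>R v x) = 2 * \<bar>\<kappa>\<bar> * \<bar>u x \<bullet> v x\<bar> * norm (v x)"
      by (simp add: abs_mult)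
    also have "\<dots> \<le> 2 * \<bar>\<kappa>\<bar> * (norm (u x) * norm (v x)) * norm (v x)"
      using Cauchy_Schwarz_ineq2[of "u x" "v x"] by (intro mult_mono) auto
    finally show "norm ((2 * \<kappa> * (u x \<bullet> v x)) *\<^sub>R v x) \<le> 2 * \<bar>\<kappa>\<bar> * norm (u x) * norm ((norm (v x))\<^sup>2)"
      by (simp add: power2_eq_square algebra_simps)
  qed simp
  show ?thesis
    using L1_loc_diff[OF L1_loc_continuous[OF continuous_on_const[of UNIV 0]] L1_loc_add[OF L1_loc_add[OF 1 2] 3]]
    unfolding rhs_def by simp
qed

lemma w_weak_deriv: "has_weak_deriv w (\<lambda>x. rhs (v x) x)"
  unfolding has_weak_deriv_iff
proof (intro conjI allI impI w_L1 rhs_L1)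
  fix \<psi> :: "real \<Rightarrow> real" assume \<psi>: "test_fun \<psi>"
  note iw = integrable_test_L1_loc[OF test_fun_Dn[OF \<psi>] w_L1]
  note ir = integrable_test_L1_loc[OF \<psi> rhs_L1]
  have [measurable]: "\<psi> \<in> borel_measurable borel" "Dn 1 \<psi> \<in> borel_measurable borel"
    using \<psi> test_fun_Dn[OF \<psi>] by (auto intro: test_fun_measurable)
  \<comment> \<open>\<open>Z\<close> is the defect of the claimed identity. Testing with
    \<open>\<psi>\<close> times this constant vector gives \<open>Z \<bullet> Z = 0\<close>, so one
    complex test function settles all components at once.\<close>
  define Z where "Z = (LINT x|lborel. Dn 1 \<psi> x *\<^sub>R w x) + (LINT x|lborel. \<psi> x *\<^sub>R rhs (v x) x)"
  define \<phi> where "\<phi> = (\<lambda>x. \<psi> x *\<^sub>R Z)"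
  have \<phi>: "test_fun \<phi>"
    unfolding \<phi>_def by (rule test_fun_linear_image[OF \<psi> bounded_linear_scaleR_left])
  have D\<phi>: "vector_derivative \<phi> (at x) = Dn 1 \<psi> x *\<^sub>R Z" for x
    unfolding \<phi>_def
    by (intro vector_derivative_at bounded_linear.has_vector_derivative[OF bounded_linear_scaleR_left] test_fun_deriv \<psi>)
  have u\<phi>: "has_weak_deriv (\<lambda>t. u t \<bullet> \<phi> t) (\<lambda>x. v x \<bullet> \<phi> x + u x \<bullet> (Dn 1 \<psi> x *\<^sub>R Z))"
    using has_weak_deriv_inner_test_fun[OF uv \<phi>] unfolding Dn_1[of \<phi>] D\<phi> .
  \<comment> \<open>The weak equation contains a chosen representative of this derivative, which
    agrees with the Leibniz formula only almost everywhere.\<close>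
  define d where "d = weak_deriv (\<lambda>t. u t \<bullet> \<phi> t)"
  have d: "AE x in lborel. d x = v x \<bullet> \<phi> x + u x \<bullet> (Dn 1 \<psi> x *\<^sub>R Z)"
    unfolding d_def by (rule has_weak_deriv_unique[OF has_weak_deriv_weak_deriv[OF u\<phi>] u\<phi>])
  have [measurable]: "d \<in> borel_measurable borel"
    using has_weak_deriv_weak_deriv[OF u\<phi>] unfolding d_def has_weak_deriv_def by (auto intro: L1_loc_measurable)
  have [measurable]: "\<phi> \<in> borel_measurable borel"
    using \<phi> by (rule test_fun_measurable)
  have weak: "(LINT x|lborel. (\<i> * complex_of_real c * weak_deriv u x
             + u x * complex_of_real (1 - (norm (u x))\<^sup>2)) \<bullet> \<phi> x
          - weak_deriv u x \<bullet> vector_derivative \<phi> (at x)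
          + 2 * \<kappa> * (u x \<bullet> weak_deriv u x) * weak_deriv (\<lambda>t. u t \<bullet> \<phi> t) x) = 0"
    if "test_fun \<phi>" for \<phi>
    using weak_sol that by (simp only: weak_solution_def)
  have "0 = (LINT x|lborel.
          (\<i> * complex_of_real c * v x + u x * complex_of_real (\<eta> x)) \<bullet> \<phi> x
          - v x \<bullet> (Dn 1 \<psi> x *\<^sub>R Z) + 2 * \<kappa> * (u x \<bullet> v x) * d x)"
    unfolding d_def v_def \<eta>_def D\<phi>[symmetric] by (rule weak[OF \<phi>, symmetric])
  also have "\<dots> = (LINT x|lborel. - ((Dn 1 \<psi> x *\<^sub>R w x) \<bullet> Z + (\<psi> x *\<^sub>R rhs (v x) x) \<bullet> Z))"
  proof (rule integral_cong_AE)
    show "(\<lambda>x. - ((Dn 1 \<psi> x *\<^sub>R w x) \<bullet> Z + (\<psi> x *\<^sub>R rhs (v x) x) \<bullet> Z)) \<in> borel_measurable lborel"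
      using borel_measurable_integrable[OF iw] borel_measurable_integrable[OF ir]
      by (simp del: inner_scaleR_left One_nat_def)
    show "AE x in lborel. (\<i> * complex_of_real c * v x + u x * complex_of_real (\<eta> x)) \<bullet> \<phi> x
          - v x \<bullet> (Dn 1 \<psi> x *\<^sub>R Z) + 2 * \<kappa> * (u x \<bullet> v x) * d x =
        - ((Dn 1 \<psi> x *\<^sub>R w x) \<bullet> Z + (\<psi> x *\<^sub>R rhs (v x) x) \<bullet> Z)"
      using d by eventually_elim
        (simp add: \<phi>_def w_def rhs_def inner_add_left inner_diff_left inner_minus_left algebra_simps)
  qed (simp del: One_nat_def)
  also have "\<dots> = - ((LINT x|lborel. Dn 1 \<psi> x *\<^sub>R w x) \<bullet> Z + (LINT x|lborel. \<psi> x *\<^sub>R rhs (v x) x) \<bullet> Z)"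
    using iw ir by (simp del: inner_scaleR_left One_nat_def)
  also have "\<dots> = - (Z \<bullet> Z)"
    by (simp only: Z_def inner_add_left)
  finally show "(LINT x|lborel. Dn 1 \<psi> x *\<^sub>R w x) = - (LINT x|lborel. \<psi> x *\<^sub>R rhs (v x) x)"
    by (simp add: Z_def eq_neg_iff_add_eq_0)
qed

lemma primitive_u: "primitive u v"
proof -
  obtain F where F: "primitive F v" "AE x in lborel. u x = F x"
    using has_weak_deriv_AE_primitive[OF uv] .
  then have "u = F"
    by (intro continuous_AE_eq cont_u) (auto simp: primitive_def)
  then show ?thesis using F by simp
qed

definition F where "F = (SOME F. primitive F (\<lambda>x. rhs (v x) x) \<and> (AE x in lborel. w x = F x))"

lemma F: "primitive F (\<lambda>x. rhs (v x) x)" "AE x in lborel. w x = F x"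
proof -
  have "\<exists>F. primitive F (\<lambda>x. rhs (v x) x) \<and> (AE x in lborel. w x = F x)"
    using has_weak_deriv_AE_primitive[OF w_weak_deriv] by metis
  from someI_ex[OF this]
  show "primitive F (\<lambda>x. rhs (v x) x)" "AE x in lborel. w x = F x"
    unfolding F_def by auto
qed

text \<open>Solves \<open>w = v - 2 * \<kappa> * (u \<bullet> v) *\<^sub>R u\<close> for \<open>v\<close>, with the continuous representative \<open>F\<close> of \<open>w\<close>.\<close>

definition V where "V = (\<lambda>x. F x + (2 * \<kappa> * (u x \<bullet> F x) / s x) *\<^sub>R u x)"

lemma v_eq_V: "AE x in lborel. x \<in> reg \<longrightarrow> v x = V x"
  using F(2)
proof eventually_elim
  case (elim x)
  \<comment> \<open>Pairing \<open>w\<close> with \<open>u\<close> isolates the scalar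
    \<open>u \<bullet> v\<close>, the only unknown left in the definition of \<open>w\<close>;
    dividing by \<open>s\<close> recovers it.\<close>
  have "u x \<bullet> F x = (u x \<bullet> v x) * s x"
    unfolding elim[symmetric] w_def s_def by (simp add: inner_diff_right power2_norm_eq_inner algebra_simps)
  then show ?case
    by (auto simp: reg_def V_def elim[symmetric] w_def)
qed

lemma cont_F: "continuous_on UNIV F"
  using F(1) by (simp add: primitive_def)

lemma cont_V: "continuous_on reg V"
  unfolding V_def using cont_F cont_u cont_s
  by (auto intro!: continuous_intros intro: continuous_on_subset simp: reg_def)

lemma u_deriv: "x \<in> reg \<Longrightarrow> (u has_vector_derivative V x) (at x)"
  by (rule primitive_has_vector_derivative[OF primitive_u vL1 open_reg cont_V v_eq_V])

lemma cont_rhs: "continuous_on reg (\<lambda>x. rhs (V x) x)"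
  unfolding rhs_def using cont_V cont_u cont_\<eta>
  by (auto intro!: continuous_intros intro: continuous_on_subset)

lemma F_deriv: "x \<in> reg \<Longrightarrow> (F has_vector_derivative rhs (V x) x) (at x)"
proof (rule primitive_has_vector_derivative[OF F(1) rhs_L1 open_reg cont_rhs])
  show "AE x in lborel. x \<in> reg \<longrightarrow> rhs (v x) x = rhs (V x) x"
    using v_eq_V by eventually_elim auto
qed

lemma s_deriv: "x \<in> reg \<Longrightarrow> (s has_real_derivative - 4 * \<kappa> * (u x \<bullet> V x)) (at x)"
  unfolding s_def power2_norm_eq_inner has_real_derivative_iff_has_vector_derivative
  using u_deriv[of x]
  by (auto intro!: derivative_eq_intros has_vector_derivative_eq_rhs
        [OF bounded_bilinear.has_vector_derivative[OF bounded_bilinear_inner]] simp: inner_commute)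

lemma \<eta>_deriv: "x \<in> reg \<Longrightarrow> (\<eta> has_real_derivative - 2 * (u x \<bullet> V x)) (at x)"
  unfolding \<eta>_def power2_norm_eq_inner has_real_derivative_iff_has_vector_derivative
  using u_deriv[of x]
  by (auto intro!: derivative_eq_intros has_vector_derivative_eq_rhs
        [OF bounded_bilinear.has_vector_derivative[OF bounded_bilinear_inner]] simp: inner_commute)

text \<open>The outcome of the product and quotient rules for \<open>V\<close>. It provides
  existence and continuity of the second derivative; calculations use \<open>strong_eq\<close>
  instead.\<close>

definition V2 where
  "V2 = (\<lambda>x. rhs (V x) x
     + (2 * \<kappa> * ((V x \<bullet> F x + u x \<bullet> rhs (V x) x) * s x + (u x \<bullet> F x) * (4 * \<kappa> * (u x \<bullet> V x))) / (s x)\<^sup>2) *\<^sub>R u x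
     + (2 * \<kappa> * (u x \<bullet> F x) / s x) *\<^sub>R V x)"

lemma cont_V2: "continuous_on reg V2"
  unfolding V2_def using cont_F cont_u cont_s cont_V cont_rhs
  by (auto intro!: continuous_intros intro: continuous_on_subset simp: reg_def)

lemma V_deriv:
  assumes x: "x \<in> reg"
  shows "(V has_vector_derivative V2 x) (at x)"
proof -
  have uF: "((\<lambda>x. u x \<bullet> F x) has_real_derivative V x \<bullet> F x + u x \<bullet> rhs (V x) x) (at x)"
    unfolding has_real_derivative_iff_has_vector_derivative
    by (rule has_vector_derivative_eq_rhs[OF bounded_bilinear.has_vector_derivative[OF bounded_bilinear_inner u_deriv[OF x] F_deriv[OF x]]])
      (simp add: add.commute)
  have "((\<lambda>x. 2 * \<kappa> * (u x \<bullet> F x) / s x) has_real_derivative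
      2 * \<kappa> * ((V x \<bullet> F x + u x \<bullet> rhs (V x) x) * s x + (u x \<bullet> F x) * (4 * \<kappa> * (u x \<bullet> V x))) / (s x)\<^sup>2) (at x)"
    using x by (auto intro!: derivative_eq_intros uF s_deriv simp: reg_def field_simps power2_eq_square)
  from has_vector_derivative_add[OF F_deriv[OF x] has_vector_derivative_scaleR[OF this u_deriv[OF x]]]
  show ?thesis
    unfolding V_def[abs_def] V2_def
    by (rule has_vector_derivative_eq_rhs) (simp add: V_def algebra_simps)
qed

lemma F_eq: "x \<in> reg \<Longrightarrow> F x = V x - (2 * \<kappa> * (u x \<bullet> V x)) *\<^sub>R u x"
proof -
  assume x: "x \<in> reg"
  then have "u x \<bullet> V x = (u x \<bullet> F x) / s x"
    unfolding V_def inner_add_right inner_scaleR_right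
    by (simp add: reg_def field_simps) (simp add: s_def power2_norm_eq_inner algebra_simps)
  then show ?thesis by (simp add: V_def)
qed

text \<open>Differentiating the formula for \<open>F\<close> in terms of \<open>V\<close> and
  comparing with \<open>rhs\<close> cancels the term
  \<open>(2 * \<kappa> * (u x \<bullet> V x)) *\<^sub>R V x\<close> and leaves the travelling wave
  equation in classical form.\<close>

lemma strong_eq:
  assumes x: "x \<in> reg"
  shows "V2 x = (2 * \<kappa> * (V x \<bullet> V x + u x \<bullet> V2 x)) *\<^sub>R u x - \<i> * complex_of_real c * V x - complex_of_real (\<eta> x) * u x"
proof -
  have uV: "((\<lambda>x. u x \<bullet> V x) has_real_derivative V x \<bullet> V x + u x \<bullet> V2 x) (at x)"
    unfolding has_real_derivative_iff_has_vector_derivative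
    by (rule has_vector_derivative_eq_rhs[OF bounded_bilinear.has_vector_derivative[OF bounded_bilinear_inner u_deriv[OF x] V_deriv[OF x]]])
      (simp add: add.commute)
  have "((\<lambda>x. 2 * \<kappa> * (u x \<bullet> V x)) has_real_derivative 2 * \<kappa> * (V x \<bullet> V x + u x \<bullet> V2 x)) (at x)"
    by (rule DERIV_cmult[OF uV])
  from has_vector_derivative_diff[OF V_deriv[OF x] has_vector_derivative_scaleR[OF this u_deriv[OF x]]]
  have "(F has_vector_derivative V2 x - ((2 * \<kappa> * (u x \<bullet> V x)) *\<^sub>R V x + (2 * \<kappa> * (V x \<bullet> V x + u x \<bullet> V2 x)) *\<^sub>R u x)) (at x)"
    by (rule has_vector_derivative_transform_within_open[OF _ open_reg x]) (simp add: F_eq)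
  from vector_derivative_unique_at[OF this F_deriv[OF x]]
  show ?thesis
    by (simp add: rhs_def algebra_simps)
qed

text \<open>Used contrapositively: a singular solution must reach the level where \<open>s\<close>
  vanishes.\<close>

lemma C2_if_no_singularity:
  assumes "reg = UNIV"
  shows "Ck_on 2 u UNIV"
proof -
  have 1: "Dn 1 u = V"
    unfolding Dn_1 using u_deriv assms by (auto simp: vector_derivative_at)
  have 2: "Dn 2 u = V2"
    using V_deriv assms 1 Dn_Suc[of 1 u] by (auto simp: vector_derivative_at numeral_2_eq_2)
  have "j \<le> 2 \<longleftrightarrow> j = 0 \<or> j = 1 \<or> j = 2" "j < 2 \<longleftrightarrow> j = 0 \<or> j = 1" for j :: nat by auto
  moreover have "u differentiable at x" "V differentiable at x" for x
    using u_deriv[of x] V_deriv[of x] assms by (auto intro: differentiableI_vector)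
  ultimately show ?thesis
    unfolding Ck_on_def using cont_u cont_V cont_V2 assms
    by (auto simp: 1[simplified] 2)
qed


section \<open>Behaviour at infinity\<close>

lemma tail_small:
  assumes "\<delta> > 0"
  obtains X where "X > 0"
    "\<And>x. \<bar>x\<bar> \<ge> X \<Longrightarrow> \<bar>norm (u x) - 1\<bar> \<le> \<delta>"
    "\<And>p. X \<le> p \<or> p + 1 \<le> - X \<Longrightarrow> {p..p + 1} \<subseteq> reg \<Longrightarrow>
       \<exists>x\<in>{p..p + 1}. (norm (V x))\<^sup>2 + (\<eta> x)\<^sup>2 \<le> \<delta>"
proof -
  \<comment> \<open>With \<open>sqrt \<epsilon> \<le> \<delta> / 2\<close>, the deviation of
    \<open>norm u\<close> from 1 at one good point and its oscillation over a unit interval add up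
    to at most \<open>\<delta>\<close>. The entry \<open>\<delta>\<close> of the minimum serves the
    claim about \<open>V\<close> and \<open>\<eta>\<close>.\<close>
  define \<epsilon> where "\<epsilon> = min \<delta> ((\<delta> / 2)\<^sup>2)"
  define e where "e = (\<lambda>x. (norm (v x))\<^sup>2 + (\<eta> x)\<^sup>2)"
  have \<epsilon>: "\<epsilon> > 0" "\<epsilon> \<le> \<delta>"
    using assms by (auto simp: \<epsilon>_def)
  have "sqrt \<epsilon> \<le> sqrt ((\<delta> / 2)\<^sup>2)"
    by (intro real_sqrt_le_mono) (simp add: \<epsilon>_def)
  then have sqrt_\<epsilon>: "sqrt \<epsilon> \<le> \<delta> / 2"
    using assms by simp
  have e: "integrable lborel e" "\<And>x. e x \<ge> 0"
    unfolding e_def by (auto intro!: Bochner_Integration.integrable_add L2)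
  obtain X where X: "X > 0" "\<And>p. X \<le> p \<or> p + 1 \<le> - X \<Longrightarrow> (LINT x:{p..p + 1}|lborel. e x) \<le> \<epsilon>"
    using integrable_tail[OF e \<epsilon>(1)] by metis
  have ie: "set_integrable lborel {p..q} e" for p q
    unfolding set_integrable_def by (rule integrable_mult_indicator[OF _ e(1)]) simp
  have iv: "set_integrable lborel {p..q} (\<lambda>x. norm (v x))" for p q
    using set_integrable_norm[OF L1_loc_set_integrable[OF vL1]] .
  \<comment> \<open>AM-GM: \<open>2 * norm v * sqrt \<epsilon> \<le> \<epsilon> + (norm v)\<^sup>2\<close>\<close>
  have du: "norm (u x - u y) \<le> sqrt \<epsilon>" if p: "X \<le> p \<or> p + 1 \<le> - X" and xy: "p \<le> y" "y \<le> x" "x \<le> p + 1" for p x y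
  proof -
    have "norm (u x - u y) = norm (LINT t:{y..x}|lborel. v t)"
      using primitive_u xy by (simp add: primitive_def)
    also have "\<dots> \<le> (LINT t:{y..x}|lborel. norm (v t))"
      using set_integral_norm_bound[OF L1_loc_set_integrable[OF vL1]] .
    also have "\<dots> \<le> (LINT t:{p..p + 1}|lborel. sqrt \<epsilon> / 2 + e t / (2 * sqrt \<epsilon>))"
      unfolding set_lebesgue_integral_def
    proof (rule integral_mono)
      show "integrable lborel (\<lambda>t. indicator {y..x} t *\<^sub>R norm (v t))"
        using iv unfolding set_integrable_def .
      have "set_integrable lborel {p..p + 1} (\<lambda>t. sqrt \<epsilon> / 2)"
        by (rule L1_loc_set_integrable[OF L1_loc_continuous[OF continuous_on_const]])
      then show "integrable lborel (\<lambda>t. indicator {p..p + 1} t *\<^sub>R (sqrt \<epsilon> / 2 + e t / (2 * sqrt \<epsilon>)))"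
        using set_integrable_divide[OF ie] unfolding set_integrable_def[symmetric]
        by (intro set_integral_add(1)) auto
      fix t
      have "0 \<le> (norm (v t) - sqrt \<epsilon>)\<^sup>2" by simp
      then have "norm (v t) * (2 * sqrt \<epsilon>) \<le> \<epsilon> + (norm (v t))\<^sup>2"
        using \<epsilon> by (simp add: power2_diff algebra_simps)
      also have "\<dots> \<le> \<epsilon> + e t" by (simp add: e_def)
      finally have "norm (v t) \<le> (\<epsilon> + e t) / (2 * sqrt \<epsilon>)"
        using \<epsilon>(1) by (simp add: pos_le_divide_eq)
      also have "\<dots> = sqrt \<epsilon> / 2 + e t / (2 * sqrt \<epsilon>)"
        using \<epsilon>(1) by (simp add: add_divide_distrib real_div_sqrt flip: divide_divide_eq_left)
      finally have "norm (v t) \<le> sqrt \<epsilon> / 2 + e t / (2 * sqrt \<epsilon>)" .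
      moreover have "0 \<le> sqrt \<epsilon> / 2 + e t / (2 * sqrt \<epsilon>)"
        using \<epsilon>(1) e(2) by (intro add_nonneg_nonneg divide_nonneg_pos) auto
      ultimately show "indicator {y..x} t *\<^sub>R norm (v t) \<le> indicator {p..p + 1} t *\<^sub>R (sqrt \<epsilon> / 2 + e t / (2 * sqrt \<epsilon>))"
        using xy by (auto simp: indicator_def)
    qed
    also have "\<dots> = sqrt \<epsilon> / 2 + (LINT t:{p..p + 1}|lborel. e t) / (2 * sqrt \<epsilon>)"
      using set_integral_add(2)[OF L1_loc_set_integrable[OF L1_loc_continuous[OF continuous_on_const]] set_integrable_divide[OF ie], of p "p + 1" "sqrt \<epsilon> / 2" "2 * sqrt \<epsilon>"]
      by (simp add: set_integral_const)
    also have "\<dots> \<le> sqrt \<epsilon> / 2 + \<epsilon> / (2 * sqrt \<epsilon>)"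
      using X(2)[OF p] \<epsilon>(1) by (intro add_left_mono divide_right_mono) auto
    also have "\<dots> = sqrt \<epsilon>"
      using \<epsilon>(1) real_div_sqrt[of \<epsilon>] by (simp add: field_simps)
    finally show ?thesis .
  qed
  have 1: "\<bar>norm (u x) - 1\<bar> \<le> \<delta>" if p: "X \<le> p \<or> p + 1 \<le> - X" and x: "x \<in> {p..p + 1}" for p x
  proof -
    \<comment> \<open>The integral bound yields one good point per unit interval, and
      \<open>du\<close> transports the estimate to the rest of the interval.\<close>
    have "\<exists>y\<in>{p..p + 1}. (\<eta> y)\<^sup>2 \<le> \<epsilon>"
      by (rule exists_le_of_integral_le[OF _ ie _ X(2)[OF p]])
        (auto simp: e_def intro!: continuous_intros continuous_on_subset[OF cont_\<eta>])
    then obtain y where y: "y \<in> {p..p + 1}" "(\<eta> y)\<^sup>2 \<le> \<epsilon>" by blast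
    have "\<bar>norm (u y) - 1\<bar> * 1 \<le> \<bar>norm (u y) - 1\<bar> * \<bar>norm (u y) + 1\<bar>"
      by (intro mult_left_mono) auto
    also have "\<dots> = \<bar>\<eta> y\<bar>"
      unfolding abs_mult[symmetric] by (simp add: \<eta>_def power2_eq_square algebra_simps abs_minus_commute)
    also have "\<dots> \<le> sqrt \<epsilon>"
      using y(2) by (rule real_le_rsqrt[of "\<bar>\<eta> y\<bar>", simplified])
    finally have "\<bar>norm (u y) - 1\<bar> \<le> sqrt \<epsilon>" by simp
    moreover have "norm (u x - u y) \<le> sqrt \<epsilon>"
      using du[OF p, of y x] du[OF p, of x y] x y(1) by (cases "y \<le> x") (auto simp: norm_minus_commute)
    then have "\<bar>norm (u x) - norm (u y)\<bar> \<le> sqrt \<epsilon>"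
      using norm_triangle_ineq3[of "u x" "u y"] by linarith
    ultimately show ?thesis using sqrt_\<epsilon> by linarith
  qed
  show ?thesis
  proof (rule that[of "X + 1"])
    fix x assume "\<bar>x\<bar> \<ge> X + 1"
    then show "\<bar>norm (u x) - 1\<bar> \<le> \<delta>"
      using 1[of x x] 1[of "x - 1" x] X(1) by (cases "x \<ge> 0") auto
  next
    fix p assume p: "X + 1 \<le> p \<or> p + 1 \<le> - (X + 1)" and sub: "{p..p + 1} \<subseteq> reg"
    have "\<exists>x\<in>{p..p + 1}. (norm (V x))\<^sup>2 + (\<eta> x)\<^sup>2 \<le> \<epsilon>"
    proof (rule exists_le_of_integral_le[OF _ ie _ X(2)])
      show "continuous_on {p..p + 1} (\<lambda>x. (norm (V x))\<^sup>2 + (\<eta> x)\<^sup>2)"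
        by (intro continuous_intros continuous_on_subset[OF cont_V sub] continuous_on_subset[OF cont_\<eta>]) auto
      show "AE x in lborel. x \<in> {p..p + 1} \<longrightarrow> (norm (V x))\<^sup>2 + (\<eta> x)\<^sup>2 \<le> e x"
        using v_eq_V by eventually_elim (use sub in \<open>auto simp: e_def\<close>)
    qed (use p X(1) in auto)
    then show "\<exists>x\<in>{p..p + 1}. (norm (V x))\<^sup>2 + (\<eta> x)\<^sup>2 \<le> \<delta>"
      using \<epsilon>(2) by force
  qed (use X(1) in auto)
qed

lemma norm_u_tendsto: "((\<lambda>x. norm (u x)) \<longlongrightarrow> 1) at_infinity"
proof (rule tendstoI)
  fix d :: real assume "d > 0"
  then obtain X where X: "\<And>x. \<bar>x\<bar> \<ge> X \<Longrightarrow> \<bar>norm (u x) - 1\<bar> \<le> d / 2"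
    using tail_small[of "d / 2"] by (metis half_gt_zero)
  show "\<forall>\<^sub>F x in at_infinity. dist (norm (u x)) 1 < d"
    unfolding eventually_at_infinity dist_real_def using X \<open>d > 0\<close> by (intro exI[of _ X]) force
qed

lemma \<eta>_tendsto: "(\<eta> \<longlongrightarrow> 0) at_infinity"
  unfolding \<eta>_def using tendsto_diff[OF tendsto_const tendsto_power[OF norm_u_tendsto, of 2], of 1] by simp

section \<open>First integrals and the profile equation\<close>

definition momentum where "momentum = (\<lambda>x. (\<i> * u x) \<bullet> V x - c * \<eta> x / 2)"
text \<open>\<open>momentum\<close> and \<open>hamiltonian\<close> are the conserved quantities that
  belong to phase rotation and to translation: they arise by pairing the equation with
  \<open>\<i> * u\<close> and with \<open>V\<close>.\<close>

definition hamiltonian where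
  "hamiltonian = (\<lambda>x. (V x \<bullet> V x) / 2 - \<kappa> * (u x \<bullet> V x)\<^sup>2 - (\<eta> x)\<^sup>2 / 4)"

lemma momentum_deriv:
  assumes x: "x \<in> reg"
  shows "(momentum has_real_derivative 0) (at x)"
proof -
  have iu: "((\<lambda>x. \<i> * u x) has_vector_derivative \<i> * V x) (at x)"
    by (rule has_vector_derivative_mult_right[OF u_deriv[OF x]])
  have "((\<lambda>x. (\<i> * u x) \<bullet> V x) has_real_derivative (\<i> * u x) \<bullet> V2 x + (\<i> * V x) \<bullet> V x) (at x)"
    unfolding has_real_derivative_iff_has_vector_derivative
    by (rule bounded_bilinear.has_vector_derivative[OF bounded_bilinear_inner iu V_deriv[OF x]])
  then have "(momentum has_real_derivative (\<i> * u x) \<bullet> V2 x + (\<i> * V x) \<bullet> V x + c * (u x \<bullet> V x)) (at x)"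
    unfolding momentum_def by (auto intro!: derivative_eq_intros \<eta>_deriv x)
  moreover have "(\<i> * V x) \<bullet> V x = 0" "(\<i> * u x) \<bullet> u x = 0" "(\<i> * u x) \<bullet> (\<i> * V x) = u x \<bullet> V x"
    by (simp_all add: inner_complex_def)
  moreover have "(\<i> * u x) \<bullet> V2 x = - c * (u x \<bullet> V x)"
    by (subst strong_eq[OF x]) (simp add: inner_complex_def algebra_simps)
  ultimately show ?thesis by simp
qed

lemma hamiltonian_deriv:
  assumes x: "x \<in> reg"
  shows "(hamiltonian has_real_derivative 0) (at x)"
proof -
  have VV: "((\<lambda>x. V x \<bullet> V x) has_real_derivative 2 * (V x \<bullet> V2 x)) (at x)"
    unfolding has_real_derivative_iff_has_vector_derivative
    by (rule has_vector_derivative_eq_rhs[OF bounded_bilinear.has_vector_derivative[OF bounded_bilinear_inner V_deriv[OF x] V_deriv[OF x]]])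
      (simp add: inner_commute)
  have uV: "((\<lambda>x. u x \<bullet> V x) has_real_derivative V x \<bullet> V x + u x \<bullet> V2 x) (at x)"
    unfolding has_real_derivative_iff_has_vector_derivative
    by (rule has_vector_derivative_eq_rhs[OF bounded_bilinear.has_vector_derivative[OF bounded_bilinear_inner u_deriv[OF x] V_deriv[OF x]]])
      (simp add: add.commute)
  have "(hamiltonian has_real_derivative
      V x \<bullet> V2 x - 2 * \<kappa> * (u x \<bullet> V x) * (V x \<bullet> V x + u x \<bullet> V2 x) + \<eta> x * (u x \<bullet> V x)) (at x)"
    unfolding hamiltonian_def
    by (auto intro!: derivative_eq_intros \<eta>_deriv x VV uV)
  moreover have "V x \<bullet> V2 x = 2 * \<kappa> * (u x \<bullet> V x) * (V x \<bullet> V x + u x \<bullet> V2 x) - \<eta> x * (u x \<bullet> V x)"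
  proof -
    define q where "q = V x \<bullet> V x + u x \<bullet> V2 x"
    have "V x \<bullet> V2 x = V x \<bullet> ((2 * \<kappa> * q) *\<^sub>R u x - \<i> * complex_of_real c * V x - complex_of_real (\<eta> x) * u x)"
      using strong_eq[OF x] by (simp add: q_def)
    also have "\<dots> = 2 * \<kappa> * (u x \<bullet> V x) * q - \<eta> x * (u x \<bullet> V x)"
      by (simp add: inner_complex_def algebra_simps)
    finally show ?thesis by (simp add: q_def)
  qed
  ultimately show ?thesis by simp
qed

text \<open>Both quantities are constant on \<open>T\<close>, and an unbounded \<open>T\<close>
  contains points where \<open>V\<close> and \<open>\<eta>\<close> are as small as desired. The
  momentum is estimated through its square because the smallness at hand is that of
  \<open>(norm (V y))\<^sup>2 + (\<eta> y)\<^sup>2\<close>.\<close>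

lemma first_integrals_vanish:
  assumes T: "T \<subseteq> reg" "open T" "connected T"
    and unb: "(\<exists>b. {b<..} \<subseteq> T) \<or> (\<exists>a. {..<a} \<subseteq> T)" and x: "x \<in> T"
  shows "momentum x = 0" "hamiltonian x = 0"
proof -
  have const: "f y = f x" if "\<And>x. x \<in> reg \<Longrightarrow> (f has_real_derivative 0) (at x)" "y \<in> T" for f y
  proof (rule has_derivative_zero_unique_connected[OF T(2,3) _ _ x])
    show "(f has_derivative (\<lambda>h. 0)) (at x)" if "x \<in> T" for x
      using \<open>\<And>x. x \<in> reg \<Longrightarrow> (f has_real_derivative 0) (at x)\<close>[of x] that T(1)
      unfolding has_field_derivative_def by (auto simp: lambda_zero)
  qed fact
  have small: "\<exists>y\<in>T. norm (u y) \<le> 2 \<and> (norm (V y))\<^sup>2 + (\<eta> y)\<^sup>2 \<le> \<delta>" if "0 < \<delta>" "\<delta> \<le> 1" for \<delta>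
  proof -
    obtain X where X: "X > 0" "\<And>x. \<bar>x\<bar> \<ge> X \<Longrightarrow> \<bar>norm (u x) - 1\<bar> \<le> \<delta>"
      "\<And>p. X \<le> p \<or> p + 1 \<le> - X \<Longrightarrow> {p..p + 1} \<subseteq> reg \<Longrightarrow>
       \<exists>x\<in>{p..p + 1}. (norm (V x))\<^sup>2 + (\<eta> x)\<^sup>2 \<le> \<delta>"
      using tail_small[OF \<open>0 < \<delta>\<close>] by metis
    obtain p where p: "X \<le> p \<or> p + 1 \<le> - X" "{p..p + 1} \<subseteq> T"
      using unb
    proof
      assume "\<exists>b. {b<..} \<subseteq> T"
      then obtain b where b: "{b<..} \<subseteq> T" by blast
      show ?thesis by (rule that[of "max X (b + 1)"]) (use b in \<open>auto simp: subset_iff\<close>)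
    next
      assume "\<exists>a. {..<a} \<subseteq> T"
      then obtain a where a: "{..<a} \<subseteq> T" by blast
      show ?thesis by (rule that[of "min (- X - 1) (a - 2)"]) (use a in \<open>auto simp: subset_iff\<close>)
    qed
    then obtain y where y: "y \<in> {p..p + 1}" "(norm (V y))\<^sup>2 + (\<eta> y)\<^sup>2 \<le> \<delta>"
      using X(3) T(1) by (meson order.trans)
    have "\<bar>y\<bar> \<ge> X" using y(1) p(1) X(1) by auto
    from X(2)[OF this] have "norm (u y) \<le> 2" using that by linarith
    then show ?thesis using y p(2) by blast
  qed
  have zero: "z = 0" if "\<And>\<delta>. 0 < \<delta> \<Longrightarrow> \<delta> \<le> 1 \<Longrightarrow> \<bar>z\<bar> \<le> C * \<delta>" "C > 0" for z C :: real
  proof (rule ccontr)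
    assume "z \<noteq> 0"
    then have "\<bar>z\<bar> \<le> C * min 1 (\<bar>z\<bar> / (2 * C))"
      using that(2) by (intro that(1)) auto
    also have "\<dots> \<le> C * (\<bar>z\<bar> / (2 * C))"
      using that(2) by (intro mult_left_mono) auto
    also have "\<dots> = \<bar>z\<bar> / 2" using that(2) by simp
    finally show False using \<open>z \<noteq> 0\<close> by simp
  qed
  have inner_sq: "(a \<bullet> b)\<^sup>2 \<le> 4 * (norm b)\<^sup>2" if "norm a \<le> 2" for a b :: complex
  proof -
    have "\<bar>a \<bullet> b\<bar> \<le> norm a * norm b" by (rule Cauchy_Schwarz_ineq2)
    also have "\<dots> \<le> 2 * norm b" using that by (intro mult_right_mono) auto
    finally have "\<bar>a \<bullet> b\<bar>\<^sup>2 \<le> (2 * norm b)\<^sup>2" by (intro power_mono) auto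
    then show ?thesis by (simp add: power_mult_distrib)
  qed
  have "(momentum x)\<^sup>2 = 0"
  \<comment> \<open>The square of a difference is at most twice the sum of the squares. With
    \<open>norm (u y) \<le> 2\<close> the first square contributes the factor \<open>2 * 4\<close>,
    and the second at most \<open>c\<^sup>2\<close>.\<close>
  proof (rule zero[of _ "8 + c\<^sup>2"])
    fix \<delta> :: real assume "0 < \<delta>" "\<delta> \<le> 1"
    from small[OF this] obtain y where y: "y \<in> T" "norm (u y) \<le> 2" "(norm (V y))\<^sup>2 + (\<eta> y)\<^sup>2 \<le> \<delta>" by blast
    have 1: "((\<i> * u y) \<bullet> V y)\<^sup>2 \<le> 4 * (norm (V y))\<^sup>2"
      by (rule inner_sq) (use y(2) in \<open>simp add: norm_mult\<close>)
    have "(momentum y)\<^sup>2 \<le> 2 * ((\<i> * u y) \<bullet> V y)\<^sup>2 + 2 * (c * \<eta> y / 2)\<^sup>2"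
      unfolding momentum_def using sum_squares_bound[of "(\<i> * u y) \<bullet> V y" "- (c * \<eta> y / 2)"]
      by (simp add: power2_eq_square algebra_simps)
    also have "\<dots> \<le> 8 * (norm (V y))\<^sup>2 + c\<^sup>2 * (\<eta> y)\<^sup>2"
    proof -
      have "2 * (c * \<eta> y / 2)\<^sup>2 = c\<^sup>2 * (\<eta> y)\<^sup>2 / 2" "0 \<le> c\<^sup>2 * (\<eta> y)\<^sup>2"
        by (simp_all add: power_mult_distrib power_divide)
      then show ?thesis using 1 by linarith
    qed
    also have "\<dots> \<le> (8 + c\<^sup>2) * ((norm (V y))\<^sup>2 + (\<eta> y)\<^sup>2)"
      by (simp add: algebra_simps)
    also have "\<dots> \<le> (8 + c\<^sup>2) * \<delta>"
      using y(3) by (intro mult_left_mono) auto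
    finally show "\<bar>(momentum x)\<^sup>2\<bar> \<le> (8 + c\<^sup>2) * \<delta>"
      using const[OF momentum_deriv y(1)] by simp
  qed (simp add: add_pos_nonneg)
  then show "momentum x = 0" by simp
  show "hamiltonian x = 0"
  proof (rule zero[of _ "1 + 4 * \<bar>\<kappa>\<bar>"])
    fix \<delta> :: real assume "0 < \<delta>" "\<delta> \<le> 1"
    from small[OF this] obtain y where y: "y \<in> T" "norm (u y) \<le> 2" "(norm (V y))\<^sup>2 + (\<eta> y)\<^sup>2 \<le> \<delta>" by blast
    have 1: "\<bar>\<kappa>\<bar> * (u y \<bullet> V y)\<^sup>2 \<le> \<bar>\<kappa>\<bar> * (4 * (norm (V y))\<^sup>2)"
      by (intro mult_left_mono inner_sq y(2)) simp
    have "\<bar>hamiltonian y\<bar> \<le> (norm (V y))\<^sup>2 / 2 + \<bar>\<kappa>\<bar> * (u y \<bullet> V y)\<^sup>2 + (\<eta> y)\<^sup>2 / 4"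
    proof -
      have "\<bar>\<kappa> * (u y \<bullet> V y)\<^sup>2\<bar> = \<bar>\<kappa>\<bar> * (u y \<bullet> V y)\<^sup>2" by (simp add: abs_mult)
      then show ?thesis
        unfolding hamiltonian_def power2_norm_eq_inner[symmetric]
        using zero_le_power2[of "norm (V y)"] zero_le_power2[of "\<eta> y"] by linarith
    qed
    also have "\<dots> \<le> (1 + 4 * \<bar>\<kappa>\<bar>) * (norm (V y))\<^sup>2 + (1 + 4 * \<bar>\<kappa>\<bar>) * (\<eta> y)\<^sup>2"
    proof (rule add_mono)
      show "(norm (V y))\<^sup>2 / 2 + \<bar>\<kappa>\<bar> * (u y \<bullet> V y)\<^sup>2 \<le> (1 + 4 * \<bar>\<kappa>\<bar>) * (norm (V y))\<^sup>2"
      proof -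
        have "(1 + 4 * \<bar>\<kappa>\<bar>) * (norm (V y))\<^sup>2 = (norm (V y))\<^sup>2 + \<bar>\<kappa>\<bar> * (4 * (norm (V y))\<^sup>2)"
          by (simp add: algebra_simps)
        then show ?thesis using 1 zero_le_power2[of "norm (V y)"] by linarith
      qed
      have "1 / 4 * (\<eta> y)\<^sup>2 \<le> (1 + 4 * \<bar>\<kappa>\<bar>) * (\<eta> y)\<^sup>2"
        by (intro mult_right_mono) auto
      then show "(\<eta> y)\<^sup>2 / 4 \<le> (1 + 4 * \<bar>\<kappa>\<bar>) * (\<eta> y)\<^sup>2" by simp
    qed
    also have "\<dots> = (1 + 4 * \<bar>\<kappa>\<bar>) * ((norm (V y))\<^sup>2 + (\<eta> y)\<^sup>2)"
      by (simp add: algebra_simps)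
    also have "\<dots> \<le> (1 + 4 * \<bar>\<kappa>\<bar>) * \<delta>"
      using y(3) by (intro mult_left_mono) auto
    finally show "\<bar>hamiltonian x\<bar> \<le> (1 + 4 * \<bar>\<kappa>\<bar>) * \<delta>"
      using const[OF hamiltonian_deriv y(1)] by simp
  qed auto
qed

text \<open>\<open>u\<close> and \<open>\<i> * u\<close> are orthogonal and of equal length, so
  \<open>V\<close> splits by Pythagoras. The momentum gives the component along
  \<open>\<i> * u\<close>, the Hamiltonian gives \<open>V \<bullet> V\<close>, and an equation for
  \<open>u \<bullet> V\<close>, that is for the derivative of \<open>\<eta>\<close>,
  remains.\<close>

lemma profile_equation:
  assumes "momentum x = 0" "hamiltonian x = 0"
  shows "(- 2 * (u x \<bullet> V x))\<^sup>2 * (1 - 2 * \<kappa> + 2 * \<kappa> * \<eta> x) = (\<eta> x)\<^sup>2 * (2 - c\<^sup>2 - 2 * \<eta> x)"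
proof -
  define d where "d = u x \<bullet> V x"
  have "(norm (u x))\<^sup>2 * (V x \<bullet> V x) = d\<^sup>2 + ((\<i> * u x) \<bullet> V x)\<^sup>2"
    unfolding d_def cmod_power2 inner_complex_def by (simp add: power2_eq_square algebra_simps)
  moreover have "(\<i> * u x) \<bullet> V x = c * \<eta> x / 2"
    using assms(1) by (simp add: momentum_def)
  moreover have "V x \<bullet> V x = 2 * \<kappa> * d\<^sup>2 + (\<eta> x)\<^sup>2 / 2"
    using assms(2) by (simp add: hamiltonian_def d_def)
  moreover have "(norm (u x))\<^sup>2 = 1 - \<eta> x" by (simp add: \<eta>_def)
  ultimately have "(1 - \<eta> x) * (2 * \<kappa> * d\<^sup>2 + (\<eta> x)\<^sup>2 / 2) = d\<^sup>2 + (c * \<eta> x / 2)\<^sup>2" by simp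
  then show ?thesis
    unfolding d_def[symmetric] by (simp add: power2_eq_square field_simps)
qed

end

section \<open>The profile equation\<close>

text \<open>\<open>\<zeta>\<close> is \<open>\<eta>\<close> along one of the two half-lines. Inequalities are multiplied by \<open>A\<close> below, so that
  the cases \<open>\<kappa> < 1 / 2\<close> and \<open>\<kappa> > 1 / 2\<close> need no separate treatment.\<close>

locale profile =
  fixes c \<kappa> :: real and \<zeta> d :: "real \<Rightarrow> real"
  assumes \<kappa>: "\<kappa> > 0" and nondegenerate: "1 - 2 * \<kappa> \<noteq> 0" and same_sign: "(1 - 2 * \<kappa>) * (2 - c\<^sup>2) \<ge> 0"
    and cont: "continuous_on {0..} \<zeta>" and init: "\<zeta> 0 = 1 - 1 / (2 * \<kappa>)"
    and lim: "(\<zeta> \<longlongrightarrow> 0) at_top"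
    and regular: "\<And>x. x > 0 \<Longrightarrow> 1 - 2 * \<kappa> + 2 * \<kappa> * \<zeta> x \<noteq> 0"
    and deriv: "\<And>x. x > 0 \<Longrightarrow> (\<zeta> has_real_derivative d x) (at x)"
    and cont_d: "continuous_on {0<..} d"
    and ode: "\<And>x. x > 0 \<Longrightarrow> (d x)\<^sup>2 * (1 - 2 * \<kappa> + 2 * \<kappa> * \<zeta> x) = (\<zeta> x)\<^sup>2 * (2 - c\<^sup>2 - 2 * \<zeta> x)"
begin

definition A where "A = 1 - 2 * \<kappa>"
definition P where "P = 2 - c\<^sup>2"
definition S where "S = (\<lambda>y. A + 2 * \<kappa> * y)"
definition R where "R = (\<lambda>y. (P - 2 * y) / S y)"
definition r where "r = (\<lambda>x. sqrt (R (\<zeta> x)))"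
text \<open>Where \<open>S y\<close> is nonzero, \<open>S y * (1 + \<kappa> * R y)\<close> does not
  depend on \<open>y\<close> and equals \<open>B\<close>; moreover \<open>R\<close> has derivative
  \<open>- 2 * B / (S y)\<^sup>2\<close>. This lets the denominators \<open>S\<close> be traded for
  polynomials in \<open>r\<close>.\<close>

definition B where "B = A + \<kappa> * P"

lemma A0: "A \<noteq> 0" and AP: "A * P \<ge> 0"
  using nondegenerate same_sign by (auto simp: A_def P_def)

lemma AA: "A * A > 0"
  using A0 not_real_square_gt_zero[of A] by blast

lemma AB: "A * B > 0"
proof -
  have "A * B = A\<^sup>2 + \<kappa> * (A * P)" by (simp add: B_def power2_eq_square algebra_simps)
  then show ?thesis using A0 AP \<kappa> by (simp add: add_pos_nonneg)
qed

lemma B0: "B \<noteq> 0" using AB by auto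

lemma ode': "x > 0 \<Longrightarrow> (d x)\<^sup>2 = (\<zeta> x)\<^sup>2 * R (\<zeta> x)"
  using ode[of x] regular[of x] by (simp add: R_def S_def A_def P_def field_simps)

lemma cont_pos: "continuous_on {0<..} \<zeta>"
  by (rule continuous_on_subset[OF cont]) auto

lemma IVT_pos:
  fixes f :: "real \<Rightarrow> real"
  assumes "continuous_on {0<..} f" "\<And>x. x > 0 \<Longrightarrow> f x \<noteq> 0" "x > 0" "y > 0" "f y > 0"
  shows "f x > 0"
proof (rule ccontr)
  assume "\<not> f x > 0"
  then have "f x < 0" using assms by force
  have "connected (f ` {0<..})"
    by (intro connected_continuous_image assms) auto
  then have "0 \<in> f ` {0<..}"
    by (rule connectedD_interval[of _ "f x" "f y"]) (use assms \<open>f x < 0\<close> in auto)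
  then show False using assms(2) by force
qed

text \<open>\<open>S (\<zeta> x)\<close> has no zero on the open half-line and tends to
  \<open>A\<close>, so it keeps the sign of \<open>A\<close>.\<close>

lemma AS_pos: "x > 0 \<Longrightarrow> A * S (\<zeta> x) > 0"
proof -
  assume x: "x > 0"
  have "((\<lambda>x. A * S (\<zeta> x)) \<longlongrightarrow> A * (A + 2 * \<kappa> * 0)) at_top"
    unfolding S_def by (intro tendsto_intros lim)
  moreover have "A * (A + 2 * \<kappa> * 0) > 0" using AA by simp
  ultimately have "eventually (\<lambda>x. A * S (\<zeta> x) > 0) at_top"
    by (rule order_tendstoD)
  then have "eventually (\<lambda>x. A * S (\<zeta> x) > 0 \<and> x > 0) at_top"
    by (intro eventually_conj eventually_gt_at_top)
  then obtain y where y: "y > 0" "A * S (\<zeta> y) > 0"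
    by (auto simp: eventually_at_top_linorder)
  show ?thesis
  proof (rule IVT_pos[where y = y and f = "\<lambda>x. A * S (\<zeta> x)"])
    show "continuous_on {0<..} (\<lambda>x. A * S (\<zeta> x))"
      unfolding S_def by (intro continuous_intros cont_pos)
    show "A * S (\<zeta> x) \<noteq> 0" if "x > 0" for x
      using A0 regular[OF that] by (simp add: S_def A_def)
  qed (use x y in auto)
qed

lemma \<zeta>_init: "\<zeta> 0 = - A / (2 * \<kappa>)"
  using \<kappa> by (simp add: init A_def field_simps)

lemma \<zeta>_nonzero: "x \<ge> 0 \<Longrightarrow> \<zeta> x \<noteq> 0"
proof
  assume x: "x \<ge> 0" and z: "\<zeta> x = 0"
  have "x > 0" using x z \<zeta>_init A0 \<kappa> by (cases "x = 0") auto
  have zero: "\<zeta> e = 0" if e: "0 < e" "e < x" for e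
  proof -
    \<comment> \<open>\<open>R\<close> is bounded only away from the singular end, hence the lower
      limit \<open>e\<close>; the end itself is reached afterwards by continuity of
      \<open>\<zeta>\<close>.\<close>
    have "continuous_on {e..x} (\<lambda>t. R (\<zeta> t))"
      unfolding R_def S_def A_def using e
      by (intro continuous_intros continuous_on_subset[OF cont]) (auto simp: regular)
    then have "compact ((\<lambda>t. R (\<zeta> t)) ` {e..x})"
      by (intro compact_continuous_image) auto
    then obtain K where K: "\<And>t. t \<in> {e..x} \<Longrightarrow> norm (R (\<zeta> t)) \<le> K"
      by (meson compact_imp_bounded bounded_iff imageI)
    \<comment> \<open>Chosen so that \<open>L\<^sup>2 \<ge> \<bar>K\<bar>\<close>, because the
      equation bounds only the square of \<open>d\<close>.\<close>
    define L where "L = 1 + \<bar>K\<bar>"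
    have dL: "\<bar>d t\<bar> \<le> L * \<bar>\<zeta> t\<bar>" if "t \<in> {e..x}" for t
    proof -
      have "(d t)\<^sup>2 \<le> (\<zeta> t)\<^sup>2 * \<bar>K\<bar>"
        using ode'[of t] K[OF that] that e by (auto intro!: mult_left_mono)
      also have "\<dots> \<le> (\<zeta> t)\<^sup>2 * L\<^sup>2"
        by (intro mult_left_mono) (auto simp: L_def power2_eq_square algebra_simps)
      finally have "(d t)\<^sup>2 \<le> (L * \<zeta> t)\<^sup>2" by (simp add: power_mult_distrib mult.commute)
      then have "\<bar>d t\<bar> \<le> \<bar>L * \<zeta> t\<bar>" by (simp only: abs_le_square_iff)
      then show ?thesis by (simp add: abs_mult L_def)
    qed
    have "(\<zeta> e)\<^sup>2 * exp (2 * L * e) \<le> (\<zeta> x)\<^sup>2 * exp (2 * L * x)"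
    proof (rule DERIV_nonneg_imp_nondecreasing[of e x "\<lambda>t. (\<zeta> t)\<^sup>2 * exp (2 * L * t)"])
      fix t assume t: "e \<le> t" "t \<le> x"
      have "((\<lambda>t. (\<zeta> t)\<^sup>2 * exp (2 * L * t)) has_real_derivative
          2 * (\<zeta> t * d t + L * (\<zeta> t)\<^sup>2) * exp (2 * L * t)) (at t)"
        using t e by (auto intro!: derivative_eq_intros deriv simp: algebra_simps)
      moreover have "\<bar>\<zeta> t * d t\<bar> \<le> L * (\<zeta> t)\<^sup>2"
      proof -
        have "\<bar>\<zeta> t * d t\<bar> \<le> \<bar>\<zeta> t\<bar> * (L * \<bar>\<zeta> t\<bar>)"
          unfolding abs_mult using dL[of t] t by (intro mult_left_mono) auto
        then show ?thesis by (simp add: power2_eq_square algebra_simps flip: abs_mult)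
      qed
      then have "0 \<le> \<zeta> t * d t + L * (\<zeta> t)\<^sup>2" by linarith
      ultimately show "\<exists>y. ((\<lambda>t. (\<zeta> t)\<^sup>2 * exp (2 * L * t)) has_real_derivative y) (at t) \<and> 0 \<le> y"
        by (intro exI[of _ "2 * (\<zeta> t * d t + L * (\<zeta> t)\<^sup>2) * exp (2 * L * t)"] conjI) auto
    qed (use e in auto)
    then show ?thesis using z by (simp add: mult_le_0_iff)
  qed
  have "(\<zeta> \<longlongrightarrow> \<zeta> 0) (at_right 0)"
    using cont by (auto simp: continuous_on_def intro: tendsto_within_subset)
  moreover have "(\<zeta> \<longlongrightarrow> 0) (at_right 0)"
    by (rule tendsto_eventually) (use zero \<open>x > 0\<close> in \<open>auto simp: eventually_at_right\<close>)
  ultimately have "\<zeta> 0 = 0"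
    by (rule tendsto_unique[rotated]) simp
  then show False using \<zeta>_init A0 \<kappa> by auto
qed

lemma A\<zeta>_neg: "x \<ge> 0 \<Longrightarrow> A * \<zeta> x < 0"
proof (rule ccontr)
  assume x: "x \<ge> 0" and "\<not> A * \<zeta> x < 0"
  have "A * \<zeta> 0 = - (A * A / (2 * \<kappa>))" by (simp add: \<zeta>_init)
  also have "\<dots> < 0" using divide_pos_pos[OF AA, of "2 * \<kappa>"] \<kappa> by simp
  finally have "A * \<zeta> 0 < 0" .
  have "connected ((\<lambda>x. A * \<zeta> x) ` {0..})"
    by (intro connected_continuous_image continuous_intros cont) auto
  then have "0 \<in> (\<lambda>x. A * \<zeta> x) ` {0..}"
    by (rule connectedD_interval[of _ "A * \<zeta> 0" "A * \<zeta> x"]) (use \<open>A * \<zeta> 0 < 0\<close> \<open>\<not> A * \<zeta> x < 0\<close> x in auto)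
  then show False using A0 \<zeta>_nonzero by auto
qed

lemma S_ne: "x > 0 \<Longrightarrow> S (\<zeta> x) \<noteq> 0"
  using AS_pos[of x] by auto

lemma R_eq: "x > 0 \<Longrightarrow> R (\<zeta> x) = (A * P - 2 * (A * \<zeta> x)) / (A * S (\<zeta> x))"
  using A0 S_ne[of x] by (simp add: R_def field_simps)

lemma R_pos: "x > 0 \<Longrightarrow> R (\<zeta> x) > 0"
proof -
  assume x: "x > 0"
  have "R (\<zeta> x) = (A * P - 2 * (A * \<zeta> x)) / (A * S (\<zeta> x))"
    by (rule R_eq[OF x])
  also have "\<dots> > 0" using AP A\<zeta>_neg[of x] AS_pos[OF x] x by (intro divide_pos_pos) auto
  finally show ?thesis .
qed

lemma r_pos: "x > 0 \<Longrightarrow> r x > 0"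
  using R_pos by (simp add: r_def)

lemma r_sq: "x > 0 \<Longrightarrow> (r x)\<^sup>2 = R (\<zeta> x)"
  using R_pos[of x] by (simp add: r_def)

text \<open>\<open>d\<close> has no zero, so \<open>A * d\<close> has one sign. Were it negative,
  \<open>A * \<zeta>\<close> would decrease from a negative value and could not tend to 0.\<close>

lemma Ad_pos: "x > 0 \<Longrightarrow> A * d x > 0"
proof (rule ccontr)
  assume x: "x > 0" and nonpos: "\<not> A * d x > 0"
  have ne: "A * d y \<noteq> 0" if "y > 0" for y
    using ode'[OF that] \<zeta>_nonzero[of y] R_pos[OF that] that A0 by auto
  have "- (A * d x) > 0" using ne[OF x] nonpos by linarith
  have neg: "A * d y < 0" if y: "y > 0" for y
  proof -
    have "- (A * d y) > 0"
    proof (rule IVT_pos[OF _ _ y x, of "\<lambda>y. - (A * d y)"])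
      show "continuous_on {0<..} (\<lambda>y. - (A * d y))"
        by (intro continuous_intros cont_d)
      show "- (A * d y) \<noteq> 0" if "y > 0" for y using ne[OF that] by simp
    qed fact
    then show ?thesis by simp
  qed
  have "A * \<zeta> y \<le> A * \<zeta> x" if "y \<ge> x" for y
  proof (rule DERIV_nonpos_imp_nonincreasing[OF that])
    fix t assume "x \<le> t" "t \<le> y"
    then have "((\<lambda>t. A * \<zeta> t) has_real_derivative A * d t) (at t)" "A * d t \<le> 0"
      using x neg[of t] by (auto intro!: derivative_eq_intros deriv)
    then show "\<exists>z. ((\<lambda>t. A * \<zeta> t) has_real_derivative z) (at t) \<and> z \<le> 0" by blast
  qed
  moreover have "((\<lambda>y. A * \<zeta> y) \<longlongrightarrow> A * 0) at_top"
    by (intro tendsto_intros lim)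
  ultimately have "A * 0 \<le> A * \<zeta> x"
    by (intro tendsto_upperbound) (auto intro: eventually_mono[OF eventually_ge_at_top[of x]])
  then show False using A\<zeta>_neg[of x] x by simp
qed

lemma d_eq: "x > 0 \<Longrightarrow> d x = - (\<zeta> x * r x)"
proof -
  assume x: "x > 0"
  have "(d x)\<^sup>2 = (\<zeta> x * r x)\<^sup>2"
    using ode'[OF x] r_sq[OF x] by (simp add: power_mult_distrib)
  then have "d x = \<zeta> x * r x \<or> d x = - (\<zeta> x * r x)" by (simp add: power2_eq_iff)
  moreover have "d x \<noteq> \<zeta> x * r x"
  proof
    assume "d x = \<zeta> x * r x"
    then have "A * d x = (A * \<zeta> x) * r x" by simp
    also have "\<dots> < 0" using A\<zeta>_neg[of x] r_pos[OF x] x by (metis less_imp_le mult_neg_pos)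
    finally show False using Ad_pos[OF x] by simp
  qed
  ultimately show ?thesis by blast
qed

lemma \<zeta>_deriv: "x > 0 \<Longrightarrow> (\<zeta> has_real_derivative - (\<zeta> x * r x)) (at x)"
  using deriv[of x] d_eq[of x] by simp

lemma S_eq: "x > 0 \<Longrightarrow> S (\<zeta> x) * (1 + \<kappa> * (r x)\<^sup>2) = B"
  using S_ne[of x] by (simp add: r_sq R_def field_simps) (simp add: S_def B_def algebra_simps)

text \<open>The chain rule gives \<open>B * \<zeta> x / (S (\<zeta> x))\<^sup>2\<close>. Trading
  \<open>1 / S\<close> for \<open>(1 + \<kappa> * (r x)\<^sup>2) / B\<close> makes the right hand
  side polynomial, with the factor \<open>\<zeta>\<close>, as the algebra of generators
  requires.\<close>

lemma r_deriv:
  assumes x: "x > 0"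
  shows "(r has_real_derivative \<zeta> x * (1 + \<kappa> * (r x)\<^sup>2)\<^sup>2 / B) (at x)"
proof -
  have "((\<lambda>x. R (\<zeta> x)) has_real_derivative 2 * B * (\<zeta> x * r x) / (S (\<zeta> x))\<^sup>2) (at x)"
  proof -
    have "((\<lambda>x. P - 2 * \<zeta> x) has_real_derivative 2 * (\<zeta> x * r x)) (at x)"
      by (auto intro!: derivative_eq_intros \<zeta>_deriv x)
    moreover have "((\<lambda>x. S (\<zeta> x)) has_real_derivative - (2 * \<kappa> * (\<zeta> x * r x))) (at x)"
      unfolding S_def by (auto intro!: derivative_eq_intros \<zeta>_deriv x)
    ultimately have "((\<lambda>x. R (\<zeta> x)) has_real_derivative
        (2 * (\<zeta> x * r x) * S (\<zeta> x) - (P - 2 * \<zeta> x) * - (2 * \<kappa> * (\<zeta> x * r x))) / (S (\<zeta> x) * S (\<zeta> x))) (at x)"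
      unfolding R_def using S_ne[OF x] by (rule DERIV_divide)
    moreover have "2 * (\<zeta> x * r x) * S (\<zeta> x) - (P - 2 * \<zeta> x) * - (2 * \<kappa> * (\<zeta> x * r x)) = 2 * B * (\<zeta> x * r x)"
      by (simp add: S_def B_def algebra_simps)
    ultimately show ?thesis by (simp only: power2_eq_square)
  qed
  from DERIV_real_sqrt[THEN DERIV_chain2, OF R_pos[OF x] this]
  have "(r has_real_derivative inverse (r x) / 2 * (2 * B * (\<zeta> x * r x) / (S (\<zeta> x))\<^sup>2)) (at x)"
    unfolding r_def .
  also have "inverse (r x) / 2 * (2 * B * (\<zeta> x * r x) / (S (\<zeta> x))\<^sup>2) = B * \<zeta> x / (S (\<zeta> x))\<^sup>2"
    using r_pos[OF x] by (simp add: field_simps)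
  also have "\<dots> = \<zeta> x * (B / S (\<zeta> x))\<^sup>2 / B"
    using B0 by (simp add: power2_eq_square)
  also have "B / S (\<zeta> x) = 1 + \<kappa> * (r x)\<^sup>2"
    using S_eq[OF x] S_ne[OF x] by (simp add: field_simps)
  finally show ?thesis .
qed

section \<open>The singular end and the implicit solution\<close>

lemma r_at_0: "filterlim r at_top (at_right 0)"
proof -
  have \<zeta>0: "(\<zeta> \<longlongrightarrow> \<zeta> 0) (at_right 0)"
    using cont by (auto simp: continuous_on_def intro: tendsto_within_subset)
  have pos: "\<forall>\<^sub>F x in at_right 0. x > (0::real)"
    by (auto simp: eventually_at_filter)
  have "filterlim (\<lambda>x. (A * P - 2 * (A * \<zeta> x)) / (A * S (\<zeta> x))) at_top (at_right 0)"
  proof (rule LIM_at_top_divide)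
    have "((\<lambda>x. A * S (\<zeta> x)) \<longlongrightarrow> A * (A + 2 * \<kappa> * \<zeta> 0)) (at_right 0)"
      unfolding S_def by (intro tendsto_intros \<zeta>0)
    moreover have "A * (A + 2 * \<kappa> * \<zeta> 0) = 0" using \<kappa> by (simp add: \<zeta>_init)
    ultimately show "((\<lambda>x. A * S (\<zeta> x)) \<longlongrightarrow> 0) (at_right 0)" by simp
    show "\<forall>\<^sub>F x in at_right 0. 0 < A * S (\<zeta> x)"
      using pos AS_pos by (auto elim!: eventually_mono)
    show "((\<lambda>x. A * P - 2 * (A * \<zeta> x)) \<longlongrightarrow> A * P - 2 * (A * \<zeta> 0)) (at_right 0)"
      by (intro tendsto_intros \<zeta>0)
    show "A * P - 2 * (A * \<zeta> 0) > 0" using AP A\<zeta>_neg[of 0] by linarith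
  qed
  then have "filterlim (\<lambda>x. R (\<zeta> x)) at_top (at_right 0)"
    by (rule filterlim_mono_eventually[OF _ order_refl order_refl])
      (use pos in \<open>auto elim!: eventually_mono simp: R_eq\<close>)
  then show ?thesis
    unfolding r_def by (rule filterlim_compose[OF sqrt_at_top])
qed

text \<open>At the singular end \<open>\<zeta>\<close> has a nonzero limit of the sign of
  \<open>- A\<close>, so \<open>d = - \<zeta> * r\<close> inherits the divergence of
  \<open>r\<close> with the sign of \<open>A\<close>.\<close>

lemma d_at_0:
  shows "A > 0 \<Longrightarrow> filterlim d at_top (at_right 0)" "A < 0 \<Longrightarrow> filterlim d at_bot (at_right 0)"
proof -
  have \<zeta>0: "((\<lambda>x. - \<zeta> x) \<longlongrightarrow> A / (2 * \<kappa>)) (at_right 0)"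
    using cont \<zeta>_init by (auto simp: continuous_on_def intro!: tendsto_eq_intros intro: tendsto_within_subset)
  have eq: "\<forall>\<^sub>F x in at_right 0. - \<zeta> x * r x = d x"
    by (auto simp: eventually_at_filter d_eq)
  show "filterlim d at_top (at_right 0)" if "A > 0"
    by (rule filterlim_mono_eventually[OF filterlim_tendsto_pos_mult_at_top[OF \<zeta>0 _ r_at_0] order_refl order_refl eq])
      (use that \<kappa> in simp)
  show "filterlim d at_bot (at_right 0)" if "A < 0"
    by (rule filterlim_mono_eventually[OF filterlim_tendsto_neg_mult_at_bot[OF \<zeta>0 _ r_at_0] order_refl order_refl eq])
      (use that \<kappa> in \<open>simp add: divide_neg_pos\<close>)
qed

text \<open>\<open>\<Psi> (r x) - x\<close> is constant because \<open>\<psi>\<close> is the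
  reciprocal of the derivative of \<open>r\<close>. Letting \<open>x\<close> tend to 0, where
  \<open>r\<close> tends to infinity, identifies the constant as 0. The point \<open>x = 0\<close>
  itself is covered by the explicit endpoint value of \<open>G\<close>.\<close>

lemma implicit_solution:
  assumes G0: "G (\<zeta> 0) = 0"
    and G: "\<And>x. x > 0 \<Longrightarrow> G (\<zeta> x) = \<Psi> (r x)"
    and \<Psi>: "\<And>x. x > 0 \<Longrightarrow> (\<Psi> has_real_derivative \<psi> x) (at (r x))"
      "\<And>x. x > 0 \<Longrightarrow> \<psi> x * (\<zeta> x * (1 + \<kappa> * (r x)\<^sup>2)\<^sup>2 / B) = 1"
    and lim\<Psi>: "(\<Psi> \<longlongrightarrow> 0) at_top"
    and x: "x \<ge> 0"
  shows "G (\<zeta> x) = x"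
proof (cases "x = 0")
  case False
  with x have x: "x > 0" by simp
  have d: "((\<lambda>x. \<Psi> (r x) - x) has_real_derivative 0) (at x)" if "x > 0" for x
    by (rule DERIV_cong[OF DERIV_diff[OF DERIV_chain2[OF \<Psi>(1)[OF that] r_deriv[OF that]] DERIV_ident]])
      (simp only: \<Psi>(2)[OF that] diff_self)
  have const: "\<Psi> (r y) - y = \<Psi> (r x) - x" if "y > 0" for y
  proof (rule has_derivative_zero_unique_connected[of "{0<..}" "\<lambda>x. \<Psi> (r x) - x"])
    show "((\<lambda>x. \<Psi> (r x) - x) has_derivative (\<lambda>h. 0)) (at t)" if "t \<in> {0<..}" for t
      using d[of t] that unfolding has_field_derivative_def by (auto simp: lambda_zero)
  qed (use x that in auto)
  have "((\<lambda>y. \<Psi> (r y) - y) \<longlongrightarrow> 0 - 0) (at_right 0)"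
    by (intro tendsto_diff filterlim_compose[OF lim\<Psi> r_at_0] tendsto_ident_at)
  moreover have "((\<lambda>y. \<Psi> (r y) - y) \<longlongrightarrow> \<Psi> (r x) - x) (at_right 0)"
    by (rule tendsto_eventually) (use const in \<open>auto simp: eventually_at_filter\<close>)
  ultimately have "0 - 0 = \<Psi> (r x) - x"
    by (rule tendsto_unique[rotated]) simp
  then show ?thesis using G[OF x] by simp
qed (use G0 in simp)

lemma arctan_term:
  shows "((\<lambda>t. arctan (sqrt \<kappa> * t)) \<longlongrightarrow> pi / 2) at_top"
    and "((\<lambda>t. 2 * sqrt \<kappa> * arctan (sqrt \<kappa> * t)) has_real_derivative 2 * \<kappa> / (1 + \<kappa> * t\<^sup>2)) (at t)"
proof -
  have "filterlim (\<lambda>t. sqrt \<kappa> * t) at_top at_top"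
    using \<kappa> by (intro filterlim_tendsto_pos_mult_at_top[OF tendsto_const _ filterlim_ident]) auto
  then show "((\<lambda>t. arctan (sqrt \<kappa> * t)) \<longlongrightarrow> pi / 2) at_top"
    by (rule filterlim_compose[OF tendsto_arctan_at_top])
  have "((\<lambda>t. arctan (sqrt \<kappa> * t)) has_real_derivative inverse (1 + (sqrt \<kappa> * t)\<^sup>2) * (sqrt \<kappa> * 1)) (at t)"
    by (rule DERIV_chain2[OF DERIV_arctan]) (auto intro!: derivative_eq_intros)
  from DERIV_cmult[OF this, of "2 * sqrt \<kappa>"]
  show "((\<lambda>t. 2 * sqrt \<kappa> * arctan (sqrt \<kappa> * t)) has_real_derivative 2 * \<kappa> / (1 + \<kappa> * t\<^sup>2)) (at t)"
    by (rule DERIV_cong)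
      (use \<kappa> in \<open>simp add: power_mult_distrib divide_inverse algebra_simps flip: power2_eq_square\<close>)
qed

lemma fh_\<zeta>:
  assumes "P \<noteq> 0" "x \<ge> 0"
  shows "fh c \<kappa> (\<zeta> x) = x"
proof -
  have "A * P > 0" using AP A0 assms(1) by (simp add: less_le)
  then have "A / P > 0" by (simp add: zero_less_divide_iff zero_less_mult_iff)
  \<comment> \<open>In terms of \<open>r\<close>, the argument of \<open>artanh\<close> in
    \<open>fh\<close> is \<open>1 / (m * r x)\<close>.\<close>
  define m where "m = sqrt (A / P)"
  have m: "m > 0" "m\<^sup>2 = A / P" using \<open>A / P > 0\<close> by (auto simp: m_def)
  define \<Psi> where "\<Psi> = (\<lambda>t. 2 * sqrt \<kappa> * arctan (sqrt \<kappa> * t) + 2 * m * artanh (inverse (m * t)) - pi * sqrt \<kappa>)"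
  have sq1: "m\<^sup>2 * (r x)\<^sup>2 - 1 = - 2 * \<zeta> x * B / (P * S (\<zeta> x))" if x: "x > 0" for x
    using S_ne[OF x] assms(1) unfolding m r_sq[OF x]
    by (simp add: R_def field_simps) (simp add: S_def B_def algebra_simps)
  \<comment> \<open>Puts the argument of \<open>artanh\<close> below 1, where it is differentiable.
    Extending the quotient by \<open>A\<^sup>2\<close> expresses it in factors of known
    sign.\<close>
  have gt1: "m * r x > 1" if x: "x > 0" for x
  proof -
    have "- 2 * \<zeta> x * B / (P * S (\<zeta> x)) = (- 2 * (A * \<zeta> x)) * (A * B) / ((A * P) * (A * S (\<zeta> x)))"
      using A0 by (simp add: field_simps)
    also have "\<dots> > 0"
    proof (rule divide_pos_pos)
      have "- 2 * (A * \<zeta> x) > 0" using A\<zeta>_neg[of x] x by linarith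
      then show "- 2 * (A * \<zeta> x) * (A * B) > 0" by (rule mult_pos_pos[OF _ AB])
      show "(A * P) * (A * S (\<zeta> x)) > 0" by (rule mult_pos_pos[OF \<open>A * P > 0\<close> AS_pos[OF x]])
    qed
    finally have "1\<^sup>2 < (m * r x)\<^sup>2" using sq1[OF x] by (simp add: power_mult_distrib)
    then show ?thesis using m r_pos[OF x] by (intro power2_less_imp_less[of 1 "m * r x"]) auto
  qed
  show ?thesis
  proof (rule implicit_solution[where \<Psi> = \<Psi> and \<psi> = "\<lambda>x. 2 * \<kappa> / (1 + \<kappa> * (r x)\<^sup>2) - 2 * m\<^sup>2 / (m\<^sup>2 * (r x)\<^sup>2 - 1)"])
    show "fh c \<kappa> (\<zeta> 0) = 0" by (simp add: fh_def init)
    show "(\<Psi> \<longlongrightarrow> 0) at_top"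
    proof -
      have "filterlim (\<lambda>t. m * t) at_top at_top"
        using m by (intro filterlim_tendsto_pos_mult_at_top[OF tendsto_const _ filterlim_ident]) auto
      then have "((\<lambda>t. inverse (m * t)) \<longlongrightarrow> 0) at_top"
        by (rule tendsto_inverse_0_at_top)
      then have 2: "((\<lambda>t. artanh (inverse (m * t))) \<longlongrightarrow> artanh 0) at_top"
        by (intro isCont_tendsto_compose[of _ artanh] isCont_artanh) auto
      have "(\<Psi> \<longlongrightarrow> 2 * sqrt \<kappa> * (pi / 2) + 2 * m * artanh 0 - pi * sqrt \<kappa>) at_top"
        unfolding \<Psi>_def by (intro tendsto_intros arctan_term(1) 2)
      then show ?thesis by simp
    qed
    fix x :: real assume x: "x > 0"
    have ne: "\<zeta> x \<noteq> 1 - 1 / (2 * \<kappa>)"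
      using S_ne[OF x] \<kappa> by (auto simp: S_def A_def field_simps)
    have "((2 - c\<^sup>2) * (1 - 2 * \<kappa> + 2 * \<kappa> * \<zeta> x)) / ((1 - 2 * \<kappa>) * (2 - c\<^sup>2 - 2 * \<zeta> x)) = inverse ((A / P) * R (\<zeta> x))"
      by (simp add: R_def S_def A_def P_def field_simps)
    then have "sqrt (((2 - c\<^sup>2) * (1 - 2 * \<kappa> + 2 * \<kappa> * \<zeta> x)) / ((1 - 2 * \<kappa>) * (2 - c\<^sup>2 - 2 * \<zeta> x))) = inverse (m * r x)"
      unfolding m_def r_def by (simp only: real_sqrt_inverse real_sqrt_mult)
    then show "fh c \<kappa> (\<zeta> x) = \<Psi> (r x)"
      using ne unfolding fh_def \<Psi>_def by (simp add: m_def r_def R_def S_def A_def P_def)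
    have pos: "1 + \<kappa> * (r x)\<^sup>2 > 0" using \<kappa> by (simp add: add_pos_nonneg)
    have mr: "m\<^sup>2 * (r x)\<^sup>2 - 1 > 0"
      using gt1[OF x] one_less_power[OF gt1[OF x], of 2] by (simp add: power_mult_distrib)
    have 2: "((\<lambda>t. artanh (inverse (m * t))) has_real_derivative
        1 / (1 - (inverse (m * r x))\<^sup>2) * (- (inverse (m * r x) * (m * 1) * inverse (m * r x)))) (at (r x))"
    proof (rule DERIV_chain2[OF artanh_real_has_field_derivative])
      show "\<bar>inverse (m * r x)\<bar> < 1"
        using gt1[OF x] by (simp add: abs_of_pos inverse_less_1_iff del: inverse_mult_distrib)
      show "((\<lambda>t. inverse (m * t)) has_real_derivative - (inverse (m * r x) * (m * 1) * inverse (m * r x))) (at (r x))"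
        using m r_pos[OF x] by (intro DERIV_inverse' derivative_intros) (auto intro!: derivative_eq_intros)
    qed
    have "(\<Psi> has_real_derivative 2 * \<kappa> / (1 + \<kappa> * (r x)\<^sup>2)
        + 2 * m * (1 / (1 - (inverse (m * r x))\<^sup>2) * (- (inverse (m * r x) * (m * 1) * inverse (m * r x)))) - 0) (at (r x))"
      unfolding \<Psi>_def by (intro DERIV_diff DERIV_add arctan_term(2) DERIV_cmult[OF 2] DERIV_const)
    moreover have "2 * m * (1 / (1 - (inverse (m * r x))\<^sup>2) * (- (inverse (m * r x) * (m * 1) * inverse (m * r x))))
        = - (2 * m\<^sup>2 / (m\<^sup>2 * (r x)\<^sup>2 - 1))"
    proof -
      have "1 - (inverse (m * r x))\<^sup>2 = (m\<^sup>2 * (r x)\<^sup>2 - 1) / (m * r x)\<^sup>2"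
        using m(1) r_pos[OF x] by (simp add: field_simps power_mult_distrib)
      then show ?thesis
        using m(1) r_pos[OF x] mr by (simp add: field_simps power2_eq_square)
    qed
    ultimately show "(\<Psi> has_real_derivative 2 * \<kappa> / (1 + \<kappa> * (r x)\<^sup>2) - 2 * m\<^sup>2 / (m\<^sup>2 * (r x)\<^sup>2 - 1)) (at (r x))"
      by simp
    \<comment> \<open>Over the common denominator the terms in \<open>(r x)\<^sup>2\<close> cancel.
      What remains is \<open>\<kappa> + m\<^sup>2 = B / P\<close>, whose \<open>B\<close> cancels
      against the one in the derivative of \<open>r\<close>.\<close>
    have "2 * \<kappa> / (1 + \<kappa> * (r x)\<^sup>2) - 2 * m\<^sup>2 / (m\<^sup>2 * (r x)\<^sup>2 - 1)
        = - 2 * (\<kappa> + m\<^sup>2) / ((1 + \<kappa> * (r x)\<^sup>2) * (m\<^sup>2 * (r x)\<^sup>2 - 1))"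
      using pos mr by (simp add: divide_simps) (simp add: algebra_simps)
    also have "\<kappa> + m\<^sup>2 = B / P" unfolding m B_def using assms(1) by (simp add: field_simps)
    finally have eq: "2 * \<kappa> / (1 + \<kappa> * (r x)\<^sup>2) - 2 * m\<^sup>2 / (m\<^sup>2 * (r x)\<^sup>2 - 1)
        = - 2 * (B / P) / ((1 + \<kappa> * (r x)\<^sup>2) * (m\<^sup>2 * (r x)\<^sup>2 - 1))" .
    have "(2 * \<kappa> / (1 + \<kappa> * (r x)\<^sup>2) - 2 * m\<^sup>2 / (m\<^sup>2 * (r x)\<^sup>2 - 1)) * (\<zeta> x * (1 + \<kappa> * (r x)\<^sup>2)\<^sup>2 / B)
       = - 2 * \<zeta> x * (1 + \<kappa> * (r x)\<^sup>2) / (P * (m\<^sup>2 * (r x)\<^sup>2 - 1))"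
      unfolding eq using pos mr B0 assms(1) by (simp add: divide_simps power2_eq_square)
    also have "\<dots> = S (\<zeta> x) * (1 + \<kappa> * (r x)\<^sup>2) / B"
      unfolding sq1[OF x] using assms(1) S_ne[OF x] B0 \<zeta>_nonzero[of x] x by (simp add: field_simps)
    also have "\<dots> = 1" using S_eq[OF x] B0 by simp
    finally show "(2 * \<kappa> / (1 + \<kappa> * (r x)\<^sup>2) - 2 * m\<^sup>2 / (m\<^sup>2 * (r x)\<^sup>2 - 1)) * (\<zeta> x * (1 + \<kappa> * (r x)\<^sup>2)\<^sup>2 / B) = 1" .
  qed fact
qed

lemma gg_\<zeta>:
  assumes "P = 0" "x \<ge> 0"
  shows "gg \<kappa> (\<zeta> x) = x"
proof -
  \<comment> \<open>The term \<open>2 * inverse t\<close> is the limit of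
    \<open>2 * m * artanh (inverse (m * t))\<close> as \<open>m\<close> tends to infinity, which
    corresponds to \<open>P\<close> tending to 0.\<close>
  define \<Psi> where "\<Psi> = (\<lambda>t. 2 * sqrt \<kappa> * arctan (sqrt \<kappa> * t) + 2 * inverse t - pi * sqrt \<kappa>)"
  show ?thesis
  proof (rule implicit_solution[where \<Psi> = \<Psi> and \<psi> = "\<lambda>x. 2 * \<kappa> / (1 + \<kappa> * (r x)\<^sup>2) - 2 / (r x)\<^sup>2"])
    show "gg \<kappa> (\<zeta> 0) = 0" by (simp add: gg_def init)
    show "(\<Psi> \<longlongrightarrow> 0) at_top"
    proof -
      have "(\<Psi> \<longlongrightarrow> 2 * sqrt \<kappa> * (pi / 2) + 2 * 0 - pi * sqrt \<kappa>) at_top"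
        unfolding \<Psi>_def by (intro tendsto_intros arctan_term(1) tendsto_inverse_0_at_top filterlim_ident)
      then show ?thesis by simp
    qed
    fix x :: real assume x: "x > 0"
    have ne: "\<zeta> x \<noteq> 1 - 1 / (2 * \<kappa>)"
      using S_ne[OF x] \<kappa> by (auto simp: S_def A_def field_simps)
    have R: "R (\<zeta> x) = - 2 * \<zeta> x / S (\<zeta> x)" by (simp add: R_def assms(1))
    have "(- 2 * \<kappa> * \<zeta> x) / (1 - 2 * \<kappa> + 2 * \<kappa> * \<zeta> x) = \<kappa> * R (\<zeta> x)"
      by (simp add: R S_def A_def)
    then have 1: "sqrt ((- 2 * \<kappa> * \<zeta> x) / (1 - 2 * \<kappa> + 2 * \<kappa> * \<zeta> x)) = sqrt \<kappa> * r x"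
      unfolding r_def by (simp only: real_sqrt_mult)
    have "2 * (- ((1 - 2 * \<kappa> + 2 * \<kappa> * \<zeta> x) / \<zeta> x)) = 4 * inverse (R (\<zeta> x))"
      using \<zeta>_nonzero[of x] x by (simp add: R S_def A_def field_simps)
    then have "sqrt (2 * (- ((1 - 2 * \<kappa> + 2 * \<kappa> * \<zeta> x) / \<zeta> x))) = sqrt 4 * inverse (r x)"
      unfolding r_def by (simp only: real_sqrt_mult real_sqrt_inverse)
    then have 2: "sqrt 2 * sqrt (- ((1 - 2 * \<kappa> + 2 * \<kappa> * \<zeta> x) / \<zeta> x)) = 2 * inverse (r x)"
      by (simp only: real_sqrt_mult real_sqrt_four)
    show "gg \<kappa> (\<zeta> x) = \<Psi> (r x)"
      unfolding gg_def \<Psi>_def 1 2 using ne by simp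
    have pos: "1 + \<kappa> * (r x)\<^sup>2 > 0" using \<kappa> by (simp add: add_pos_nonneg)
    have 2: "(inverse has_real_derivative - (1 / (r x)\<^sup>2)) (at (r x))"
      using r_pos[OF x] by (auto intro!: derivative_eq_intros simp: power2_eq_square field_simps)
    have "(\<Psi> has_real_derivative 2 * \<kappa> / (1 + \<kappa> * (r x)\<^sup>2)
        + 2 * (- (1 / (r x)\<^sup>2)) - 0) (at (r x))"
      unfolding \<Psi>_def by (intro DERIV_diff DERIV_add arctan_term(2) DERIV_cmult[OF 2] DERIV_const)
    then show "(\<Psi> has_real_derivative 2 * \<kappa> / (1 + \<kappa> * (r x)\<^sup>2) - 2 / (r x)\<^sup>2) (at (r x))"
      by simp
    have "2 * \<kappa> / (1 + \<kappa> * (r x)\<^sup>2) - 2 / (r x)\<^sup>2 = - 2 / ((1 + \<kappa> * (r x)\<^sup>2) * (r x)\<^sup>2)"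
      using pos r_pos[OF x] by (simp add: divide_simps)
    note eq = this
    have "(2 * \<kappa> / (1 + \<kappa> * (r x)\<^sup>2) - 2 / (r x)\<^sup>2) * (\<zeta> x * (1 + \<kappa> * (r x)\<^sup>2)\<^sup>2 / B)
       = - 2 * \<zeta> x * (1 + \<kappa> * (r x)\<^sup>2) / ((r x)\<^sup>2 * B)"
      unfolding eq using pos r_pos[OF x] B0 by (simp add: divide_simps power2_eq_square)
    also have "\<dots> = S (\<zeta> x) * (1 + \<kappa> * (r x)\<^sup>2) / B"
      unfolding r_sq[OF x] R using S_ne[OF x] B0 \<zeta>_nonzero[of x] x by (simp add: field_simps)
    also have "\<dots> = 1" using S_eq[OF x] B0 by simp
    finally show "(2 * \<kappa> / (1 + \<kappa> * (r x)\<^sup>2) - 2 / (r x)\<^sup>2) * (\<zeta> x * (1 + \<kappa> * (r x)\<^sup>2)\<^sup>2 / B) = 1" .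
  qed fact
qed

text \<open>By the intermediate value theorem \<open>\<zeta>\<close> takes all values between
  \<open>\<zeta> 0\<close> and its limit 0, the limit excluded. The right hand side describes the
  domain on which the explicit functions are inverted.\<close>

lemma \<zeta>_range_iff: "y \<in> \<zeta> ` {0..} \<longleftrightarrow> A * y < 0 \<and> A * S y \<ge> 0"
proof
  assume "y \<in> \<zeta> ` {0..}"
  then obtain x where x: "x \<ge> 0" "y = \<zeta> x" by auto
  then have "A * S y \<ge> 0"
    using AS_pos[of x] \<zeta>_init \<kappa> by (cases "x = 0") (auto simp: S_def)
  then show "A * y < 0 \<and> A * S y \<ge> 0" using x A\<zeta>_neg by auto
next
  assume y: "A * y < 0 \<and> A * S y \<ge> 0"
  have "((\<lambda>x. A * \<zeta> x) \<longlongrightarrow> A * 0) at_top" by (intro tendsto_intros lim)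
  then have "eventually (\<lambda>x. A * y < A * \<zeta> x) at_top"
    by (rule order_tendstoD) (use y in simp)
  then have "eventually (\<lambda>x. A * y < A * \<zeta> x \<and> x \<ge> 0) at_top"
    by (intro eventually_conj eventually_ge_at_top)
  then obtain z where z: "A * y < A * \<zeta> z" "z \<ge> 0"
    by (auto simp: eventually_at_top_linorder)
  have "2 * \<kappa> * (A * \<zeta> 0) \<le> 2 * \<kappa> * (A * y)"
    using y \<kappa> by (simp add: \<zeta>_init S_def algebra_simps)
  then have le: "A * \<zeta> 0 \<le> A * y" using \<kappa> by simp
  have "connected ((\<lambda>x. A * \<zeta> x) ` {0..})"
    by (intro connected_continuous_image continuous_intros cont) auto
  then have "A * y \<in> (\<lambda>x. A * \<zeta> x) ` {0..}"
    by (rule connectedD_interval[of _ "A * \<zeta> 0" "A * \<zeta> z"]) (use z le in auto)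
  then show "y \<in> \<zeta> ` {0..}" using A0 by auto
qed

text \<open>The identity \<open>G (\<zeta> x) = x\<close> makes \<open>G\<close> injective on the range of \<open>\<zeta>\<close>, which is all of the domain.\<close>

lemma inv_into_eq:
  assumes "\<And>x. x \<ge> 0 \<Longrightarrow> G (\<zeta> x) = x" "D = {y. A * y < 0 \<and> A * S y \<ge> 0}" "x \<ge> 0"
  shows "inv_into D G x = \<zeta> x"
proof (rule inv_into_f_eq)
  have D: "D = \<zeta> ` {0..}" using assms(2) \<zeta>_range_iff by auto
  show "inj_on G D" unfolding D by (rule inj_onI) (use assms(1) in auto)
  show "\<zeta> x \<in> D" using assms(3) D by auto
qed (use assms in auto)

lemma dom_eq:
  shows "A > 0 \<Longrightarrow> T_dom \<kappa> = {y. A * y < 0 \<and> A * S y \<ge> 0}"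
    and "A < 0 \<Longrightarrow> J_dom \<kappa> = {y. A * y < 0 \<and> A * S y \<ge> 0}"
proof -
  have "S y \<ge> 0 \<longleftrightarrow> y \<ge> 1 - 1 / (2 * \<kappa>)" "S y \<le> 0 \<longleftrightarrow> y \<le> 1 - 1 / (2 * \<kappa>)" for y
    using \<kappa> by (auto simp: S_def A_def field_simps)
  then show "A > 0 \<Longrightarrow> T_dom \<kappa> = {y. A * y < 0 \<and> A * S y \<ge> 0}"
    "A < 0 \<Longrightarrow> J_dom \<kappa> = {y. A * y < 0 \<and> A * S y \<ge> 0}"
    by (auto simp: T_dom_def J_dom_def mult_less_0_iff zero_le_mult_iff)
qed

lemma \<zeta>_explicit:
  assumes "x \<ge> 0"
  shows "A > 0 \<Longrightarrow> P \<noteq> 0 \<Longrightarrow> f_inv c \<kappa> x = \<zeta> x" "A < 0 \<Longrightarrow> P \<noteq> 0 \<Longrightarrow> h_inv c \<kappa> x = \<zeta> x"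
    "A > 0 \<Longrightarrow> P = 0 \<Longrightarrow> g_inv \<kappa> x = \<zeta> x" "A < 0 \<Longrightarrow> P = 0 \<Longrightarrow> g_tilde_inv \<kappa> x = \<zeta> x"
  unfolding f_inv_def h_inv_def g_inv_def g_tilde_inv_def
  using assms by (auto intro!: inv_into_eq dom_eq fh_\<zeta> gg_\<zeta>)

section \<open>Decay of the profile\<close>

lemma r_antimono:
  assumes "0 < x" "x \<le> y"
  shows "r y \<le> r x"
proof (rule DERIV_nonpos_imp_nonincreasing[OF \<open>x \<le> y\<close>])
  fix t assume "x \<le> t" "t \<le> y"
  then have t: "t > 0" using \<open>0 < x\<close> by simp
  have "\<zeta> t * (1 + \<kappa> * (r t)\<^sup>2)\<^sup>2 / B = (A * \<zeta> t) * (1 + \<kappa> * (r t)\<^sup>2)\<^sup>2 / (A * B)"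
    using A0 by simp
  also have "\<dots> \<le> 0"
    by (rule divide_nonpos_pos[OF mult_nonpos_nonneg[OF less_imp_le[OF A\<zeta>_neg] zero_le_power2] AB])
      (use t in simp)
  finally show "\<exists>z. (r has_real_derivative z) (at t) \<and> z \<le> 0" using r_deriv[OF t] by blast
qed

text \<open>\<open>m = sqrt (P / A)\<close> is the value of \<open>sqrt (R y)\<close> at
  \<open>y = 0\<close> and a lower bound for \<open>r\<close>. Since \<open>\<zeta>\<close> has
  derivative \<open>- \<zeta> * r\<close>, the product
  \<open>(\<zeta> x)\<^sup>2 * exp (2 * m * x)\<close> cannot increase, so \<open>m\<close> is a
  rate of decay.\<close>

lemma \<zeta>_exp_decay:
  assumes "P \<noteq> 0"
  obtains C1 C2 where "C1 > 0" "C2 > 0" "\<And>x. x \<ge> 1 \<Longrightarrow> \<bar>\<zeta> x\<bar> \<le> C1 * exp (- C2 * x)"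
proof -
  have "A * P > 0" using AP A0 assms(1) by (simp add: less_le)
  then have pa: "P / A > 0" by (auto simp: zero_less_divide_iff zero_less_mult_iff)
  define m where "m = sqrt (P / A)"
  have m: "m > 0" using pa by (simp add: m_def)
  have mr: "m \<le> r x" if x: "x > 0" for x
  proof -
    have "R (\<zeta> x) - P / A = (- 2 * (A * \<zeta> x)) * (A * B) / ((A * S (\<zeta> x)) * A\<^sup>2)"
      using A0 S_ne[OF x] by (simp add: R_def field_simps power2_eq_square) (simp add: S_def B_def algebra_simps)
    also have "\<dots> > 0"
    proof (rule divide_pos_pos)
      have "- 2 * (A * \<zeta> x) > 0" using A\<zeta>_neg[of x] x by linarith
      then show "- 2 * (A * \<zeta> x) * (A * B) > 0" by (rule mult_pos_pos[OF _ AB])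
      show "(A * S (\<zeta> x)) * A\<^sup>2 > 0" using A0 by (intro mult_pos_pos[OF AS_pos[OF x]]) simp
    qed
    finally show ?thesis unfolding m_def r_def by (intro real_sqrt_le_mono) simp
  qed
  have dec: "(\<zeta> x)\<^sup>2 * exp (2 * m * x) \<le> (\<zeta> 1)\<^sup>2 * exp (2 * m * 1)" if "x \<ge> 1" for x
  proof (rule DERIV_nonpos_imp_nonincreasing[OF that, of "\<lambda>x. (\<zeta> x)\<^sup>2 * exp (2 * m * x)"])
    fix t assume "1 \<le> t" "t \<le> x"
    then have t: "t > 0" by simp
    have "((\<lambda>x. (\<zeta> x)\<^sup>2 * exp (2 * m * x)) has_real_derivative
        2 * (\<zeta> t)\<^sup>2 * (m - r t) * exp (2 * m * t)) (at t)"
      by (auto intro!: derivative_eq_intros \<zeta>_deriv t simp: power2_eq_square algebra_simps)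
    moreover have "2 * (\<zeta> t)\<^sup>2 * (m - r t) * exp (2 * m * t) \<le> 0"
      using mr[OF t] by (intro mult_nonpos_nonneg mult_nonneg_nonpos) auto
    ultimately show "\<exists>z. ((\<lambda>x. (\<zeta> x)\<^sup>2 * exp (2 * m * x)) has_real_derivative z) (at t) \<and> z \<le> 0" by blast
  qed
  show ?thesis
  proof (rule that[of "\<bar>\<zeta> 1\<bar> * exp m" m])
    show "\<bar>\<zeta> 1\<bar> * exp m > 0" using \<zeta>_nonzero[of 1] by simp
    fix x :: real assume "x \<ge> 1"
    have "(\<zeta> x * exp (m * x))\<^sup>2 \<le> (\<zeta> 1 * exp m)\<^sup>2"
      using dec[OF \<open>x \<ge> 1\<close>] by (simp add: power_mult_distrib exp_double[symmetric] mult.assoc)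
    then have "\<bar>\<zeta> x * exp (m * x)\<bar> \<le> \<bar>\<zeta> 1 * exp m\<bar>" by (simp only: abs_le_square_iff)
    then show "\<bar>\<zeta> x\<bar> \<le> \<bar>\<zeta> 1\<bar> * exp m * exp (- m * x)"
      by (simp add: abs_mult exp_minus field_simps)
  qed (rule m)
qed

text \<open>For \<open>P = 0\<close> the derivative of \<open>1 / r\<close> is
  \<open>(1 + \<kappa> * r\<^sup>2) / 2\<close>, which is at least \<open>1 / 2\<close>; hence
  \<open>1 / r\<close> grows at least linearly.\<close>

lemma r_algebraic_decay:
  assumes "P = 0"
  obtains C where "C > 0" "\<And>x. x \<ge> 1 \<Longrightarrow> r x \<le> C / x"
proof -
  \<comment> \<open>\<open>1 / 2\<close> is the lower bound for the slope of \<open>1 / r\<close>,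
    and \<open>1 / r 1\<close> makes the comparison with \<open>a * x\<close> hold at the start
    \<open>x = 1\<close>.\<close>
  define a where "a = min (1 / r 1) (1 / 2)"
  have a: "a > 0" using r_pos[of 1] by (simp add: a_def)
  have "a * x \<le> 1 / r x" if "x \<ge> 1" for x
  proof -
    have "1 / r 1 - a * 1 \<le> 1 / r x - a * x"
    proof (rule DERIV_nonneg_imp_nondecreasing[OF that, of "\<lambda>x. 1 / r x - a * x"])
      fix t assume "1 \<le> t" "t \<le> x"
      then have t: "t > 0" by simp
      have D: "((\<lambda>x. 1 / r x - a * x) has_real_derivative - (\<zeta> t * (1 + \<kappa> * (r t)\<^sup>2)\<^sup>2 / B) / (r t)\<^sup>2 - a) (at t)"
        using r_pos[OF t] by (auto intro!: derivative_eq_intros r_deriv t simp: power2_eq_square)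
      have eq: "- (\<zeta> t * (1 + \<kappa> * (r t)\<^sup>2)\<^sup>2 / B) / (r t)\<^sup>2 = (1 + \<kappa> * (r t)\<^sup>2) / 2"
      proof -
        have \<zeta>: "\<zeta> t = - (r t)\<^sup>2 * S (\<zeta> t) / 2"
          using S_ne[OF t] by (simp add: r_sq[OF t] R_def assms)
        have "\<zeta> t * (1 + \<kappa> * (r t)\<^sup>2)\<^sup>2 = - (r t)\<^sup>2 * (1 + \<kappa> * (r t)\<^sup>2) / 2 * (S (\<zeta> t) * (1 + \<kappa> * (r t)\<^sup>2))"
          by (subst \<zeta>) (simp add: power2_eq_square)
        also have "\<dots> = - (r t)\<^sup>2 * (1 + \<kappa> * (r t)\<^sup>2) / 2 * B"
          by (simp only: S_eq[OF t])
        finally have eq: "\<zeta> t * (1 + \<kappa> * (r t)\<^sup>2)\<^sup>2 = - (r t)\<^sup>2 * (1 + \<kappa> * (r t)\<^sup>2) / 2 * B" .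
        show ?thesis
          unfolding eq using r_pos[OF t] B0 by simp
      qed
      have "((\<lambda>x. 1 / r x - a * x) has_real_derivative (1 + \<kappa> * (r t)\<^sup>2) / 2 - a) (at t)"
        using D by (simp only: eq)
      moreover have "(1 + \<kappa> * (r t)\<^sup>2) / 2 - a \<ge> 0"
      proof -
        have "\<kappa> * (r t)\<^sup>2 \<ge> 0" using \<kappa> by simp
        then show ?thesis by (simp add: a_def)
      qed
      ultimately show "\<exists>z. ((\<lambda>x. 1 / r x - a * x) has_real_derivative z) (at t) \<and> 0 \<le> z" by blast
    qed
    moreover have "a \<le> 1 / r 1" by (simp add: a_def)
    ultimately show ?thesis by simp
  qed
  note le = this
  have "r x \<le> (1 / a) / x" if "x \<ge> 1" for x
  proof -
    have r: "r x > 0" using that by (intro r_pos) auto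
    then have "a * x * r x \<le> (1 / r x) * r x"
      by (intro mult_right_mono le that) auto
    then show ?thesis using a r that by (simp add: field_simps)
  qed
  then show ?thesis using that[of "1 / a"] a by simp
qed

end

section \<open>Smoothness, decay and phase of the wave\<close>

lemma smooth_on_Un:
  "smooth_on f S \<Longrightarrow> smooth_on f T \<Longrightarrow> smooth_on f (S \<union> T)"
  using smooth_on_Dn[of f] by (intro smooth_onI) blast

lemma smooth_on_reflect:
  fixes f :: "real \<Rightarrow> 'a::real_normed_vector"
  assumes "smooth_on f S" "open T" "\<And>x. x \<in> T \<Longrightarrow> a - x \<in> S"
  shows "smooth_on (\<lambda>x. f (a - x)) T"
proof (rule smooth_on_class[OF \<open>open T\<close>, where M = "{g. \<exists>j k. g = (\<lambda>x. k *\<^sub>R Dn j f (a - x))}"])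
  have "(\<lambda>x. f (a - x)) = (\<lambda>x. 1 *\<^sub>R Dn 0 f (a - x))" by simp
  then show "(\<lambda>x. f (a - x)) \<in> {g. \<exists>j k. g = (\<lambda>x. k *\<^sub>R Dn j f (a - x))}" by blast
next
  fix g assume "g \<in> {g. \<exists>j k. g = (\<lambda>x. k *\<^sub>R Dn j f (a - x))}"
  then obtain j k where g: "g = (\<lambda>x. k *\<^sub>R Dn j f (a - x))" by blast
  have "(g has_vector_derivative (- k) *\<^sub>R Dn (Suc j) f (a - x)) (at x)" if "x \<in> T" for x
  proof -
    have "((\<lambda>x. a - x) has_vector_derivative - 1) (at x)"
      by (auto intro!: derivative_eq_intros)
    from vector_diff_chain_at[OF this smooth_on_Dn[OF assms(1) assms(3)[OF that], of j]]
    have "((\<lambda>x. Dn j f (a - x)) has_vector_derivative (- 1) *\<^sub>R Dn (Suc j) f (a - x)) (at x)"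
      by (simp add: o_def)
    from bounded_linear.has_vector_derivative[OF bounded_linear_scaleR_right this, of k]
    show ?thesis by (simp add: g)
  qed
  then show "\<exists>g'\<in>{g. \<exists>j k. g = (\<lambda>x. k *\<^sub>R Dn j f (a - x))}. \<forall>x\<in>T. (g has_vector_derivative g' x) (at x)"
    by (intro bexI[of _ "\<lambda>x. (- k) *\<^sub>R Dn (Suc j) f (a - x)"]) blast+
qed

lemma Dn_linear:
  assumes "bounded_linear L" "smooth_on f S" "open S" "x \<in> S"
  shows "Dn j (\<lambda>x. L (f x)) x = L (Dn j f x)"
  using \<open>x \<in> S\<close>
proof (induction j arbitrary: x)
  case (Suc j)
  have "((\<lambda>x. L (Dn j f x)) has_vector_derivative L (Dn (Suc j) f x)) (at x)"
    using bounded_linear.has_vector_derivative[OF assms(1) smooth_on_Dn[OF assms(2) Suc.prems]] .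
  then have "(Dn j (\<lambda>x. L (f x)) has_vector_derivative L (Dn (Suc j) f x)) (at x)"
    by (rule has_vector_derivative_transform_within_open[OF _ assms(3) Suc.prems]) (simp add: Suc.IH)
  then show ?case
    by (simp add: Dn_Suc vector_derivative_at)
qed simp

lemma has_vector_derivative_of_real:
  "(f has_real_derivative f') (at x) \<Longrightarrow>
    ((\<lambda>x. of_real (f x) :: complex) has_vector_derivative of_real f') (at x)"
  unfolding has_real_derivative_iff_has_vector_derivative
  by (rule bounded_linear.has_vector_derivative[OF bounded_linear_of_real])

text \<open>\<open>c'\<close> is \<open>c\<close> on the right half-line and \<open>- c\<close> on
  the left one, where the reflection reverses the derivative of the wave and with it the angular
  component.\<close>

locale profile_wave = profile +
  fixes U V :: "real \<Rightarrow> complex" and c' :: real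
  assumes U_norm: "\<And>x. x > 0 \<Longrightarrow> (norm (U x))\<^sup>2 = 1 - \<zeta> x"
    and U_deriv: "\<And>x. x > 0 \<Longrightarrow> (U has_vector_derivative V x) (at x)"
    and U_radial: "\<And>x. x > 0 \<Longrightarrow> U x \<bullet> V x = - d x / 2"
    and U_angular: "\<And>x. x > 0 \<Longrightarrow> (\<i> * U x) \<bullet> V x = c' * \<zeta> x / 2"
begin

text \<open>Joins the generators because recovering \<open>V\<close> from its components along
  \<open>U\<close> and \<open>\<i> * U\<close> divides by
  \<open>(norm (U x))\<^sup>2 = 1 - \<zeta> x\<close>.\<close>

definition Z where "Z = (\<lambda>x. 1 / (1 - \<zeta> x))"

lemma \<zeta>_bounds: "x > 0 \<Longrightarrow> A > 0 \<Longrightarrow> 1 - 1 / (2 * \<kappa>) < \<zeta> x \<and> \<zeta> x < 0"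
    "x > 0 \<Longrightarrow> A < 0 \<Longrightarrow> 0 < \<zeta> x \<and> \<zeta> x < 1 - 1 / (2 * \<kappa>)"
proof -
  assume x: "x > 0"
  have iff: "S (\<zeta> x) > 0 \<longleftrightarrow> 1 - 1 / (2 * \<kappa>) < \<zeta> x" "S (\<zeta> x) < 0 \<longleftrightarrow> \<zeta> x < 1 - 1 / (2 * \<kappa>)"
    using \<kappa> by (auto simp: S_def A_def field_simps)
  show "1 - 1 / (2 * \<kappa>) < \<zeta> x \<and> \<zeta> x < 0" if "A > 0"
    using AS_pos[OF x] A\<zeta>_neg[of x] x that iff by (auto simp: zero_less_mult_iff mult_less_0_iff)
  show "0 < \<zeta> x \<and> \<zeta> x < 1 - 1 / (2 * \<kappa>)" if "A < 0"
    using AS_pos[OF x] A\<zeta>_neg[of x] x that iff by (auto simp: zero_less_mult_iff mult_less_0_iff)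
qed

text \<open>A positive bound uniform in \<open>x\<close>, so that \<open>Z\<close> is bounded; the
  entries 1 and \<open>1 / (2 * \<kappa>)\<close> belong to \<open>A > 0\<close> and
  \<open>A < 0\<close>.\<close>

lemma one_minus_\<zeta>: "x > 0 \<Longrightarrow> 1 - \<zeta> x \<ge> min 1 (1 / (2 * \<kappa>))"
  using \<zeta>_bounds[of x] A0 by (cases "A > 0") auto

lemma \<zeta>_less_1: "x > 0 \<Longrightarrow> \<zeta> x < 1"
proof -
  assume "x > 0"
  moreover have "min 1 (1 / (2 * \<kappa>)) > 0" using \<kappa> by simp
  ultimately show ?thesis using one_minus_\<zeta>[of x] by linarith
qed

text \<open>\<open>U\<close> and \<open>\<i> * U\<close> form an orthogonal frame, and both
  components of \<open>V\<close> contain the factor \<open>\<zeta>\<close>. Thus \<open>U\<close>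
  solves a linear equation whose coefficient is \<open>\<zeta>\<close> times a polynomial in the
  generators.\<close>

lemma V_eq:
  assumes x: "x > 0"
  shows "V x = of_real (\<zeta> x) * (of_real (r x) * of_real (Z x) / 2 + \<i> * of_real c' * of_real (Z x) / 2) * U x"
proof -
  have n: "of_real ((norm (U x))\<^sup>2) = U x * cnj (U x)"
    by (rule complex_norm_square)
  have "V x * of_real ((norm (U x))\<^sup>2) = (of_real (U x \<bullet> V x) + \<i> * of_real ((\<i> * U x) \<bullet> V x)) * U x"
    unfolding n by (simp add: complex_eq_iff inner_complex_def algebra_simps)
  also have "\<dots> = of_real (\<zeta> x) * (of_real (r x) / 2 + \<i> * of_real c' / 2) * U x"
    unfolding U_radial[OF x] U_angular[OF x] d_eq[OF x] by (simp add: algebra_simps)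
  finally have eq: "V x * of_real (1 - \<zeta> x) = of_real (\<zeta> x) * (of_real (r x) / 2 + \<i> * of_real c' / 2) * U x"
    by (simp only: U_norm[OF x])
  have "of_real (1 - \<zeta> x) * of_real (Z x) = (1 :: complex)"
    unfolding of_real_mult[symmetric] using \<zeta>_less_1[OF x] by (simp add: Z_def)
  then have "V x = V x * of_real (1 - \<zeta> x) * of_real (Z x)"
    by (simp add: mult.assoc del: of_real_diff)
  also have "\<dots> = of_real (\<zeta> x) * (of_real (r x) * of_real (Z x) / 2 + \<i> * of_real c' * of_real (Z x) / 2) * U x"
    unfolding eq by (simp add: algebra_simps)
  finally show ?thesis .
qed

definition G :: "(real \<Rightarrow> complex) set" where
  "G = {\<lambda>x. of_real (r x), \<lambda>x. of_real (\<zeta> x), \<lambda>x. of_real (Z x), U}"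

lemma gens: "(\<lambda>x. of_real (r x)) \<in> fun_alg G" "(\<lambda>x. of_real (\<zeta> x)) \<in> fun_alg G"
    "(\<lambda>x. of_real (Z x)) \<in> fun_alg G" "U \<in> fun_alg G"
  by (auto intro: fun_alg.gen simp: G_def)

lemma scale_alg: "f \<in> fun_alg G \<Longrightarrow> (\<lambda>x. f x * a) \<in> fun_alg G"
  by (intro fun_alg.mult fun_alg.const)

lemmas alg_intros = gens fun_alg.add fun_alg.mult fun_alg.const fun_alg_power scale_alg

definition r' where "r' = (\<lambda>x. (1 + of_real \<kappa> * of_real (r x) ^ 2) ^ 2 * of_real (1 / B) :: complex)"

lemma r'_alg: "r' \<in> fun_alg G"
  unfolding r'_def by (intro alg_intros)

lemma r_deriv': "x > 0 \<Longrightarrow> ((\<lambda>x. of_real (r x) :: complex) has_vector_derivative of_real (\<zeta> x) * r' x) (at x)"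
  using has_vector_derivative_of_real[OF r_deriv[of x]] by (simp add: r'_def)

lemma \<zeta>_deriv': "x > 0 \<Longrightarrow> ((\<lambda>x. of_real (\<zeta> x) :: complex) has_vector_derivative of_real (\<zeta> x) * (- 1 * of_real (r x))) (at x)"
  using has_vector_derivative_of_real[OF \<zeta>_deriv[of x]] by simp

lemma Z_deriv': "x > 0 \<Longrightarrow> ((\<lambda>x. of_real (Z x) :: complex) has_vector_derivative of_real (\<zeta> x) * (- 1 * of_real (Z x) ^ 2 * of_real (r x))) (at x)"
proof -
  assume x: "x > 0"
  have "(Z has_real_derivative - (\<zeta> x * (Z x ^ 2 * r x))) (at x)"
    unfolding Z_def using \<zeta>_less_1[OF x]
    by (auto intro!: derivative_eq_intros \<zeta>_deriv x simp: power2_eq_square)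
  from has_vector_derivative_of_real[OF this] show ?thesis by (simp add: mult.assoc)
qed

lemma alg_deriv:
  assumes "f \<in> fun_alg G"
  shows "\<exists>h\<in>fun_alg G. \<forall>x\<in>{0<..}. (f has_vector_derivative of_real (\<zeta> x) * h x) (at x)"
proof (rule fun_alg_deriv_factor[OF _ assms])
  fix g assume "g \<in> G"
  then consider "g = (\<lambda>x. of_real (r x))" | "g = (\<lambda>x. of_real (\<zeta> x))" | "g = (\<lambda>x. of_real (Z x))" | "g = U"
    by (auto simp: G_def)
  then show "\<exists>h\<in>fun_alg G. \<forall>x\<in>{0<..}. (g has_vector_derivative of_real (\<zeta> x) * h x) (at x)"
  proof cases
    case 1
    then show ?thesis using r_deriv' r'_alg by (intro bexI[of _ r']) auto
  next
    case 2
    have "(\<lambda>x. - 1 * of_real (r x)) \<in> fun_alg G" by (intro alg_intros)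
    then show ?thesis using \<zeta>_deriv' 2 by (intro bexI) auto
  next
    case 3
    have "(\<lambda>x. - 1 * of_real (Z x) ^ 2 * of_real (r x)) \<in> fun_alg G" by (intro alg_intros)
    then show ?thesis using Z_deriv' 3 by (intro bexI) auto
  next
    case 4
    define h where "h = (\<lambda>x. (of_real (r x) * of_real (Z x) * (1 / 2) + \<i> * of_real c' * of_real (Z x) * (1 / 2)) * U x)"
    have "h \<in> fun_alg G" unfolding h_def by (intro alg_intros)
    moreover have "(U has_vector_derivative of_real (\<zeta> x) * h x) (at x)" if "x > 0" for x
      using U_deriv[OF that] V_eq[OF that] by (simp add: h_def mult.assoc)
    ultimately show ?thesis using 4 by blast
  qed
qed

lemma smooth_alg: "f \<in> fun_alg G \<Longrightarrow> smooth_on f {0<..}"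
proof (rule smooth_on_class)
  fix g assume "g \<in> fun_alg G"
  from alg_deriv[OF this] obtain h where h: "h \<in> fun_alg G"
    "\<forall>x\<in>{0<..}. (g has_vector_derivative of_real (\<zeta> x) * h x) (at x)" by blast
  have "(\<lambda>x. of_real (\<zeta> x) * h x) \<in> fun_alg G" using h(1) by (intro alg_intros)
  then show "\<exists>g'\<in>fun_alg G. \<forall>x\<in>{0<..}. (g has_vector_derivative g' x) (at x)"
    using h(2) by (intro bexI[of _ "\<lambda>x. of_real (\<zeta> x) * h x"]) auto
qed auto

lemma smooth_U: "smooth_on U {0<..}"
  by (rule smooth_alg[OF gens(4)])

text \<open>The interval starts at 1 because \<open>r\<close> diverges at 0; from 1 on, monotonicity
  bounds \<open>r\<close> by \<open>r 1\<close>, and the other generators are bounded through the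
  bounds on \<open>\<zeta>\<close>.\<close>

lemma alg_bounded:
  assumes "f \<in> fun_alg G"
  shows "\<exists>K>0. \<forall>x\<in>{1..}. norm (f x) \<le> K"
proof -
  have \<zeta>: "\<bar>\<zeta> x\<bar> \<le> \<bar>1 - 1 / (2 * \<kappa>)\<bar>" if "x \<ge> 1" for x
    using \<zeta>_bounds[of x] A0 that by (cases "A > 0") auto
  have "\<exists>K. \<forall>x\<in>{1..}. norm (f x) \<le> K"
  proof (rule fun_alg_bounded[OF _ assms])
    fix g assume "g \<in> G"
    then consider "g = (\<lambda>x. of_real (r x))" | "g = (\<lambda>x. of_real (\<zeta> x))" | "g = (\<lambda>x. of_real (Z x))" | "g = U"
      by (auto simp: G_def)
    then show "\<exists>K. \<forall>x\<in>{1..}. norm (g x) \<le> K"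
    proof cases
      case 1
      have "\<bar>r x\<bar> \<le> r 1" if "x \<ge> 1" for x
        using r_antimono[of 1 x] r_pos[of x] that by auto
      then show ?thesis using 1 by auto
    next
      case 2
      then show ?thesis using \<zeta> by auto
    next
      case 3
      have "\<bar>Z x\<bar> \<le> 1 / min 1 (1 / (2 * \<kappa>))" if "x \<ge> 1" for x
        using one_minus_\<zeta>[of x] that \<kappa> \<zeta>_less_1[of x] unfolding Z_def
        by (auto simp: abs_of_pos intro!: divide_left_mono mult_pos_pos)
      then show ?thesis using 3 by auto
    next
      case 4
      have "norm (U x) \<le> 2 + \<bar>1 - 1 / (2 * \<kappa>)\<bar>" if "x \<ge> 1" for x
      proof -
        have "(norm (U x))\<^sup>2 \<le> 1 + \<bar>1 - 1 / (2 * \<kappa>)\<bar>"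
          using U_norm[of x] \<zeta>[OF that] that by auto
        moreover have "1 + t \<le> (2 + t)\<^sup>2" if "t \<ge> 0" for t :: real
          using that mult_nonneg_nonneg[OF that that] by (simp add: power2_eq_square algebra_simps)
        from this[of "\<bar>1 - 1 / (2 * \<kappa>)\<bar>"] have "1 + \<bar>1 - 1 / (2 * \<kappa>)\<bar> \<le> (2 + \<bar>1 - 1 / (2 * \<kappa>)\<bar>)\<^sup>2" by simp
        ultimately have "(norm (U x))\<^sup>2 \<le> (2 + \<bar>1 - 1 / (2 * \<kappa>)\<bar>)\<^sup>2" by linarith
        then show ?thesis by (rule power2_le_imp_le) simp
      qed
      then show ?thesis using 4 by auto
    qed
  qed
  then obtain K where "\<forall>x\<in>{1..}. norm (f x) \<le> K" by blast
  then show ?thesis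
    by (intro exI[of _ "max 1 K"]) (auto simp: le_max_iff_disj)
qed

section \<open>Decay of all derivatives\<close>

lemma Dn_\<zeta>: "x > 0 \<Longrightarrow> \<bar>Dn j \<zeta> x\<bar> \<le> norm (Dn j (\<lambda>x. of_real (\<zeta> x) :: complex) x)"
proof -
  assume "x > 0"
  then have "Dn j (\<lambda>x. Re (of_real (\<zeta> x))) x = Re (Dn j (\<lambda>x. of_real (\<zeta> x)) x)"
    by (intro Dn_linear[OF bounded_linear_Re smooth_alg[OF gens(2)]]) auto
  then show ?thesis using abs_Re_le_cmod by simp
qed

lemma Dn_1_U: "x > 0 \<Longrightarrow> Dn 1 U x = of_real (\<zeta> x) * ((of_real (r x) * of_real (Z x) * (1 / 2) + \<i> * of_real c' * of_real (Z x) * (1 / 2)) * U x)"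
  unfolding Dn_1 using vector_derivative_at[OF U_deriv[of x]] V_eq[of x] by (simp add: mult.assoc)

lemma Dn_1_U_alg: "(\<lambda>x. (of_real (r x) * of_real (Z x) * (1 / 2) + \<i> * of_real c' * of_real (Z x) * (1 / 2)) * U x) \<in> fun_alg G"
  by (intro alg_intros)

lemma decay_of_graded:
  assumes M: "\<And>k g. g \<in> M k \<Longrightarrow> \<exists>g'\<in>M (Suc k). \<forall>x\<in>{0<..}. (g has_vector_derivative g' x) (at x)"
    and M_bound: "\<And>k g. g \<in> M k \<Longrightarrow> \<exists>C>0. \<forall>x\<ge>1. norm (g x) \<le> C * \<omega> k x"
    and init: "h \<in> M k" "\<And>x. x > 0 \<Longrightarrow> Dn 1 U x = h x" "(\<lambda>x. of_real (\<zeta> x)) \<in> M k"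
  shows "\<exists>C>0. \<forall>x\<ge>1. norm (Dn j (Dn 1 U) x) + \<bar>Dn j \<zeta> x\<bar> \<le> C * \<omega> (k + j) x"
proof -
  obtain h1 where h1: "h1 \<in> M (k + j)" "\<And>x. x > 0 \<Longrightarrow> Dn j (Dn 1 U) x = h1 x"
    using Dn_graded_class[of "{0<..}" M h k "Dn 1 U" j] M init by auto
  obtain h2 where h2: "h2 \<in> M (k + j)" "\<And>x. x > 0 \<Longrightarrow> Dn j (\<lambda>x. of_real (\<zeta> x)) x = h2 x"
    using Dn_graded_class[of "{0<..}" M "\<lambda>x. of_real (\<zeta> x)" k "\<lambda>x. of_real (\<zeta> x)" j] M init by auto
  obtain C1 where C1: "C1 > 0" "\<And>x. x \<ge> 1 \<Longrightarrow> norm (h1 x) \<le> C1 * \<omega> (k + j) x"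
    using M_bound[OF h1(1)] by blast
  obtain C2 where C2: "C2 > 0" "\<And>x. x \<ge> 1 \<Longrightarrow> norm (h2 x) \<le> C2 * \<omega> (k + j) x"
    using M_bound[OF h2(1)] by blast
  have "norm (Dn j (Dn 1 U) x) + \<bar>Dn j \<zeta> x\<bar> \<le> (C1 + C2) * \<omega> (k + j) x" if "x \<ge> 1" for x
    using C1(2)[OF that] C2(2)[OF that] Dn_\<zeta>[of x j] h1(2)[of x] h2(2)[of x] that
    by (simp add: distrib_right)
  then show ?thesis using C1(1) C2(1) by (intro exI[of _ "C1 + C2"]) auto
qed

text \<open>The products of \<open>\<zeta>\<close> with elements of the algebra are closed under
  differentiation. The grading is therefore constant, and one rate \<open>C2\<close> serves all
  derivatives.\<close>

lemma exp_decay: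
  assumes "P \<noteq> 0"
  shows "\<exists>C1>0. \<exists>C2>0. \<forall>x\<ge>1. norm (Dn j (Dn 1 U) x) + \<bar>Dn j \<zeta> x\<bar> \<le> C1 * exp (- C2 * x)"
proof -
  define M :: "nat \<Rightarrow> (real \<Rightarrow> complex) set" where "M = (\<lambda>k. {f. \<exists>h\<in>fun_alg G. f = (\<lambda>x. of_real (\<zeta> x) * h x)})"
  obtain C1 C2 where C: "C1 > 0" "C2 > 0" "\<And>x. x \<ge> 1 \<Longrightarrow> \<bar>\<zeta> x\<bar> \<le> C1 * exp (- C2 * x)"
    using \<zeta>_exp_decay[OF assms] by metis
  have "\<exists>K>0. \<forall>x\<ge>1. norm (Dn j (Dn 1 U) x) + \<bar>Dn j \<zeta> x\<bar> \<le> K * exp (- C2 * x)"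
  proof (rule decay_of_graded[where M = M and k = 0 and \<omega> = "\<lambda>_ x. exp (- C2 * x)", OF _ _ _ Dn_1_U])
    fix k g assume "g \<in> M k"
    then obtain h where h: "h \<in> fun_alg G" "g = (\<lambda>x. of_real (\<zeta> x) * h x)" by (auto simp: M_def)
    obtain h' where h': "h' \<in> fun_alg G" "\<forall>x\<in>{0<..}. (h has_vector_derivative of_real (\<zeta> x) * h' x) (at x)"
      using alg_deriv[OF h(1)] by blast
    define q where "q = (\<lambda>x. of_real (\<zeta> x) * h' x + (- 1 * of_real (r x)) * h x)"
    have "q \<in> fun_alg G" unfolding q_def using h h' by (intro alg_intros)
    moreover have "(g has_vector_derivative of_real (\<zeta> x) * q x) (at x)" if "x > 0" for x
      unfolding h(2) q_def
      by (rule has_vector_derivative_eq_rhs[OF has_vector_derivative_mult[OF \<zeta>_deriv'[OF that]]])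
        (use h' that in \<open>auto simp: algebra_simps\<close>)
    ultimately show "\<exists>g'\<in>M (Suc k). \<forall>x\<in>{0<..}. (g has_vector_derivative g' x) (at x)"
      by (intro bexI[of _ "\<lambda>x. of_real (\<zeta> x) * q x"]) (auto simp: M_def)
    obtain K where K: "K > 0" "\<And>x. x \<ge> 1 \<Longrightarrow> norm (h x) \<le> K"
      using alg_bounded[OF h(1)] by auto
    have "norm (g x) \<le> (C1 * K) * exp (- C2 * x)" if "x \<ge> 1" for x
    proof -
      have "norm (g x) = \<bar>\<zeta> x\<bar> * norm (h x)" by (simp add: h(2) norm_mult)
      also have "\<dots> \<le> (C1 * exp (- C2 * x)) * K"
        using C K that by (intro mult_mono) auto
      finally show ?thesis by (simp add: mult_ac)
    qed
    then show "\<exists>C>0. \<forall>x\<ge>1. norm (g x) \<le> C * exp (- C2 * x)"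
      using C(1) K(1) by (intro exI[of _ "C1 * K"]) auto
  next
    show "(\<lambda>x. of_real (\<zeta> x) * ((of_real (r x) * of_real (Z x) * (1 / 2) + \<i> * of_real c' * of_real (Z x) * (1 / 2)) * U x)) \<in> M 0"
      using Dn_1_U_alg by (auto simp: M_def)
    show "(\<lambda>x. of_real (\<zeta> x)) \<in> M 0"
      unfolding M_def using fun_alg.const[of 1 G] by (auto intro!: bexI[of _ "\<lambda>x. 1"])
  qed
  then show ?thesis using C(2) by blast
qed

text \<open>For \<open>P = 0\<close> the profile is divisible by \<open>r\<^sup>2\<close>, and so is
  the derivative of \<open>r\<close>; differentiating a power of \<open>r\<close> thus raises its
  exponent by one. Grade \<open>k\<close> means divisibility by \<open>r ^ k\<close>, and both
  \<open>\<zeta>\<close> and the derivative of \<open>U\<close> have grade 2.\<close>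

lemma algebraic_decay:
  assumes "P = 0"
  shows "\<exists>C>0. \<forall>x\<ge>1. norm (Dn j (Dn 1 U) x) + \<bar>Dn j \<zeta> x\<bar> \<le> C * x powr - (2 + real j)"
proof -
  \<comment> \<open>This is \<open>- S / 2\<close> along the profile, the cofactor of
    \<open>r\<^sup>2\<close> in \<open>\<zeta>\<close> when \<open>P = 0\<close>.\<close>
  define T where "T = (\<lambda>x. (of_real A + of_real (2 * \<kappa>) * of_real (\<zeta> x)) * (- 1 / 2) :: complex)"
  have T: "T \<in> fun_alg G" unfolding T_def by (intro alg_intros)
  have \<zeta>T: "of_real (\<zeta> x) = of_real (r x) ^ 2 * T x" if "x > 0" for x
  proof -
    have "\<zeta> x = (r x)\<^sup>2 * (S (\<zeta> x) * (- 1 / 2))"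
      using S_ne[OF that] assms by (simp add: r_sq[OF that] R_def)
    then have "\<zeta> x = (r x)\<^sup>2 * ((A + 2 * \<kappa> * \<zeta> x) * (- 1 / 2))"
      unfolding S_def .
    then have "complex_of_real (\<zeta> x) = of_real ((r x)\<^sup>2 * ((A + 2 * \<kappa> * \<zeta> x) * (- 1 / 2)))"
      by (rule arg_cong)
    then show ?thesis by (simp add: T_def)
  qed
  \<comment> \<open>Factorisations are demanded for positive arguments only, since
    \<open>\<zeta> = r\<^sup>2 * T\<close> is available only there.\<close>
  define M :: "nat \<Rightarrow> (real \<Rightarrow> complex) set" where
    "M = (\<lambda>k. {f. \<exists>h\<in>fun_alg G. \<forall>x>0. f x = of_real (r x) ^ k * h x})"
  obtain C where C: "C > 0" "\<And>x. x \<ge> 1 \<Longrightarrow> r x \<le> C / x"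
    using r_algebraic_decay[OF assms] by metis
  have "\<exists>K>0. \<forall>x\<ge>1. norm (Dn j (Dn 1 U) x) + \<bar>Dn j \<zeta> x\<bar> \<le> K * (1 / x) ^ (2 + j)"
  proof (rule decay_of_graded[where M = M and k = 2 and \<omega> = "\<lambda>k x. (1 / x) ^ k", OF _ _ _ Dn_1_U])
    fix k g assume "g \<in> M k"
    then obtain h where h: "h \<in> fun_alg G" "\<And>x. x > 0 \<Longrightarrow> g x = of_real (r x) ^ k * h x" by (auto simp: M_def)
    obtain h' where h': "h' \<in> fun_alg G" "\<forall>x\<in>{0<..}. (h has_vector_derivative of_real (\<zeta> x) * h' x) (at x)"
      using alg_deriv[OF h(1)] by blast
    define q where "q = (\<lambda>x. of_real (r x) * T x * h' x + of_nat k * T x * r' x * h x)"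
    have "q \<in> fun_alg G" unfolding q_def using h h' T r'_alg by (intro alg_intros)
    moreover have "(g has_vector_derivative of_real (r x) ^ Suc k * q x) (at x)" if x: "x > 0" for x
    proof -
      have pow: "((\<lambda>x. of_real (r x) ^ k :: complex) has_vector_derivative of_real (r x) ^ Suc k * (of_nat k * T x * r' x)) (at x)"
      proof (induction k)
        case (Suc k)
        have "((\<lambda>x. of_real (r x) * of_real (r x) ^ k :: complex) has_vector_derivative
            of_real (r x) * (of_real (r x) ^ Suc k * (of_nat k * T x * r' x)) + (of_real (\<zeta> x) * r' x) * of_real (r x) ^ k) (at x)"
          by (rule has_vector_derivative_mult[OF r_deriv'[OF x] Suc])
        then show ?case
          by (simp add: \<zeta>T[OF x] algebra_simps power2_eq_square)
      qed simp
      have "((\<lambda>x. of_real (r x) ^ k * h x) has_vector_derivative of_real (r x) ^ Suc k * q x) (at x)"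
        by (rule has_vector_derivative_eq_rhs[OF has_vector_derivative_mult[OF pow]])
          (use h' x in \<open>auto simp: q_def \<zeta>T algebra_simps power2_eq_square\<close>)
      then show ?thesis
        by (rule has_vector_derivative_transform_within_open[of _ _ _ "{0<..}"]) (use x h in auto)
    qed
    ultimately show "\<exists>g'\<in>M (Suc k). \<forall>x\<in>{0<..}. (g has_vector_derivative g' x) (at x)"
      by (intro bexI[of _ "\<lambda>x. of_real (r x) ^ Suc k * q x"]) (auto simp: M_def)
    obtain K where K: "K > 0" "\<And>x. x \<ge> 1 \<Longrightarrow> norm (h x) \<le> K"
      using alg_bounded[OF h(1)] by auto
    have "norm (g x) \<le> (C ^ k * K) * (1 / x) ^ k" if "x \<ge> 1" for x
    proof -
      have "norm (g x) = r x ^ k * norm (h x)"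
        using that r_pos[of x] by (simp add: h(2) norm_mult norm_power)
      also have "\<dots> \<le> (C / x) ^ k * K"
        using C K that r_pos[of x] by (intro mult_mono power_mono) auto
      finally show ?thesis by (simp add: power_divide field_simps)
    qed
    then show "\<exists>C>0. \<forall>x\<ge>1. norm (g x) \<le> C * (1 / x) ^ k"
      using C(1) K(1) by (intro exI[of _ "C ^ k * K"]) auto
  next
    define h where "h = (\<lambda>x. (of_real (r x) * of_real (Z x) * (1 / 2) + \<i> * of_real c' * of_real (Z x) * (1 / 2)) * U x)"
    have "(\<lambda>x. T x * h x) \<in> fun_alg G" using T Dn_1_U_alg unfolding h_def by (intro alg_intros)
    then have "(\<lambda>x. of_real (\<zeta> x) * h x) \<in> M 2"
      unfolding M_def by (auto simp: \<zeta>T mult.assoc intro!: bexI[of _ "\<lambda>x. T x * h x"])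
    then show "(\<lambda>x. of_real (\<zeta> x) * ((of_real (r x) * of_real (Z x) * (1 / 2) + \<i> * of_real c' * of_real (Z x) * (1 / 2)) * U x)) \<in> M 2"
      unfolding h_def .
    show "(\<lambda>x. of_real (\<zeta> x)) \<in> M 2"
      unfolding M_def using T \<zeta>T by auto
  qed
  moreover have "(1 / x) ^ (2 + j) = x powr - (2 + real j)" if "x \<ge> 1" for x :: real
  proof -
    have "x powr (2 + real j) = x ^ (2 + j)"
      using that powr_realpow[of x "2 + j"] by simp
    then show ?thesis
      by (simp only: powr_minus power_one_over inverse_eq_divide)
  qed
  ultimately show ?thesis by (metis (no_types, lifting))
qed

text \<open>Instead of lifting \<open>U\<close> to a continuous argument, the phase is integrated
  from its prescribed derivative and corrected by a constant at the end.\<close>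

lemma phase_exists:
  "\<exists>\<theta>. \<forall>x>0. U x = of_real (sqrt (1 - \<zeta> x)) * exp (\<i> * of_real (\<theta> x)) \<and>
     (\<theta> has_real_derivative c' * \<zeta> x / (2 - 2 * \<zeta> x)) (at x)"
proof -
  have "continuous_on {0<..} (\<lambda>x. c' * \<zeta> x / (2 - 2 * \<zeta> x))"
    by (intro continuous_intros cont_pos) (auto dest: \<zeta>_less_1)
  then have "isCont (\<lambda>x. c' * \<zeta> x / (2 - 2 * \<zeta> x)) x" if "x > 0" for x
    by (rule continuous_on_interior) (use that in \<open>simp add: interior_open\<close>)
  then have "\<exists>F. \<forall>x. ereal 0 < ereal x \<longrightarrow> ereal x < \<infinity> \<longrightarrow> (F has_vector_derivative c' * \<zeta> x / (2 - 2 * \<zeta> x)) (at x)"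
    by (intro einterval_antiderivative) auto
  then obtain \<theta>0 where \<theta>0: "\<And>x. x > 0 \<Longrightarrow> (\<theta>0 has_real_derivative c' * \<zeta> x / (2 - 2 * \<zeta> x)) (at x)"
    by (auto simp: has_real_derivative_iff_has_vector_derivative)
  \<comment> \<open>\<open>T\<close> solves the same linear equation as \<open>U\<close>, so \<open>U / T\<close> is constant.\<close>
  define T where "T = (\<lambda>x. of_real (sqrt (1 - \<zeta> x)) * exp (\<i> * of_real (\<theta>0 x)) :: complex)"
  define q where "q = (\<lambda>x. of_real (\<zeta> x) * (of_real (r x) * of_real (Z x) / 2 + \<i> * of_real c' * of_real (Z x) / 2) :: complex)"
  have T_deriv: "(T has_vector_derivative q x * T x) (at x)" if x: "x > 0" for x
  proof -
    have pos: "1 - \<zeta> x > 0" using \<zeta>_less_1[OF x] by simp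
    have "((\<lambda>x. sqrt (1 - \<zeta> x)) has_real_derivative (\<zeta> x * r x * Z x / 2) * sqrt (1 - \<zeta> x)) (at x)"
    proof (rule DERIV_cong)
      show "((\<lambda>x. sqrt (1 - \<zeta> x)) has_real_derivative inverse (sqrt (1 - \<zeta> x)) / 2 * (\<zeta> x * r x)) (at x)"
        by (rule DERIV_chain2[where f = sqrt and g = "\<lambda>x. 1 - \<zeta> x", OF DERIV_real_sqrt[OF pos]]) (auto intro!: derivative_eq_intros \<zeta>_deriv x)
      have "Z x * sqrt (1 - \<zeta> x) = inverse (sqrt (1 - \<zeta> x))"
        using pos real_sqrt_mult_self[of "1 - \<zeta> x"] by (simp add: Z_def field_simps)
      then show "inverse (sqrt (1 - \<zeta> x)) / 2 * (\<zeta> x * r x) = \<zeta> x * r x * Z x / 2 * sqrt (1 - \<zeta> x)"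
        by (simp add: algebra_simps)
    qed
    note 1 = has_vector_derivative_of_real[OF this]
    have "((\<lambda>x. \<i> * of_real (\<theta>0 x)) has_vector_derivative \<i> * of_real (c' * \<zeta> x / (2 - 2 * \<zeta> x))) (at x)"
      by (rule has_vector_derivative_mult_right[OF has_vector_derivative_of_real[OF \<theta>0[OF x]]])
    from field_vector_diff_chain_at[OF this DERIV_exp]
    have 2: "((\<lambda>x. exp (\<i> * of_real (\<theta>0 x))) has_vector_derivative
        \<i> * of_real (c' * \<zeta> x / (2 - 2 * \<zeta> x)) * exp (\<i> * of_real (\<theta>0 x))) (at x)"
      by (simp add: o_def)
    have \<theta>': "c' * \<zeta> x / (2 - 2 * \<zeta> x) = c' * \<zeta> x * Z x / 2"
      using pos by (simp add: Z_def field_simps)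
    show ?thesis
      unfolding T_def q_def
      by (rule has_vector_derivative_eq_rhs[OF has_vector_derivative_mult[OF 1 2[unfolded \<theta>']]])
        (simp add: algebra_simps)
  qed
  have T_norm: "norm (T x) = norm (U x)" if "x > 0" for x
    using U_norm[OF that] \<zeta>_less_1[OF that] by (simp add: T_def norm_mult real_sqrt_unique)
  have T_ne: "T x \<noteq> 0" if "x > 0" for x
    using \<zeta>_less_1[OF that] by (simp add: T_def)
  have quot: "((\<lambda>x. U x / T x) has_vector_derivative 0) (at x)" if x: "x > 0" for x
  proof -
    have U': "(U has_vector_derivative q x * U x) (at x)"
      using U_deriv[OF x] V_eq[OF x] by (simp add: q_def)
    have inv: "((\<lambda>x. inverse (T x)) has_vector_derivative - (inverse (T x) * (q x * T x) * inverse (T x))) (at x)"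
      using T_deriv[OF x] T_ne[OF x] unfolding has_vector_derivative_def
      by (auto intro!: derivative_eq_intros)
    show ?thesis
      unfolding divide_inverse
      by (rule has_vector_derivative_eq_rhs[OF has_vector_derivative_mult[OF U' inv]])
        (use T_ne[OF x] in \<open>simp add: field_simps\<close>)
  qed
  have const: "U x / T x = U 1 / T 1" if "x > 0" for x
  proof (rule has_derivative_zero_unique_connected[of "{0<..}" "\<lambda>x. U x / T x"])
    show "((\<lambda>x. U x / T x) has_derivative (\<lambda>h. 0)) (at t)" if "t \<in> {0<..}" for t
      using quot[of t] that by (simp add: has_vector_derivative_def)
  qed (use that in auto)
  \<comment> \<open>The constant \<open>U / T\<close> has modulus 1, and its argument is the missing
    constant in the phase.\<close>
  define \<alpha> where "\<alpha> = Arg (U 1 / T 1)"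
  have "norm (U 1 / T 1) = 1"
    unfolding norm_divide T_norm[OF zero_less_one, symmetric] using T_ne[of 1] by simp
  then have \<alpha>: "exp (\<i> * of_real \<alpha>) = U 1 / T 1"
    using Arg_eq[of "U 1 / T 1"] by (cases "U 1 / T 1 = 0") (auto simp: \<alpha>_def)
  have "U x = of_real (sqrt (1 - \<zeta> x)) * exp (\<i> * of_real (\<theta>0 x + \<alpha>))" if x: "x > 0" for x
  proof -
    have "U x = exp (\<i> * of_real \<alpha>) * T x"
      unfolding \<alpha> const[OF x, symmetric] using T_ne[OF x] by simp
    then show ?thesis by (simp add: T_def distrib_left exp_add)
  qed
  moreover have "((\<lambda>x. \<theta>0 x + \<alpha>) has_real_derivative c' * \<zeta> x / (2 - 2 * \<zeta> x)) (at x)" if "x > 0" for x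
    using \<theta>0[OF that] by (auto intro!: derivative_eq_intros)
  ultimately show ?thesis by (intro exI[of _ "\<lambda>x. \<theta>0 x + \<alpha>"]) auto
qed

end

section \<open>The two outer half-lines as profiles\<close>

context weak_tw
begin

text \<open>\<open>\<sigma>\<close> is the direction in which the half-line is traversed from its
  singular end \<open>t0\<close>. Both directions lead to the same locale, with the speed multiplied
  by \<open>\<sigma>\<close>, so each fact about the profile is proved once for both sides.\<close>

lemma profile_half_line:
  fixes t0 \<sigma> :: real
  assumes \<kappa>: "\<kappa> > 0" "1 - 2 * \<kappa> \<noteq> 0" "(1 - 2 * \<kappa>) * (2 - c\<^sup>2) \<ge> 0"
    and \<sigma>: "\<sigma> = 1 \<or> \<sigma> = - 1" and s0: "s t0 = 0"
    and reg: "\<And>x. x > 0 \<Longrightarrow> t0 + \<sigma> * x \<in> reg"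
  shows "profile_wave c \<kappa> (\<lambda>x. \<eta> (t0 + \<sigma> * x)) (\<lambda>x. \<sigma> * (- 2 * (u (t0 + \<sigma> * x) \<bullet> V (t0 + \<sigma> * x))))
     (\<lambda>x. u (t0 + \<sigma> * x)) (\<lambda>x. \<sigma> *\<^sub>R V (t0 + \<sigma> * x)) (\<sigma> * c)"
proof -
  define T where "T = (\<lambda>x. t0 + \<sigma> * x) ` {0<..}"
  have "x \<in> T" if "\<sigma> = 1 \<and> t0 < x \<or> \<sigma> = - 1 \<and> x < t0" for x
    unfolding T_def by (rule image_eqI[of _ _ "\<sigma> * (x - t0)"]) (use that in auto)
  then have "T = {t0<..} \<or> T = {..<t0}"
    using \<sigma> by (auto simp: T_def)
  then have T_open: "open T" "connected T" "(\<exists>b. {b<..} \<subseteq> T) \<or> (\<exists>a. {..<a} \<subseteq> T)"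
    by auto
  have "T \<subseteq> reg" using reg by (auto simp: T_def)
  note T = this T_open
  have in_T: "t0 + \<sigma> * x \<in> T" if "x > 0" for x using that by (auto simp: T_def)
  note vanish = first_integrals_vanish[OF T]
  have \<sigma>2: "\<sigma> * \<sigma> = 1" "\<sigma>\<^sup>2 = 1" "\<bar>\<sigma>\<bar> = 1" using \<sigma> by auto
  have aff: "((\<lambda>x. t0 + \<sigma> * x) has_real_derivative \<sigma>) (at x)" for x
    by (auto intro!: derivative_eq_intros)
  have S1: "1 - 2 * \<kappa> + 2 * \<kappa> * \<eta> x = s x" for x
    by (simp add: s_def \<eta>_def algebra_simps)
  have cT: "continuous_on {0<..} (\<lambda>x. f (t0 + \<sigma> * x))" if "continuous_on reg f" for f :: "real \<Rightarrow> complex"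
    by (rule continuous_on_compose2[OF that]) (use reg in \<open>auto intro!: continuous_intros\<close>)
  have cuT: "continuous_on {0<..} (\<lambda>x. u (t0 + \<sigma> * x))"
    by (rule continuous_on_compose2[OF cont_u]) (auto intro!: continuous_intros)
  show ?thesis
  proof unfold_locales
    show "continuous_on {0..} (\<lambda>x. \<eta> (t0 + \<sigma> * x))"
      by (rule continuous_on_compose2[OF cont_\<eta>]) (auto intro!: continuous_intros)
    show "\<eta> (t0 + \<sigma> * 0) = 1 - 1 / (2 * \<kappa>)"
      using s0 \<kappa>(1) S1[of t0] by (simp add: field_simps)
    have "filterlim (\<lambda>x. t0 + \<sigma> * x) at_infinity at_top"
    proof (rule filterlim_norm_at_top_imp_at_infinity)
      have "filterlim (\<lambda>x. - \<bar>t0\<bar> + x) at_top at_top"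
        by (rule filterlim_tendsto_add_at_top[OF tendsto_const filterlim_ident])
      then show "filterlim (\<lambda>x. norm (t0 + \<sigma> * x)) at_top at_top"
      proof (rule filterlim_at_top_mono)
        show "\<forall>\<^sub>F x in at_top. - \<bar>t0\<bar> + x \<le> norm (t0 + \<sigma> * x)"
          using \<sigma> by (intro always_eventually) auto
      qed
    qed
    then show "((\<lambda>x. \<eta> (t0 + \<sigma> * x)) \<longlongrightarrow> 0) at_top"
      by (rule filterlim_compose[OF \<eta>_tendsto])
    show "continuous_on {0<..} (\<lambda>x. \<sigma> * (- 2 * (u (t0 + \<sigma> * x) \<bullet> V (t0 + \<sigma> * x))))"
      by (intro continuous_intros cT cuT cont_V)
    fix x :: real assume x: "x > 0"
    show "1 - 2 * \<kappa> + 2 * \<kappa> * \<eta> (t0 + \<sigma> * x) \<noteq> 0"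
      unfolding S1 using reg[OF x] by (simp add: reg_def)
    show "((\<lambda>x. \<eta> (t0 + \<sigma> * x)) has_real_derivative \<sigma> * (- 2 * (u (t0 + \<sigma> * x) \<bullet> V (t0 + \<sigma> * x)))) (at x)"
      by (rule DERIV_cong[OF DERIV_chain2[OF \<eta>_deriv[OF reg[OF x]] aff]]) simp
    show "(\<sigma> * (- 2 * (u (t0 + \<sigma> * x) \<bullet> V (t0 + \<sigma> * x))))\<^sup>2 * (1 - 2 * \<kappa> + 2 * \<kappa> * \<eta> (t0 + \<sigma> * x)) =
        (\<eta> (t0 + \<sigma> * x))\<^sup>2 * (2 - c\<^sup>2 - 2 * \<eta> (t0 + \<sigma> * x))"
      using profile_equation[OF vanish[OF in_T[OF x]]] by (simp only: power_mult_distrib \<sigma>2 mult_1_left)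
    show "(norm (u (t0 + \<sigma> * x)))\<^sup>2 = 1 - \<eta> (t0 + \<sigma> * x)"
      by (simp add: \<eta>_def)
    show "((\<lambda>x. u (t0 + \<sigma> * x)) has_vector_derivative \<sigma> *\<^sub>R V (t0 + \<sigma> * x)) (at x)"
      using vector_diff_chain_at[OF aff[of x, unfolded has_real_derivative_iff_has_vector_derivative] u_deriv[OF reg[OF x]]]
      by (simp add: o_def)
    show "u (t0 + \<sigma> * x) \<bullet> (\<sigma> *\<^sub>R V (t0 + \<sigma> * x)) = - (\<sigma> * (- 2 * (u (t0 + \<sigma> * x) \<bullet> V (t0 + \<sigma> * x)))) / 2"
      by simp
    show "(\<i> * u (t0 + \<sigma> * x)) \<bullet> (\<sigma> *\<^sub>R V (t0 + \<sigma> * x)) = \<sigma> * c * \<eta> (t0 + \<sigma> * x) / 2"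
      using vanish(1)[OF in_T[OF x]] by (simp add: momentum_def)
  qed (use \<kappa> in auto)
qed

end

section \<open>Assembly of the statement\<close>

theorem theorem1p3:
  fixes c \<kappa> \<aa> \<bb> :: real and u :: "real \<Rightarrow> complex" and \<eta> :: "real \<Rightarrow> real"
  assumes "(c, \<kappa>) \<in> D_tilde"
    and "singular_solution c \<kappa> u"
    and "\<eta> = (\<lambda>x. 1 - (norm (u x))\<^sup>2)"
    and "\<aa> = Inf (Gamma_set \<kappa> u)"
    and "\<bb> = Sup (Gamma_set \<kappa> u)"
  shows "\<not> trivial_solution u \<and> Gamma_set \<kappa> u \<noteq> {} \<and> bounded (Gamma_set \<kappa> u) \<and>
    (\<bb> = 0 \<longrightarrow>
      (\<forall>x\<ge>0. ((c, \<kappa>) \<in> D1 \<longrightarrow> \<eta> x = f_inv c \<kappa> x) \<and>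
               ((c, \<kappa>) \<in> D3 \<longrightarrow> \<eta> x = h_inv c \<kappa> x) \<and>
               ((c, \<kappa>) \<in> B_minus \<longrightarrow> \<eta> x = g_inv \<kappa> x) \<and>
               ((c, \<kappa>) \<in> B_plus \<longrightarrow> \<eta> x = g_tilde_inv \<kappa> x)) \<and>
      (\<forall>x\<le>\<aa>. \<eta> x = \<eta> (\<aa> - x)) \<and>
      (\<forall>x \<in> {..<\<aa>} \<union> {0<..}.
         ((c, \<kappa>) \<in> D1 \<union> B_minus \<longrightarrow> 1 - 1 / (2 * \<kappa>) < \<eta> x \<and> \<eta> x < 0) \<and>
         ((c, \<kappa>) \<in> D3 \<union> B_plus \<longrightarrow> 0 < \<eta> x \<and> \<eta> x < 1 - 1 / (2 * \<kappa>))) \<and>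
      (\<exists>\<theta> :: real \<Rightarrow> real. \<forall>x \<in> {..<\<aa>} \<union> {0<..}.
         u x = complex_of_real (sqrt (1 - \<eta> x)) * exp (\<i> * complex_of_real (\<theta> x)) \<and>
         (\<theta> has_real_derivative c * \<eta> x / (2 - 2 * \<eta> x)) (at x)) \<and>
      smooth_on u ({..<\<aa>} \<union> {0<..}) \<and>
      continuous_on UNIV u \<and>
      ((c, \<kappa>) \<in> D1 \<union> B_minus \<longrightarrow>
         filterlim (deriv \<eta>) at_bot (at_left \<aa>) \<and> filterlim (deriv \<eta>) at_top (at_right 0)) \<and>
      ((c, \<kappa>) \<in> D3 \<union> B_plus \<longrightarrow>
         filterlim (deriv \<eta>) at_top (at_left \<aa>) \<and> filterlim (deriv \<eta>) at_bot (at_right 0)) \<and>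
      (\<forall>j. \<exists>C1>0. \<exists>C2>0. \<exists>C3>0. \<forall>x\<ge>1.
         ((c, \<kappa>) \<in> D1 \<union> D3 \<longrightarrow>
            norm (Dn j (Dn 1 u) x) + \<bar>Dn j \<eta> x\<bar> \<le> C1 * exp (- C2 * x)) \<and>
         ((c, \<kappa>) \<in> B_plus \<union> B_minus \<longrightarrow>
            norm (Dn j (Dn 1 u) x) + \<bar>Dn j \<eta> x\<bar> \<le> C3 * x powr (- (2 + real j)))))"
proof -
  interpret W: weak_tw c \<kappa> u
    by unfold_locales (use assms(2) in \<open>simp add: singular_solution_def\<close>)
  have \<eta>: "\<eta> = W.\<eta>" unfolding assms(3) W.\<eta>_def ..
  have D1: "(c, \<kappa>) \<in> D1 \<Longrightarrow> c\<^sup>2 < 2 \<and> 0 < \<kappa> \<and> \<kappa> < 1 / 2"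
    unfolding D1_def using power_strict_mono[of c "sqrt 2" 2] by auto
  have D3: "(c, \<kappa>) \<in> D3 \<Longrightarrow> c\<^sup>2 > 2 \<and> \<kappa> > 1 / 2"
    unfolding D3_def using power_strict_mono[of "sqrt 2" c 2] by auto
  have Bm: "(c, \<kappa>) \<in> B_minus \<Longrightarrow> c\<^sup>2 = 2 \<and> 0 < \<kappa> \<and> \<kappa> < 1 / 2"
    and Bp: "(c, \<kappa>) \<in> B_plus \<Longrightarrow> c\<^sup>2 = 2 \<and> \<kappa> > 1 / 2"
    by (auto simp: B_minus_def B_plus_def)
  have cases: "(c, \<kappa>) \<in> D1 \<or> (c, \<kappa>) \<in> D3 \<or> (c, \<kappa>) \<in> B_minus \<or> (c, \<kappa>) \<in> B_plus"
    using assms(1) by (auto simp: D_tilde_def)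
  have \<kappa>: "\<kappa> > 0" "1 - 2 * \<kappa> \<noteq> 0" "(1 - 2 * \<kappa>) * (2 - c\<^sup>2) \<ge> 0"
    using cases D1 D3 Bm Bp by (force simp: mult_nonneg_nonneg mult_nonpos_nonpos)+
  have \<Gamma>: "Gamma_set \<kappa> u = - W.reg"
    using \<kappa>(1) by (auto simp: Gamma_set_def W.reg_def W.s_def field_simps)
  have closed: "closed (Gamma_set \<kappa> u)"
    unfolding \<Gamma> using W.open_reg by (rule closed_Compl)
  have nonempty: "Gamma_set \<kappa> u \<noteq> {}"
    using W.C2_if_no_singularity assms(2) unfolding \<Gamma> singular_solution_def by auto
  have bounded: "bounded (Gamma_set \<kappa> u)"
  proof -
    have "((\<lambda>x. (norm (u x))\<^sup>2) \<longlongrightarrow> 1\<^sup>2) at_infinity"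
      by (intro tendsto_intros W.norm_u_tendsto)
    \<comment> \<open>\<open>\<kappa>\<close> differs from \<open>1 / 2\<close> in all four regions,
      so the limit 1 of the squared modulus is not the singular level, which is therefore attained
      only on a bounded set.\<close>
    moreover have "1\<^sup>2 \<noteq> 1 / (2 * \<kappa>)" using \<kappa> by (simp add: field_simps)
    ultimately have "\<forall>\<^sub>F x in at_infinity. (norm (u x))\<^sup>2 \<noteq> 1 / (2 * \<kappa>)"
      by (rule tendsto_imp_eventually_ne)
    then obtain X where "\<And>x. X \<le> norm x \<Longrightarrow> (norm (u x))\<^sup>2 \<noteq> 1 / (2 * \<kappa>)"
      by (auto simp: eventually_at_infinity)
    then have "norm x \<le> X" if "x \<in> Gamma_set \<kappa> u" for x
      using that by (auto simp: Gamma_set_def intro: linear[THEN disjE])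
    then show ?thesis unfolding bounded_iff by blast
  qed
  have nontrivial: "\<not> trivial_solution u"
  proof
    assume "trivial_solution u"
    then have "(norm (u x))\<^sup>2 = 1" for x by (auto simp: trivial_solution_def)
    then show False using nonempty \<kappa> by (auto simp: Gamma_set_def field_simps)
  qed
  show ?thesis
  proof (rule conjI[OF nontrivial conjI[OF nonempty conjI[OF bounded impI]]], goal_cases)
    case \<bb>0: 1
    have bdd: "bdd_above (Gamma_set \<kappa> u)" "bdd_below (Gamma_set \<kappa> u)"
      using bounded bounded_imp_bdd_above bounded_imp_bdd_below by auto
    \<comment> \<open>A closed bounded set contains its infimum and supremum; these two points are
      the singular ends of the outer half-lines.\<close>
    have in\<Gamma>: "0 \<in> Gamma_set \<kappa> u" "\<aa> \<in> Gamma_set \<kappa> u"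
      using closed_contains_Sup[OF nonempty bdd(1) closed] closed_contains_Inf[OF nonempty bdd(2) closed]
        assms(4,5) \<bb>0 by auto
    have reg: "x \<in> W.reg" if "x > 0 \<or> x < \<aa>" for x
    proof (rule ccontr)
      assume "x \<notin> W.reg"
      then have "x \<in> Gamma_set \<kappa> u" by (simp add: \<Gamma>)
      then have "\<aa> \<le> x" "x \<le> 0"
        using cInf_lower[OF _ bdd(2)] cSup_upper[OF _ bdd(1)] assms(4,5) \<bb>0 by auto
      then show False using that by auto
    qed
    have \<aa>0: "\<aa> \<le> 0" using cInf_lower[OF in\<Gamma>(1) bdd(2)] assms(4) by simp
    have s0: "W.s 0 = 0" "W.s \<aa> = 0" using in\<Gamma> by (auto simp: \<Gamma> W.reg_def)
    interpret R: profile_wave c \<kappa> \<eta> "\<lambda>x. - 2 * (u x \<bullet> W.V x)" u W.V c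
      using W.profile_half_line[OF \<kappa>, of 1 0] s0(1) reg by (simp add: \<eta>)
    \<comment> \<open>The left half-line, reflected so that its singular end becomes 0; the
      reflection is the reason for the speed \<open>- c\<close>.\<close>
    interpret L: profile_wave c \<kappa> "\<lambda>x. \<eta> (\<aa> - x)" "\<lambda>x. 2 * (u (\<aa> - x) \<bullet> W.V (\<aa> - x))"
        "\<lambda>x. u (\<aa> - x)" "\<lambda>x. - W.V (\<aa> - x)" "- c"
      using W.profile_half_line[OF \<kappa>, of "- 1" \<aa>] s0(2) reg by (simp add: \<eta>)
    have sgn: "(c, \<kappa>) \<in> D1 \<union> B_minus \<Longrightarrow> R.A > 0" "(c, \<kappa>) \<in> D3 \<union> B_plus \<Longrightarrow> R.A < 0"
      "(c, \<kappa>) \<in> D1 \<union> D3 \<Longrightarrow> R.P \<noteq> 0" "(c, \<kappa>) \<in> B_plus \<union> B_minus \<Longrightarrow> R.P = 0"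
      using D1 D3 Bm Bp by (auto simp: R.A_def R.P_def)
    have 1: "((c, \<kappa>) \<in> D1 \<longrightarrow> \<eta> x = f_inv c \<kappa> x) \<and> ((c, \<kappa>) \<in> D3 \<longrightarrow> \<eta> x = h_inv c \<kappa> x) \<and>
        ((c, \<kappa>) \<in> B_minus \<longrightarrow> \<eta> x = g_inv \<kappa> x) \<and> ((c, \<kappa>) \<in> B_plus \<longrightarrow> \<eta> x = g_tilde_inv \<kappa> x)"
      if "x \<ge> 0" for x
      using R.\<zeta>_explicit[OF that] sgn by auto
    \<comment> \<open>On both sides the profile is the same explicit inverse function, evaluated at
      the distance to the singular end.\<close>
    have 2: "\<eta> x = \<eta> (\<aa> - x)" if "x \<le> \<aa>" for x
    proof -
      have y: "\<aa> - x \<ge> 0" using that by simp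
      show ?thesis
        using cases R.\<zeta>_explicit[OF y] L.\<zeta>_explicit[OF y] sgn by auto
    qed
    have 3: "((c, \<kappa>) \<in> D1 \<union> B_minus \<longrightarrow> 1 - 1 / (2 * \<kappa>) < \<eta> x \<and> \<eta> x < 0) \<and>
         ((c, \<kappa>) \<in> D3 \<union> B_plus \<longrightarrow> 0 < \<eta> x \<and> \<eta> x < 1 - 1 / (2 * \<kappa>))"
      if "x \<in> {..<\<aa>} \<union> {0<..}" for x
    proof (cases "x > 0")
      case True
      then show ?thesis using R.\<zeta>_bounds[of x] sgn by blast
    next
      case False
      then have "\<aa> - x > 0" using that by simp
      then show ?thesis using L.\<zeta>_bounds[of "\<aa> - x"] sgn by simp
    qed
    have 4: "\<exists>\<theta> :: real \<Rightarrow> real. \<forall>x \<in> {..<\<aa>} \<union> {0<..}.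
         u x = complex_of_real (sqrt (1 - \<eta> x)) * exp (\<i> * complex_of_real (\<theta> x)) \<and>
         (\<theta> has_real_derivative c * \<eta> x / (2 - 2 * \<eta> x)) (at x)"
    proof -
      obtain \<theta>1 where \<theta>1: "\<And>x. x > 0 \<Longrightarrow> u x = of_real (sqrt (1 - \<eta> x)) * exp (\<i> * of_real (\<theta>1 x))"
        "\<And>x. x > 0 \<Longrightarrow> (\<theta>1 has_real_derivative c * \<eta> x / (2 - 2 * \<eta> x)) (at x)"
        using R.phase_exists by blast
      obtain \<theta>2 where \<theta>2: "\<And>x. x > 0 \<Longrightarrow> u (\<aa> - x) = of_real (sqrt (1 - \<eta> (\<aa> - x))) * exp (\<i> * of_real (\<theta>2 x))"
        "\<And>x. x > 0 \<Longrightarrow> (\<theta>2 has_real_derivative - c * \<eta> (\<aa> - x) / (2 - 2 * \<eta> (\<aa> - x))) (at x)"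
        using L.phase_exists by blast
      \<comment> \<open>The two half-lines are disjoint open sets, so the phases can be glued
        without matching their constants.\<close>
      define \<theta> where "\<theta> = (\<lambda>x. if x > 0 then \<theta>1 x else \<theta>2 (\<aa> - x))"
      show ?thesis
      proof (intro exI[of _ \<theta>] ballI)
        fix x assume x: "x \<in> {..<\<aa>} \<union> {0<..}"
        show "u x = complex_of_real (sqrt (1 - \<eta> x)) * exp (\<i> * complex_of_real (\<theta> x)) \<and>
         (\<theta> has_real_derivative c * \<eta> x / (2 - 2 * \<eta> x)) (at x)"
        proof (cases "x > 0")
          case True
          have "(\<theta> has_real_derivative c * \<eta> x / (2 - 2 * \<eta> x)) (at x)"
            by (rule has_field_derivative_transform_within_open[OF \<theta>1(2)[OF True], of "{0<..}"])
              (use True in \<open>auto simp: \<theta>_def\<close>)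
          then show ?thesis using \<theta>1(1)[OF True] True by (simp add: \<theta>_def)
        next
          case False
          then have x: "x < \<aa>" using x by simp
          have aff: "((\<lambda>x. \<aa> - x) has_real_derivative - 1) (at x)"
            by (auto intro!: derivative_eq_intros)
          have "(\<theta>2 has_real_derivative - c * \<eta> x / (2 - 2 * \<eta> x)) (at (\<aa> - x))"
            using \<theta>2(2)[of "\<aa> - x"] x by simp
          from DERIV_chain2[OF this aff]
          have "((\<lambda>x. \<theta>2 (\<aa> - x)) has_real_derivative c * \<eta> x / (2 - 2 * \<eta> x)) (at x)" by simp
          then have "(\<theta> has_real_derivative c * \<eta> x / (2 - 2 * \<eta> x)) (at x)"
            by (rule has_field_derivative_transform_within_open[of _ _ _ "{..<\<aa>}"])
              (use x \<aa>0 in \<open>auto simp: \<theta>_def\<close>)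
          then show ?thesis using \<theta>2(1)[of "\<aa> - x"] x \<aa>0 by (simp add: \<theta>_def)
        qed
      qed
    qed
    have 5: "smooth_on u ({..<\<aa>} \<union> {0<..})"
    proof (rule smooth_on_Un[OF _ R.smooth_U])
      show "smooth_on u {..<\<aa>}"
        using smooth_on_reflect[OF L.smooth_U, of "{..<\<aa>}" \<aa>] by simp
    qed
    have d_right: "deriv \<eta> x = - 2 * (u x \<bullet> W.V x)" if "x > 0" for x
      by (rule DERIV_imp_deriv[OF R.deriv[OF that]])
    have d_left: "deriv \<eta> x = - (2 * (u x \<bullet> W.V x))" if "x < \<aa>" for x
      unfolding \<eta> using DERIV_imp_deriv[OF W.\<eta>_deriv[OF reg]] that by simp
    have ev: "\<forall>\<^sub>F x in at_right 0. - 2 * (u x \<bullet> W.V x) = deriv \<eta> x"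
      by (auto simp: eventually_at_filter d_right)
    \<comment> \<open>The double reflection stays unsimplified to match the result of composing the
      limit for \<open>L\<close> with the map \<open>\<aa> - x\<close>.\<close>
    have ev': "\<forall>\<^sub>F x in at_left \<aa>. - (2 * (u (\<aa> - (\<aa> - x)) \<bullet> W.V (\<aa> - (\<aa> - x)))) = deriv \<eta> x"
      by (auto simp: eventually_at_filter d_left)
    have reflect: "filterlim (\<lambda>x. \<aa> - x) (at_right 0) (at_left \<aa>)"
      unfolding filterlim_at by (auto intro!: tendsto_eq_intros simp: eventually_at_filter)
    have 6: "filterlim (deriv \<eta>) at_bot (at_left \<aa>) \<and> filterlim (deriv \<eta>) at_top (at_right 0)"
      if "(c, \<kappa>) \<in> D1 \<union> B_minus"
    proof
      show "filterlim (deriv \<eta>) at_top (at_right 0)"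
        by (rule filterlim_mono_eventually[OF R.d_at_0(1)[OF sgn(1)[OF that]] order_refl order_refl ev])
      have "filterlim (\<lambda>x. - (2 * (u (\<aa> - (\<aa> - x)) \<bullet> W.V (\<aa> - (\<aa> - x))))) at_bot (at_left \<aa>)"
        using filterlim_compose[OF L.d_at_0(1)[OF sgn(1)[OF that]] reflect]
        by (simp only: filterlim_uminus_at_bot minus_minus)
      then show "filterlim (deriv \<eta>) at_bot (at_left \<aa>)"
        by (rule filterlim_mono_eventually[OF _ order_refl order_refl ev'])
    qed
    have 7: "filterlim (deriv \<eta>) at_top (at_left \<aa>) \<and> filterlim (deriv \<eta>) at_bot (at_right 0)"
      if "(c, \<kappa>) \<in> D3 \<union> B_plus"
    proof
      show "filterlim (deriv \<eta>) at_bot (at_right 0)"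
        by (rule filterlim_mono_eventually[OF R.d_at_0(2)[OF sgn(2)[OF that]] order_refl order_refl ev])
      have "filterlim (\<lambda>x. - (2 * (u (\<aa> - (\<aa> - x)) \<bullet> W.V (\<aa> - (\<aa> - x))))) at_top (at_left \<aa>)"
        using filterlim_compose[OF L.d_at_0(2)[OF sgn(2)[OF that]] reflect]
        by (simp only: filterlim_uminus_at_top minus_minus)
      then show "filterlim (deriv \<eta>) at_top (at_left \<aa>)"
        by (rule filterlim_mono_eventually[OF _ order_refl order_refl ev'])
    qed
    have 8: "\<exists>C1>0. \<exists>C2>0. \<exists>C3>0. \<forall>x\<ge>1.
         ((c, \<kappa>) \<in> D1 \<union> D3 \<longrightarrow> norm (Dn j (Dn 1 u) x) + \<bar>Dn j \<eta> x\<bar> \<le> C1 * exp (- C2 * x)) \<and>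
         ((c, \<kappa>) \<in> B_plus \<union> B_minus \<longrightarrow> norm (Dn j (Dn 1 u) x) + \<bar>Dn j \<eta> x\<bar> \<le> C3 * x powr (- (2 + real j)))"
      for j
    proof (cases "R.P = 0")
      case True
      then obtain C where "C > 0" "\<forall>x\<ge>1. norm (Dn j (Dn 1 u) x) + \<bar>Dn j \<eta> x\<bar> \<le> C * x powr (- (2 + real j))"
        using R.algebraic_decay by blast
      \<comment> \<open>For \<open>R.P = 0\<close> the exponential estimate has a false premise, so
        its two constants are set to 1; the other case is analogous.\<close>
      then show ?thesis
        using True sgn(3) by (intro exI[of _ 1] conjI exI[of _ C]) auto
    next
      case False
      then obtain C1 C2 where "C1 > 0" "C2 > 0" "\<forall>x\<ge>1. norm (Dn j (Dn 1 u) x) + \<bar>Dn j \<eta> x\<bar> \<le> C1 * exp (- C2 * x)"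
        using R.exp_decay by blast
      then show ?thesis
        using False sgn(4) by (intro exI[of _ C1] conjI exI[of _ C2] exI[of _ 1]) auto
    qed
    show ?case
      by (rule conjI, rule allI, rule impI, rule 1, assumption,
          rule conjI, rule allI, rule impI, rule 2, assumption,
          rule conjI, rule ballI, rule 3, assumption,
          rule conjI, rule 4, rule conjI, rule 5, rule conjI, rule W.cont_u,
          rule conjI, rule impI, rule 6, assumption,
          rule conjI, rule impI, rule 7, assumption, rule allI, rule 8)
  qed
qed

end
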